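(* Let $\gamma>0$ and assume that one of the following conditions holds: (i) $\frac{N}{2s}<p<\frac{N}{s}$, $\alpha,\beta>p$ and $$0<\gamma\le\frac{p_s^*(p_s^*-p)}{p}\min\left\{\frac1\alpha\left(\frac{\alpha-p}{\beta-p}\right)^{\frac{\beta-p}{p}},\ \frac1\beta\left(\frac{\beta-p}{\alpha-p}\right)^{\frac{\alpha-p}{p}}\right\};$$ (ii) $\frac{2N}{N+2s}<p<\frac{N}{2s}$, $\alpha,\beta<p$ and $$\gamma\ge\frac{p_s^*(p_s^*-p)}{p}\max\left\{\frac1\alpha\left(\frac{p-\beta}{p-\alpha}\right)^{\frac{p-\beta}{p}},\ \frac1\beta\left(\frac{p-\alpha}{p-\beta}\right)^{\frac{p-\alpha}{p}}\right\}.$$ Then the least energy $A:=\inf_{(u,v)\in\mathcal N}\mathcal J(u,v)$ equals $$A=\frac sN(k_0+\ell_0)\,\mathcal S^{N/(sp)},$$ and $A$ is attained by $\big(k_0^{1/p}U,\ell_0^{1/p}U\big)$, where $U$ is a minimizer of $\mathcal S$ normalized so that $(-\Delta_p)^sU=U^{p_s^*-1}$, $U>0$ in $\mathbb{R}^N$, and where $(k_0,\ell_0)$ satisfies the algebraic system $$(\ast)\qquad\begin{cases}k^{\frac{p_s^*-p}{p}}+\frac{\alpha\gamma}{p_s^*}k^{\frac{\alpha-p}{p}}\ell^{\frac{\beta}{p}}=1,\\ \ell^{\frac{p_s^*-p}{p}}+\frac{\beta\gamma}{p_s^*}\ell^{\frac{\beta-p}{p}}k^{\frac{\alpha}{p}}=1,\\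 k,\ell>0,\end{cases}$$ and $k_0=\min\{k:(k,\ell)\text{ satisfies }(\ast)\}$.
   Context: Standing assumptions: $N\ge 1$ is an integer, $0<s<1$, $1<p<\infty$, $N>sp$, $p_s^*:=\frac{Np}{N-sp}$, and $\alpha,\beta>1$ are real numbers with $\alpha+\beta=p_s^*$. $\dot W^{s,p}(\mathbb{R}^N)$ is the space of $u\in L^{p_s^*}(\mathbb{R}^N)$ with finite norm $\|u\|_{\dot W^{s,p}}:=\Big(\iint_{\mathbb{R}^{2N}}\frac{|u(x)-u(y)|^p}{|x-y|^{N+sp}}\,dx\,dy\Big)^{1/p}$, and $X:=\dot W^{s,p}(\mathbb{R}^N)\times\dot W^{s,p}(\mathbb{R}^N)$. The operator $(-\Delta_p)^s$ is understood weakly via $\langle(-\Delta_p)^su,\phi\rangle=\iint_{\mathbb{R}^{2N}}\frac{|u(x)-u(y)|^{p-2}(u(x)-u(y))(\phi(x)-\phi(y))}{|x-y|^{N+sp}}\,dx\,dy$ for all $\phi\in\dot W^{s,p}(\mathbb{R}^N)$. The best Sobolev constant is $\mathcal S:=\inf_{u\in\dot W^{s,p}(\mathbb{R}^N),\,u\neq0}\|u\|_{\dot W^{s,p}}^p\big/\big(\int_{\mathbb{R}^N}|u|^{p_s^*}dx\big)^{p/p_s^*}$. The energy functional is, for $(u,v)\in X$, $$\mathcal J(u,v)=\frac1p\left(\|u\|_{\dot W^{s,p}}^p+\|v\|_{\dot W^{s,p}}^p\right)-\frac1{p_s^*}\int_{\mathbb{R}^N}\left(|u|^{p_s^*}+|v|^{p_s^*}+\gamma|u|^\alpha|v|^\beta\right)dx,$$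 and $$\mathcal N=\Big\{(u,v)\in X:u\ne0,\ v\ne0,\ \|u\|_{\dot W^{s,p}}^p=\int_{\mathbb{R}^N}\Big(|u|^{p_s^*}+\frac{\alpha\gamma}{p_s^*}|u|^\alpha|v|^\beta\Big)dx,\ \|v\|_{\dot W^{s,p}}^p=\int_{\mathbb{R}^N}\Big(|v|^{p_s^*}+\frac{\beta\gamma}{p_s^*}|u|^\alpha|v|^\beta\Big)dx\Big\}.$$ *)

theory Defs
  imports "HOL-Analysis.Analysis"
begin

text \<open>
  Elements of Lebesgue and Sobolev spaces are represented by Borel functions on
  \<open>real ^ 'n\<close>; functions that agree almost everywhere represent the same element.
  The space \<open>\<real>\<^sup>N\<close> has \<open>N = CARD('n)\<close>.
\<close>

definition nonzero_ae :: "(real ^ 'n \<Rightarrow> real) \<Rightarrow> bool" where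
  "nonzero_ae u \<longleftrightarrow> \<not> (AE x in lborel. u x = 0)"

definition crit_exp :: "nat \<Rightarrow> real \<Rightarrow> real \<Rightarrow> real" where
  "crit_exp N s p = real N * p / (real N - s * p)"

text \<open>
  On the diagonal \<open>x = y\<close>, a null set, the difference quotients below take the value 0.
\<close>

definition gagliardo_integrand ::
    "real \<Rightarrow> real \<Rightarrow> (real ^ 'n \<Rightarrow> real) \<Rightarrow> (real ^ 'n) \<times> (real ^ 'n) \<Rightarrow> real" where
  "gagliardo_integrand s p u = (\<lambda>(x, y).
     \<bar>u x - u y\<bar> powr p / norm (x - y) powr (real CARD('n) + s * p))"

definition sobolev_space :: "real \<Rightarrow> real \<Rightarrow> (real ^ 'n \<Rightarrow> real) set" where
  "sobolev_space s p = {u. u \<in> borel_measurable borel \<and>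
     integrable lborel (\<lambda>x. \<bar>u x\<bar> powr crit_exp CARD('n) s p) \<and>
     integrable (lborel \<Otimes>\<^sub>M lborel) (gagliardo_integrand s p u)}"

definition sobolev_norm :: "real \<Rightarrow> real \<Rightarrow> (real ^ 'n \<Rightarrow> real) \<Rightarrow> real" where
  "sobolev_norm s p u =
     (LINT z|(lborel \<Otimes>\<^sub>M lborel). gagliardo_integrand s p u z) powr (1 / p)"

text \<open>
  The pairing \<open>\<langle>(-\<Delta>\<^sub>p)\<^sup>s u, \<phi>\<rangle>\<close>. For \<open>p < 2\<close> the convention \<open>0 powr (p - 2) = 0\<close> gives
  \<open>\<bar>t\<bar> powr (p - 2) * t\<close> its usual value 0 at \<open>t = 0\<close>.
\<close>

definition frac_p_laplacian ::
    "real \<Rightarrow> real \<Rightarrow> (real ^ 'n \<Rightarrow> real) \<Rightarrow> (real ^ 'n \<Rightarrow> real) \<Rightarrow> real" where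
  "frac_p_laplacian s p u \<phi> = (LINT (x, y)|(lborel \<Otimes>\<^sub>M lborel).
     \<bar>u x - u y\<bar> powr (p - 2) * (u x - u y) * (\<phi> x - \<phi> y)
       / norm (x - y) powr (real CARD('n) + s * p))"

definition sobolev_quotient :: "real \<Rightarrow> real \<Rightarrow> (real ^ 'n \<Rightarrow> real) \<Rightarrow> real" where
  "sobolev_quotient s p u = sobolev_norm s p u powr p /
     (LINT x|lborel. \<bar>u x\<bar> powr crit_exp CARD('n) s p) powr (p / crit_exp CARD('n) s p)"

definition sobolev_const :: "'n::finite itself \<Rightarrow> real \<Rightarrow> real \<Rightarrow> real" where
  "sobolev_const _ s p =
     (INF u \<in> {u :: real ^ 'n \<Rightarrow> real. u \<in> sobolev_space s p \<and> nonzero_ae u}.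
        sobolev_quotient s p u)"

definition normalized_minimizer :: "real \<Rightarrow> real \<Rightarrow> (real ^ 'n \<Rightarrow> real) \<Rightarrow> bool" where
  "normalized_minimizer s p U \<longleftrightarrow>
     U \<in> sobolev_space s p \<and> nonzero_ae U \<and>
     sobolev_quotient s p U = sobolev_const TYPE('n) s p \<and>
     (\<forall>\<phi> \<in> sobolev_space s p. frac_p_laplacian s p U \<phi> =
        (LINT x|lborel. U x powr (crit_exp CARD('n) s p - 1) * \<phi> x)) \<and>
     (\<forall>x. 0 < U x)"

definition energy :: "real \<Rightarrow> real \<Rightarrow> real \<Rightarrow> real \<Rightarrow> real \<Rightarrow>
    (real ^ 'n \<Rightarrow> real) \<times> (real ^ 'n \<Rightarrow> real) \<Rightarrow> real" where
  "energy s p \<alpha> \<beta> \<gamma> = (\<lambda>(u, v).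
     1 / p * (sobolev_norm s p u powr p + sobolev_norm s p v powr p)
     - 1 / crit_exp CARD('n) s p *
       (LINT x|lborel. \<bar>u x\<bar> powr crit_exp CARD('n) s p + \<bar>v x\<bar> powr crit_exp CARD('n) s p
          + \<gamma> * \<bar>u x\<bar> powr \<alpha> * \<bar>v x\<bar> powr \<beta>))"

definition nehari_set :: "real \<Rightarrow> real \<Rightarrow> real \<Rightarrow> real \<Rightarrow> real \<Rightarrow>
    ((real ^ 'n \<Rightarrow> real) \<times> (real ^ 'n \<Rightarrow> real)) set" where
  "nehari_set s p \<alpha> \<beta> \<gamma> = {(u, v).
     u \<in> sobolev_space s p \<and> v \<in> sobolev_space s p \<and> nonzero_ae u \<and> nonzero_ae v \<and>
     sobolev_norm s p u powr p =
       (LINT x|lborel. \<bar>u x\<bar> powr crit_exp CARD('n) s p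
          + \<alpha> * \<gamma> / crit_exp CARD('n) s p * \<bar>u x\<bar> powr \<alpha> * \<bar>v x\<bar> powr \<beta>) \<and>
     sobolev_norm s p v powr p =
       (LINT x|lborel. \<bar>v x\<bar> powr crit_exp CARD('n) s p
          + \<beta> * \<gamma> / crit_exp CARD('n) s p * \<bar>u x\<bar> powr \<alpha> * \<bar>v x\<bar> powr \<beta>)}"

definition least_energy ::
    "'n::finite itself \<Rightarrow> real \<Rightarrow> real \<Rightarrow> real \<Rightarrow> real \<Rightarrow> real \<Rightarrow> real" where
  "least_energy _ s p \<alpha> \<beta> \<gamma> =
     (INF w \<in> (nehari_set s p \<alpha> \<beta> \<gamma> :: ((real ^ 'n \<Rightarrow> real) \<times> (real ^ 'n \<Rightarrow> real)) set).
        energy s p \<alpha> \<beta> \<gamma> w)"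

text \<open>In the algebraic system the parameter \<open>q\<close> stands for the critical exponent.\<close>

definition alg_system ::
    "real \<Rightarrow> real \<Rightarrow> real \<Rightarrow> real \<Rightarrow> real \<Rightarrow> real \<Rightarrow> real \<Rightarrow> bool" where
  "alg_system q p \<alpha> \<beta> \<gamma> k l \<longleftrightarrow>
     k powr ((q - p) / p) + \<alpha> * \<gamma> / q * k powr ((\<alpha> - p) / p) * l powr (\<beta> / p) = 1 \<and>
     l powr ((q - p) / p) + \<beta> * \<gamma> / q * l powr ((\<beta> - p) / p) * k powr (\<alpha> / p) = 1 \<and>
     0 < k \<and> 0 < l"

definition min_alg_solution ::
    "real \<Rightarrow> real \<Rightarrow> real \<Rightarrow> real \<Rightarrow> real \<Rightarrow> real \<Rightarrow> real \<Rightarrow> bool" where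
  "min_alg_solution q p \<alpha> \<beta> \<gamma> k\<^sub>0 l\<^sub>0 \<longleftrightarrow>
     alg_system q p \<alpha> \<beta> \<gamma> k\<^sub>0 l\<^sub>0 \<and>
     (\<forall>k l. alg_system q p \<alpha> \<beta> \<gamma> k l \<longrightarrow> k\<^sub>0 \<le> k)"

end

theory Submission
  imports Defs "HOL-Complex_Analysis.Great_Picard"
begin

text \<open>
  Putting \<open>t = l / k\<close>, both equations of the algebraic system are homogeneous in \<open>(k, l)\<close>. The
  hypothesis on \<open>\<gamma>\<close> says exactly that, after division by \<open>(k + l)\<close> to the power \<open>(q - p) / p\<close>,
  the two left-hand sides are monotone in \<open>t\<close> in opposite directions. Hence their graphs cross exactly
  once, and the crossing minimizes \<open>k + l\<close> among all pairs for which both left-hand sides are at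
  least \<open>1\<close>. By the inequalities of Hoelder and Sobolev, every pair in the Nehari set gives such a
  \<open>(k, l)\<close>.

  A minimizer of the Sobolev quotient is found as follows. Comparing \<open>u x\<close> with its mean over a ball
  bounds \<open>\<bar>u x\<bar>\<close> by a product of powers of the local energy at \<open>x\<close> and of a Morrey-type constant of
  \<open>u\<close>. So the members of a minimizing sequence can be translated and dilated to have a fixed amount of
  mass in the unit ball; averages over small balls give convergence almost everywhere to a nonzero
  limit, and the Brezis-Lieb lemma together with strict concavity of \<open>t \<mapsto> t powr (p / q)\<close>
  shows that no mass is lost. The minimizer is positive because replacing \<open>u\<close> by the maximum of \<open>u\<close>
  and \<open>\<epsilon>\<close> times a cutoff function changes the energy by \<open>O(\<epsilon> powr p) - c * \<epsilon>\<close> with \<open>c > 0\<close> if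
  \<open>u\<close> vanishes on a set of positive measure.
\<close>

section \<open>The algebraic system\<close>

text \<open>The formula for the least energy does not mention \<open>U\<close>, but that its value
  is taken rests on a normalized minimizer, which therefore has to be constructed. The obstacle is
  that the maps u(x) -> R^(N/q) u(a + R x) preserve both \<open>B\<close> and \<open>E\<close>,
  because N/q = N/p - s, so a minimizing sequence can spread out or concentrate. The supremum of
  R^(N/q - N) times the integral of |u| over a ball of radius R is invariant under the same maps,
  and \<open>improved_Sobolev\<close> bounds B u by its power q - p times E u; so it stays away from
  0 along a minimizing sequence with B u = 1. No weak convergence enters: E u is the integral of
  |\<open>diff_quot\<close> u|^p over the product space, so almost everywhere convergence passes to
  the quotients and the Brezis-Lieb lemma applies to both integrals alike. The constants in the
  hypothesis on \<gamma> come from one-variable calculus: the derivative of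
  \<open>log_ratio A b r\<close> has the sign of A t^b (b + 1 - a t) - r, whose extremum over t > 0,
  at t = b/a, is A (b/a)^b - r.\<close>

lemma Bernoulli_powr_neg:
  fixes w c :: real
  assumes "0 < w" "w \<noteq> 1" "c < 0"
  shows "1 + c * (w - 1) < w powr c"
proof (cases "1 + c * (w - 1) \<le> 0")
  case True
  then show ?thesis using assms by (simp add: order_le_less_trans)
next
  case False
  define m where "m = 1 + c * (w - 1)"
  have m: "0 < m" using False m_def by simp
  have "ln w < w - 1" using ln_le_minus_one[of w] ln_eq_minus_one[of w] assms by fastforce
  then have "(-c) * ln w < (-c) * (w - 1)" using assms(3) by (intro mult_strict_left_mono) auto
  moreover have "ln m \<le> m - 1" using m by (rule ln_le_minus_one)
  ultimately have "ln m < c * ln w" by (simp add: m_def)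
  then have "m < exp (c * ln w)" using m by (metis exp_less_cancel_iff exp_ln)
  then show ?thesis using assms by (simp add: powr_def m_def)
qed

lemma Bernoulli_powr_less:
  fixes w c :: real
  assumes "0 < w" "w \<noteq> 1" "0 < c" "c < 1"
  shows "w powr c < 1 + c * (w - 1)"
proof -
  define m where "m = 1 + c * (w - 1)"
  \<comment> \<open>m is the weighted mean of w and 1. The tangents of \<open>ln\<close> at m,
    weighted with c and 1 - c, give c ln w < ln m, strictly because w differs from m.\<close>
  have m_eq: "m = c * w + (1 - c)" by (simp add: m_def algebra_simps)
  have m: "0 < m" unfolding m_eq using assms by (intro add_pos_pos) auto
  have "w \<noteq> m"
  proof
    assume "w = m"
    then have "(1 - c) * (w - 1) = 0" unfolding m_def by (simp add: algebra_simps)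
    then show False using assms by simp
  qed
  then have "ln (w / m) < w / m - 1"
    using ln_le_minus_one[of "w / m"] ln_eq_minus_one[of "w / m"] assms m by fastforce
  then have "c * ln (w / m) < c * (w / m - 1)" using assms by (intro mult_strict_left_mono) auto
  moreover have "(1 - c) * ln (1 / m) \<le> (1 - c) * (1 / m - 1)"
    using ln_le_minus_one[of "1 / m"] m assms by (intro mult_left_mono) auto
  moreover have "c * (w / m - 1) + (1 - c) * (1 / m - 1) = 0"
    using m by (simp add: field_simps m_eq)
  ultimately have "c * ln w < ln m" using m assms
    by (simp add: ln_div ring_distribs)
  then have "exp (c * ln w) < m" using m by (metis exp_less_cancel_iff exp_ln)
  then show ?thesis using assms by (simp add: powr_def m_def)
qed

text \<open>Taking logarithms separates ln (k + l) from the ratio t: each equation of the system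
  becomes r ln (k + l) plus such a function of the ratio equal to 0.\<close>

definition log_ratio :: "real \<Rightarrow> real \<Rightarrow> real \<Rightarrow> real \<Rightarrow> real" where
  "log_ratio A b r t = ln (1 + A * t powr (b + 1)) - r * ln (1 + t)"

lemma log_ratio_deriv:
  assumes "0 < t" "0 < A"
  shows "(log_ratio A b r has_real_derivative
     (A * t powr b * (b + 1 - (r - b - 1) * t) - r) / ((1 + A * t powr (b + 1)) * (1 + t))) (at t)"
proof -
  have p: "0 < 1 + A * t powr (b + 1)" using assms by (simp add: add_pos_nonneg)
  have "(log_ratio A b r has_real_derivative
     (A * ((b + 1) * t powr b)) / (1 + A * t powr (b + 1)) - r * (1 / (1 + t))) (at t)"
    unfolding log_ratio_def using assms p
    by (auto intro!: derivative_eq_intros simp: field_simps)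
  moreover have "(A * ((b + 1) * t powr b)) / (1 + A * t powr (b + 1)) - r * (1 / (1 + t))
     = (A * t powr b * (b + 1 - (r - b - 1) * t) - r) / ((1 + A * t powr (b + 1)) * (1 + t))"
    using p assms by (simp add: divide_simps) (simp add: powr_add algebra_simps)
  ultimately show ?thesis by simp
qed

text \<open>Rescaling by w = t a / b puts the critical point t = b / a at w = 1, the point of
  equality in Bernoulli's inequality, and splits off the extremal value A (b/a)^b.\<close>

lemma log_ratio_factor:
  fixes a b t A :: real
  assumes "0 < t" "a / b > 0"
  shows "A * t powr b * (b + 1 - a * t)
    = A * (b / a) powr b * (t * a / b) powr b * (1 - b * (t * a / b - 1))"
proof -
  have nz: "a \<noteq> 0" "b \<noteq> 0" using assms by (auto simp: zero_less_divide_iff)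
  have "(b / a) powr b * (t * a / b) powr b = ((b / a) * (t * a / b)) powr b"
    using assms by (subst powr_mult) (auto simp: zero_less_divide_iff zero_le_divide_iff zero_le_mult_iff)
  also have "(b / a) * (t * a / b) = t" using nz by simp
  finally have "A * (b / a) powr b * (t * a / b) powr b = A * t powr b" by simp
  moreover have "1 - b * (t * a / b - 1) = b + 1 - a * t" using nz by (simp add: field_simps)
  ultimately show ?thesis by metis
qed

text \<open>The bound on \<gamma> admits equality, and then the derivative vanishes at the single
  point m = b / a; strict monotonicity survives by splitting the interval there.\<close>

lemma deriv_neg_except_point:
  fixes f f' :: "real \<Rightarrow> real"
  assumes d: "\<And>t. 0 < t \<Longrightarrow> (f has_real_derivative f' t) (at t)"
    and n: "\<And>t. 0 < t \<Longrightarrow> t \<noteq> m \<Longrightarrow> f' t < 0"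
    and xy: "0 < x" "x < y"
  shows "f y < f x"
proof -
  have *: "f y < f x" if "0 < x" "x < y" "m \<notin> {x<..<y}" for x y
  proof (rule DERIV_neg_imp_decreasing_open[OF that(2)])
    show "\<exists>z. (f has_real_derivative z) (at t) \<and> z < 0" if "x < t" "t < y" for t
      using d[of t] n[of t] that \<open>0 < x\<close> \<open>m \<notin> {x<..<y}\<close> by force
    show "continuous_on {x..y} f"
      using d \<open>0 < x\<close> by (intro DERIV_continuous_on[where D=f']) (auto intro: has_field_derivative_at_within)
  qed
  show ?thesis
  proof (cases "m \<in> {x<..<y}")
    case True
    then have "f m < f x" "f y < f m" using *[of x m] *[of m y] xy by auto
    then show ?thesis by simp
  qed (use * xy in blast)
qed

lemma log_ratio_strict_decreasing:
  assumes "0 < a" "0 < b" "0 < A" "A \<le> (a + b + 1) * (a / b) powr b" "0 < x" "x < y"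
  shows "log_ratio A b (a + b + 1) y < log_ratio A b (a + b + 1) x"
proof (rule deriv_neg_except_point[where m = "b / a" and f = "log_ratio A b (a + b + 1)" and f' = "\<lambda>t.
    (A * t powr b * (b + 1 - ((a + b + 1) - b - 1) * t) - (a + b + 1)) / ((1 + A * t powr (b + 1)) * (1 + t))"])
  fix t :: real
  assume t: "0 < t" "t \<noteq> b / a"
  define w where "w = t * a / b"
  have w: "0 < w" "w \<noteq> 1" using t assms by (auto simp: w_def field_simps)
  \<comment> \<open>Bernoulli's inequality with exponent -b < 0 shows that w = 1 is a strict
    maximum, with value 1.\<close>
  have "w powr b * (1 - b * (w - 1)) < w powr b * w powr (-b)"
    using Bernoulli_powr_neg[of w "-b"] w assms by (intro mult_strict_left_mono) auto
  also have "\<dots> = 1" using w by (simp flip: powr_add)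
  finally have 1: "w powr b * (1 - b * (w - 1)) < 1" .
  have "A * (b / a) powr b \<le> (a + b + 1) * (a / b) powr b * (b / a) powr b"
    using assms by (intro mult_right_mono) auto
  also have "\<dots> = a + b + 1" using assms by (simp flip: powr_mult)
  finally have 2: "A * (b / a) powr b \<le> a + b + 1" .
  have "A * t powr b * (b + 1 - a * t) = A * (b / a) powr b * (w powr b * (1 - b * (w - 1)))"
    using log_ratio_factor[of t a b A] t assms by (simp add: w_def)
  also have "\<dots> < A * (b / a) powr b * 1" using 1 assms by (intro mult_strict_left_mono) auto
  finally have "A * t powr b * (b + 1 - a * t) - (a + b + 1) < 0" using 2 by simp
  moreover have "(1 + A * t powr (b + 1)) * (1 + t) > 0"
    using assms t by (intro mult_pos_pos add_pos_nonneg) auto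
  ultimately show "(A * t powr b * (b + 1 - ((a + b + 1) - b - 1) * t) - (a + b + 1)) / ((1 + A * t powr (b + 1)) * (1 + t)) < 0"
    by (simp add: divide_neg_pos)
next
  show "(log_ratio A b (a + b + 1) has_real_derivative
      (A * t powr b * (b + 1 - (a + b + 1 - b - 1) * t) - (a + b + 1)) / ((1 + A * t powr (b + 1)) * (1 + t))) (at t)" if "0 < t" for t
    using that assms by (intro log_ratio_deriv) auto
qed (use assms in auto)

text \<open>Here a / b is still positive, but -b lies between 0 and 1, so Bernoulli's inequality
  reverses and b / a becomes a strict minimum of A t^b (b + 1 - a t).\<close>

lemma log_ratio_strict_increasing:
  assumes "a < 0" "-1 < b" "b < 0" "0 < a + b + 1" "0 < A" "(a + b + 1) * (a / b) powr b \<le> A" "0 < x" "x < y"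
  shows "log_ratio A b (a + b + 1) x < log_ratio A b (a + b + 1) y"
proof -
  have "- log_ratio A b (a + b + 1) y < - log_ratio A b (a + b + 1) x"
  proof (rule deriv_neg_except_point[where m = "b / a" and f = "\<lambda>t. - log_ratio A b (a + b + 1) t" and f' = "\<lambda>t.
      - ((A * t powr b * (b + 1 - ((a + b + 1) - b - 1) * t) - (a + b + 1)) / ((1 + A * t powr (b + 1)) * (1 + t)))"])
    fix t :: real
    assume t: "0 < t" "t \<noteq> b / a"
    define w where "w = t * a / b"
    have ab: "a / b > 0" "b / a > 0" using assms by (auto simp: zero_less_divide_iff)
    have w: "0 < w" using mult_pos_pos[OF t(1) ab(1)] by (simp add: w_def)
    have "w \<noteq> 1" using t assms by (auto simp: w_def field_simps)
    note w = w this
    have "w powr b * w powr (-b) < w powr b * (1 - b * (w - 1))"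
      using Bernoulli_powr_less[of w "-b"] w assms by (intro mult_strict_left_mono) auto
    moreover have "w powr b * w powr (-b) = 1" using w by (simp flip: powr_add)
    ultimately have 1: "1 < w powr b * (1 - b * (w - 1))" by simp
    have "(a / b) powr b * (b / a) powr b = ((a / b) * (b / a)) powr b"
      by (rule powr_mult[symmetric])
    also have "\<dots> = 1" using assms by simp
    finally have "a + b + 1 = (a + b + 1) * (a / b) powr b * (b / a) powr b" by simp
    also have "\<dots> \<le> A * (b / a) powr b"
      using assms by (intro mult_right_mono) auto
    finally have 2: "a + b + 1 \<le> A * (b / a) powr b" .
    have "A * (b / a) powr b * 1 < A * (b / a) powr b * (w powr b * (1 - b * (w - 1)))"
      using 1 assms by (intro mult_strict_left_mono) auto
    also have "\<dots> = A * t powr b * (b + 1 - a * t)"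
      using log_ratio_factor[of t a b A] t ab by (metis w_def mult.assoc)
    finally have "A * t powr b * (b + 1 - a * t) - (a + b + 1) > 0" using 2 by simp
    moreover have "(1 + A * t powr (b + 1)) * (1 + t) > 0"
      using assms t by (intro mult_pos_pos add_pos_nonneg) auto
    ultimately show "- ((A * t powr b * (b + 1 - ((a + b + 1) - b - 1) * t) - (a + b + 1)) / ((1 + A * t powr (b + 1)) * (1 + t))) < 0"
      by simp
  next
    show "((\<lambda>t. - log_ratio A b (a + b + 1) t) has_real_derivative
         - ((A * t powr b * (b + 1 - (a + b + 1 - b - 1) * t) - (a + b + 1)) / ((1 + A * t powr (b + 1)) * (1 + t)))) (at t)" if "0 < t" for t
      using that assms by (intro DERIV_minus log_ratio_deriv) auto
  qed (use assms in auto)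
  then show ?thesis by simp
qed

text \<open>For t \<ge> 1 the function is at most ln (1 + A) - a ln t, since r - (b + 1) = a; T is
  chosen so that a ln t exceeds ln (1 + A) - c.\<close>

lemma log_ratio_far_neg:
  assumes "0 < a" "0 < A" "-1 < b" "0 < a + b + 1"
  shows "\<exists>T\<ge>1. \<forall>t\<ge>T. log_ratio A b (a + b + 1) t < c"
proof -
  define T where "T = max 1 (exp ((ln (1 + A) - c) / a + 1))"
  have "log_ratio A b (a + b + 1) t < c" if t: "T \<le> t" for t
  proof -
    have t1: "1 \<le> t" "exp ((ln (1 + A) - c) / a + 1) \<le> t" using t T_def by auto
    then have "(ln (1 + A) - c) / a + 1 \<le> ln t" by (metis ln_exp ln_mono exp_gt_zero)
    then have "a * ((ln (1 + A) - c) / a + 1) \<le> a * ln t" using assms by (intro mult_left_mono) auto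
    then have 1: "ln (1 + A) - c + a \<le> a * ln t" using assms by (simp add: distrib_left)
    have "1 \<le> t powr (b + 1)" using t1 assms by (intro ge_one_powr_ge_zero) auto
    then have "1 + A * t powr (b + 1) \<le> (1 + A) * t powr (b + 1)" by (simp add: algebra_simps)
    then have "ln (1 + A * t powr (b + 1)) \<le> ln ((1 + A) * t powr (b + 1))"
      using assms by (intro ln_mono) (auto intro: add_pos_nonneg)
    also have "\<dots> = ln (1 + A) + (b + 1) * ln t" using t1 assms by (simp add: ln_mult ln_powr)
    finally have "ln (1 + A * t powr (b + 1)) \<le> ln (1 + A) + (b + 1) * ln t" .
    moreover have "(a + b + 1) * ln t \<le> (a + b + 1) * ln (1 + t)"
      using t1 assms by (intro mult_left_mono ln_mono) auto
    ultimately have "log_ratio A b (a + b + 1) t \<le> ln (1 + A) - a * ln t"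
      unfolding log_ratio_def by (simp add: algebra_simps)
    then show ?thesis using 1 assms by linarith
  qed
  then show ?thesis by (intro exI[of _ T]) (auto simp: T_def)
qed

lemma log_ratio_far_pos:
  assumes "a < 0" "0 < A" "-1 < b" "0 < a + b + 1"
  shows "\<exists>T\<ge>1. \<forall>t\<ge>T. c < log_ratio A b (a + b + 1) t"
proof -
  \<comment> \<open>D collects the constants of the lower bound D - a ln t, obtained for t \<ge> 1
    by replacing 1 + t by 2 t.\<close>
  define D where "D = ln A - (a + b + 1) * ln 2"
  define T where "T = max 1 (exp ((c - D) / (- a) + 1))"
  have "c < log_ratio A b (a + b + 1) t" if t: "T \<le> t" for t
  proof -
    have t1: "1 \<le> t" "exp ((c - D) / (- a) + 1) \<le> t" using t T_def by auto
    then have "(c - D) / (- a) + 1 \<le> ln t" by (metis ln_exp ln_mono exp_gt_zero)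
    then have "(- a) * ((c - D) / (- a) + 1) \<le> (- a) * ln t" using assms by (intro mult_left_mono) auto
    moreover have "(- a) * ((c - D) / (- a) + 1) = c - D - a" using assms by (simp add: field_simps)
    ultimately have 1: "c - D - a \<le> (- a) * ln t" by simp
    have "ln A + (b + 1) * ln t = ln (A * t powr (b + 1))" using t1 assms by (simp add: ln_mult ln_powr)
    also have "\<dots> \<le> ln (1 + A * t powr (b + 1))" using assms t1 by (intro ln_mono) auto
    finally have "ln A + (b + 1) * ln t \<le> ln (1 + A * t powr (b + 1))" .
    moreover have "(a + b + 1) * ln (1 + t) \<le> (a + b + 1) * ln (2 * t)"
      using t1 assms by (intro mult_left_mono ln_mono) auto
    moreover have "ln (2 * t) = ln 2 + ln t" using t1 by (simp add: ln_mult)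
    ultimately have "D - a * ln t \<le> log_ratio A b (a + b + 1) t"
      unfolding log_ratio_def D_def by (simp add: algebra_simps)
    then show ?thesis using 1 assms by linarith
  qed
  then show ?thesis by (intro exI[of _ T]) (auto simp: T_def)
qed

lemma log_ratio_near_lower:
  assumes "0 < A" "0 \<le> t" "t \<le> 1" "0 < r"
  shows "- (r * ln 2) \<le> log_ratio A b r t"
proof -
  have "r * ln (1 + t) \<le> r * ln 2" using assms by (intro mult_left_mono ln_mono) auto
  moreover have "0 \<le> ln (1 + A * t powr (b + 1))" using assms by (intro ln_ge_zero) auto
  ultimately show ?thesis unfolding log_ratio_def by linarith
qed

lemma log_ratio_near_upper:
  assumes "0 < A" "0 \<le> t" "t \<le> 1" "0 < r" "-1 < b"
  shows "log_ratio A b r t \<le> ln (1 + A)"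
proof -
  have "t powr (b + 1) \<le> 1" using assms by (intro powr_le1) auto
  then have "A * t powr (b + 1) \<le> A" using assms by simp
  then have "ln (1 + A * t powr (b + 1)) \<le> ln (1 + A)"
    using assms by (intro ln_mono) (auto intro: add_pos_nonneg)
  moreover have "0 \<le> r * ln (1 + t)" using assms by (intro mult_nonneg_nonneg) auto
  ultimately show ?thesis unfolding log_ratio_def by linarith
qed

lemma continuous_on_log_ratio:
  assumes "0 < A"
  shows "continuous_on {0<..} (log_ratio A b r)"
  using log_ratio_deriv[OF _ assms]
  by (intro DERIV_continuous_on) (auto intro: has_field_derivative_at_within)

section \<open>Two functions monotone in opposite directions and their crossing\<close>

definition opposite_monotone :: "(real \<Rightarrow> real) \<Rightarrow> (real \<Rightarrow> real) \<Rightarrow> bool" where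
  "opposite_monotone P Q \<longleftrightarrow>
     (\<forall>x y. 0 < x \<longrightarrow> x < y \<longrightarrow> P y < P x \<and> Q x < Q y) \<or>
     (\<forall>x y. 0 < x \<longrightarrow> x < y \<longrightarrow> P x < P y \<and> Q y < Q x)"

lemma opposite_monotone_min:
  assumes "opposite_monotone P Q" "0 < t" "0 < u" "P u = Q u" "P u \<le> P t" "P u \<le> Q t"
  shows "t = u"
  using assms unfolding opposite_monotone_def
  by (metis linorder_neqE_linordered_idom order_less_le_trans less_irrefl)

text \<open>Moving away from the crossing u lowers one of the two functions, so u maximizes their
  minimum. This is what later makes the crossing minimize k + l.\<close>

lemma opposite_monotone_max:
  assumes "opposite_monotone P Q" "0 < t" "0 < u" "P u = Q u"
  shows "P t \<le> P u \<or> Q t \<le> P u"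
  using assms unfolding opposite_monotone_def
  by (metis linorder_neqE_linordered_idom less_imp_le order_refl)

text \<open>At a large T the first function has passed a bound that the second one, evaluated at 1 /
  T \<le> 1, respects; at 1 / T the roles are exchanged. Hence the difference changes sign and the
  intermediate value theorem applies.\<close>

lemma log_ratio_crossing:
  assumes AB: "0 < A" "0 < B" and r: "r = a + b + 1" "0 < r"
    and cond: "(0 < a \<and> 0 < b) \<or> (-1 < a \<and> a < 0 \<and> -1 < b \<and> b < 0)"
  shows "\<exists>t>0. log_ratio A b r t = log_ratio B a r (1 / t)"
proof -
  define F where "F t = log_ratio A b r t - log_ratio B a r (1 / t)" for t
  have r': "r = b + a + 1" "0 < a + b + 1" "0 < b + a + 1" using r by auto
  have cont: "continuous_on {1/T..T} F" if "1 \<le> T" for T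
  proof -
    have pos: "0 < x" if "x \<in> {1/T..T}" for x
    proof -
      have "0 < 1 / T" using \<open>1 \<le> T\<close> by simp
      also have "1 / T \<le> x" using that by simp
      finally show ?thesis .
    qed
    show ?thesis unfolding F_def
    proof (intro continuous_on_diff)
      show "continuous_on {1/T..T} (log_ratio A b r)"
        using continuous_on_subset[OF continuous_on_log_ratio[OF AB(1)]] pos by blast
      show "continuous_on {1/T..T} (\<lambda>t. log_ratio B a r (1 / t))"
        using continuous_on_log_ratio[OF AB(2)]
        by (rule continuous_on_compose2)
           (use pos in \<open>force intro!: continuous_intros\<close>)+
    qed
  qed
  from cond show ?thesis
  proof
    assume ab: "0 < a \<and> 0 < b"
    obtain T1 where T1: "T1 \<ge> 1" "\<forall>t\<ge>T1. log_ratio A b r t < - (r * ln 2)"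
      using log_ratio_far_neg[of a A b "- (r * ln 2)", folded r(1)] ab AB r by auto
    obtain T2 where T2: "T2 \<ge> 1" "\<forall>t\<ge>T2. log_ratio B a r t < - (r * ln 2)"
      using log_ratio_far_neg[of b B a "- (r * ln 2)", folded r'(1)] ab AB r by auto
    define T where "T = max T1 T2"
    have T: "T \<ge> 1" using T1 T_def by auto
    have "F T < 0" unfolding F_def
      using T1(2)[rule_format, of T] log_ratio_near_lower[of B "1 / T" r a] T AB r by (simp add: T_def)
    moreover have "0 < F (1 / T)" unfolding F_def
      using T2(2)[rule_format, of T] log_ratio_near_lower[of A "1 / T" r b] T AB r by (simp add: T_def)
    moreover have "1 / T \<le> T" using T by (simp add: field_simps mult_ge1_I)
    ultimately obtain x where "x \<ge> 1 / T" "x \<le> T" "F x = 0"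
      using IVT2'[of F T 0 "1 / T"] cont[OF T] by auto
    moreover from this have "0 < x" using T by (intro less_le_trans[of 0 "1 / T" x]) auto
    ultimately show ?thesis by (auto simp: F_def)
  next
    assume ab: "-1 < a \<and> a < 0 \<and> -1 < b \<and> b < 0"
    obtain T1 where T1: "T1 \<ge> 1" "\<forall>t\<ge>T1. ln (1 + B) < log_ratio A b r t"
      using log_ratio_far_pos[of a A b "ln (1 + B)", folded r(1)] ab AB r by auto
    obtain T2 where T2: "T2 \<ge> 1" "\<forall>t\<ge>T2. ln (1 + A) < log_ratio B a r t"
      using log_ratio_far_pos[of b B a "ln (1 + A)", folded r'(1)] ab AB r by auto
    define T where "T = max T1 T2"
    have T: "T \<ge> 1" using T1 T_def by auto
    have "F T > 0" unfolding F_def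
      using T1(2)[rule_format, of T] log_ratio_near_upper[of B "1 / T" r a] T AB r ab by (simp add: T_def)
    moreover have "0 > F (1 / T)" unfolding F_def
      using T2(2)[rule_format, of T] log_ratio_near_upper[of A "1 / T" r b] T AB r ab by (simp add: T_def)
    moreover have "1 / T \<le> T" using T by (simp add: field_simps mult_ge1_I)
    ultimately obtain x where "x \<ge> 1 / T" "x \<le> T" "F x = 0"
      using IVT'[of F "1 / T" 0 T] cont[OF T] by auto
    moreover from this have "0 < x" using T by (intro less_le_trans[of 0 "1 / T" x]) auto
    ultimately show ?thesis by (auto simp: F_def)
  qed
qed


section \<open>From the ratio back to the pair (k, l)\<close>

lemma alg_expr_log_ratio:
  fixes k l A a b r :: real
  assumes "0 < k" "0 < l" "0 < A" "r = a + b + 1"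
  shows "k powr r + A * k powr a * l powr (b + 1) = exp (r * ln (k + l) + log_ratio A b r (l / k))"
proof -
  have pos: "0 < 1 + A * (l / k) powr (b + 1)" using assms by (auto intro: add_pos_nonneg)
  have "ln (k + l) = ln k + ln (1 + l / k)"
    using assms by (subst ln_mult_pos[symmetric]) (auto simp: field_simps add_pos_pos)
  then have "r * ln (k + l) + log_ratio A b r (l / k) = r * ln k + ln (1 + A * (l / k) powr (b + 1))"
    by (simp add: log_ratio_def algebra_simps)
  then have "exp (r * ln (k + l) + log_ratio A b r (l / k)) = k powr r * (1 + A * (l / k) powr (b + 1))"
    using assms pos by (simp add: exp_add powr_def)
  also have "\<dots> = k powr r + A * (k powr r / k powr (b + 1)) * l powr (b + 1)"
    using assms by (simp add: powr_divide algebra_simps)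
  also have "k powr r / k powr (b + 1) = k powr a"
    using assms by (simp flip: powr_diff)
  finally show ?thesis by simp
qed

context
  fixes p q \<alpha> \<beta> \<gamma> :: real
  assumes pos: "0 < p" "0 < \<alpha>" "0 < \<beta>" "0 < \<gamma>" and q: "\<alpha> + \<beta> = q" "p < q"
    and cond:
      "(p < \<alpha> \<and> p < \<beta> \<and>
        \<gamma> \<le> q * (q - p) / p *
          min (1 / \<alpha> * ((\<alpha> - p) / (\<beta> - p)) powr ((\<beta> - p) / p))
              (1 / \<beta> * ((\<beta> - p) / (\<alpha> - p)) powr ((\<alpha> - p) / p))) \<or>
       (\<alpha> < p \<and> \<beta> < p \<and>
        q * (q - p) / p *
          max (1 / \<alpha> * ((p - \<beta>) / (p - \<alpha>)) powr ((p - \<beta>) / p))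
              (1 / \<beta> * ((p - \<alpha>) / (p - \<beta>)) powr ((p - \<alpha>) / p)) \<le> \<gamma>)"
begin

text \<open>With these exponents \<alpha> / p = a + 1, \<beta> / p = b + 1 and r = a + b + 1, so the
  system reads k^r + A k^a l^(b+1) = 1 and l^r + B l^b k^(a+1) = 1. The second equation is the first
  with (k, a, A) and (l, b, B) exchanged, hence the argument 1 / t in \<open>Q\<close>.\<close>

private definition "a = (\<alpha> - p) / p"
private definition "b = (\<beta> - p) / p"
private definition "r = (q - p) / p"
private definition "A = \<alpha> * \<gamma> / q"
private definition "B = \<beta> * \<gamma> / q"
private definition "P = log_ratio A b r"
private definition "Q t = log_ratio B a r (1 / t)"

private lemma r: "r = a + b + 1" "r = b + a + 1" "0 < r"
  unfolding r_def a_def b_def using pos q(2) unfolding q(1)[symmetric] by (simp_all add: field_simps)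

private lemma AB: "0 < A" "0 < B"
  using pos q by (simp_all add: A_def B_def)

private lemma sgn_ab: "(0 < a \<and> 0 < b) \<or> (-1 < a \<and> a < 0 \<and> -1 < b \<and> b < 0)"
  using cond pos by (auto simp: a_def b_def field_simps)

private lemma opposite: "opposite_monotone P Q"
  using cond
proof
  assume c: "p < \<alpha> \<and> p < \<beta> \<and>
        \<gamma> \<le> q * (q - p) / p *
          min (1 / \<alpha> * ((\<alpha> - p) / (\<beta> - p)) powr ((\<beta> - p) / p))
              (1 / \<beta> * ((\<beta> - p) / (\<alpha> - p)) powr ((\<alpha> - p) / p))"
  have ab: "0 < a" "0 < b" using c pos by (auto simp: a_def b_def)
  have ratio: "a / b = (\<alpha> - p) / (\<beta> - p)" "b / a = (\<beta> - p) / (\<alpha> - p)"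
    using pos by (simp_all add: a_def b_def)
  have qp: "0 \<le> q * (q - p) / p" using pos q by (intro divide_nonneg_pos mult_nonneg_nonneg) auto
  \<comment> \<open>The first entry of the minimum bounds \<open>A\<close> and so controls
    \<open>P\<close>; the second bounds \<open>B\<close> and controls \<open>Q\<close>.\<close>
  have "\<gamma> \<le> q * (q - p) / p * (1 / \<alpha> * (a / b) powr b)"
    using c mult_left_mono[OF min.cobounded1 qp] unfolding ratio unfolding b_def by (meson order_trans)
  then have A: "A \<le> (a + b + 1) * (a / b) powr b"
    using pos q unfolding r(1)[symmetric] r_def A_def by (simp add: field_simps)
  have "\<gamma> \<le> q * (q - p) / p * (1 / \<beta> * (b / a) powr a)"
    using c mult_left_mono[OF min.cobounded2 qp] unfolding ratio unfolding a_def by (meson order_trans)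
  then have B: "B \<le> (b + a + 1) * (b / a) powr a"
    using pos q unfolding r(2)[symmetric] r_def B_def by (simp add: field_simps)
  have "P y < P x \<and> Q x < Q y" if "0 < x" "x < y" for x y
    using log_ratio_strict_decreasing[OF ab AB(1) A that, folded r(1)]
      log_ratio_strict_decreasing[OF ab(2,1) AB(2) B, of "1 / y" "1 / x", folded r(2)] that
    by (auto simp: P_def Q_def frac_less2)
  then show ?thesis by (auto simp: opposite_monotone_def)
next
  assume c: "\<alpha> < p \<and> \<beta> < p \<and>
        q * (q - p) / p *
          max (1 / \<alpha> * ((p - \<beta>) / (p - \<alpha>)) powr ((p - \<beta>) / p))
              (1 / \<beta> * ((p - \<alpha>) / (p - \<beta>)) powr ((p - \<alpha>) / p)) \<le> \<gamma>"
  have ab: "a < 0" "b < 0" "-1 < a" "-1 < b" using c pos by (auto simp: a_def b_def field_simps)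
  have ratio: "a / b = (p - \<alpha>) / (p - \<beta>)" "b / a = (p - \<beta>) / (p - \<alpha>)"
    using pos by (simp_all add: a_def b_def) (metis minus_diff_eq minus_divide_divide)+
  \<comment> \<open>The hypothesis states these constants with inverted base and the positive
    exponents -b and -a; this brings them to the form expected by
    \<open>log_ratio_strict_increasing\<close>.\<close>
  have inv: "(a / b) powr b = (b / a) powr (- b)" "(b / a) powr a = (a / b) powr (- a)"
    using ab by (simp_all add: powr_minus powr_divide divide_simps)
  have nab: "- b = (p - \<beta>) / p" "- a = (p - \<alpha>) / p" using pos by (simp_all add: a_def b_def divide_simps)
  have qp: "0 \<le> q * (q - p) / p" using pos q by (intro divide_nonneg_pos mult_nonneg_nonneg) auto
  have "q * (q - p) / p * u \<le> \<gamma> \<and> q * (q - p) / p * v \<le> \<gamma>"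
    if "q * (q - p) / p * max u v \<le> \<gamma>" for u v
    using that mult_left_mono[OF max.cobounded1[of u v] qp] mult_left_mono[OF max.cobounded2[of v u] qp]
    by linarith
  note c' = this[OF c[THEN conjunct2, THEN conjunct2]]
  have "q * (q - p) / p * (1 / \<alpha> * (a / b) powr b) \<le> \<gamma>"
    using c' unfolding inv unfolding nab ratio by (rule conjunct1)
  then have A: "(a + b + 1) * (a / b) powr b \<le> A"
    using pos q unfolding r(1)[symmetric] r_def A_def by (simp add: field_simps)
  have "q * (q - p) / p * (1 / \<beta> * (b / a) powr a) \<le> \<gamma>"
    using c' unfolding inv unfolding nab ratio by (rule conjunct2)
  then have B: "(b + a + 1) * (b / a) powr a \<le> B"
    using pos q unfolding r(2)[symmetric] r_def B_def by (simp add: field_simps)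
  have "P x < P y \<and> Q y < Q x" if "0 < x" "x < y" for x y
    using log_ratio_strict_increasing[OF ab(1,4,2) _ AB(1) A that, folded r(1)]
      log_ratio_strict_increasing[OF ab(2,3,1) _ AB(2) B, of "1 / y" "1 / x", folded r(2)] that r(3)
    by (auto simp: P_def Q_def frac_less2)
  then show ?thesis by (auto simp: opposite_monotone_def)
qed

private lemma exprs:
  assumes "0 < k" "0 < l"
  shows "k powr ((q - p) / p) + \<alpha> * \<gamma> / q * k powr ((\<alpha> - p) / p) * l powr (\<beta> / p)
      = exp (r * ln (k + l) + P (l / k))"
    and "l powr ((q - p) / p) + \<beta> * \<gamma> / q * l powr ((\<beta> - p) / p) * k powr (\<alpha> / p)
      = exp (r * ln (k + l) + Q (l / k))"
proof -
  have 1: "\<beta> / p = b + 1" "\<alpha> / p = a + 1" using pos by (simp_all add: a_def b_def field_simps)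
  show "k powr ((q - p) / p) + \<alpha> * \<gamma> / q * k powr ((\<alpha> - p) / p) * l powr (\<beta> / p)
      = exp (r * ln (k + l) + P (l / k))"
    using alg_expr_log_ratio[OF assms AB(1) r(1)]
    unfolding 1 P_def r_def[symmetric] a_def[symmetric] A_def[symmetric] by simp
  show "l powr ((q - p) / p) + \<beta> * \<gamma> / q * l powr ((\<beta> - p) / p) * k powr (\<alpha> / p)
      = exp (r * ln (k + l) + Q (l / k))"
    using alg_expr_log_ratio[OF assms(2,1) AB(2) r(2)]
    unfolding 1 Q_def r_def[symmetric] b_def[symmetric] B_def[symmetric] by (simp add: add.commute)
qed

private lemma alg_system_iff:
  "alg_system q p \<alpha> \<beta> \<gamma> k l \<longleftrightarrow>
    0 < k \<and> 0 < l \<and> r * ln (k + l) + P (l / k) = 0 \<and> r * ln (k + l) + Q (l / k) = 0"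
  using exprs[of k l] unfolding alg_system_def by (cases "0 < k \<and> 0 < l") auto

text \<open>At every ratio one of \<open>P\<close> and \<open>Q\<close> is at most their common
  value at the crossing; the corresponding inequality then forces ln (k + l) to be at least
  \<open>ln (k\<^sub>0 + l\<^sub>0)\<close>.\<close>

lemma alg_system_minimal_sum:
  assumes "alg_system q p \<alpha> \<beta> \<gamma> k\<^sub>0 l\<^sub>0" "0 < k" "0 < l"
    and "1 \<le> k powr ((q - p) / p) + \<alpha> * \<gamma> / q * k powr ((\<alpha> - p) / p) * l powr (\<beta> / p)"
    and "1 \<le> l powr ((q - p) / p) + \<beta> * \<gamma> / q * l powr ((\<beta> - p) / p) * k powr (\<alpha> / p)"
  shows "k\<^sub>0 + l\<^sub>0 \<le> k + l"
proof -
  have 0: "0 < k\<^sub>0" "0 < l\<^sub>0" "r * ln (k\<^sub>0 + l\<^sub>0) + P (l\<^sub>0 / k\<^sub>0) = 0" "r * ln (k\<^sub>0 + l\<^sub>0) + Q (l\<^sub>0 / k\<^sub>0) = 0"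
    using assms(1) unfolding alg_system_iff by auto
  have 1: "0 \<le> r * ln (k + l) + P (l / k)" "0 \<le> r * ln (k + l) + Q (l / k)"
    using assms(4,5) unfolding exprs[OF assms(2,3)] by simp_all
  have "P (l / k) \<le> P (l\<^sub>0 / k\<^sub>0) \<or> Q (l / k) \<le> P (l\<^sub>0 / k\<^sub>0)"
    using opposite_monotone_max[OF opposite, of "l / k" "l\<^sub>0 / k\<^sub>0"] 0 assms by auto
  then have "r * ln (k\<^sub>0 + l\<^sub>0) \<le> r * ln (k + l)" using 0 1 by auto
  then show ?thesis using r 0 assms by simp
qed

text \<open>The ratio of a solution is the unique crossing, and \<open>P\<close> at that ratio
  determines k + l; ratio and sum together determine k.\<close>

lemma alg_system_unique:
  assumes "alg_system q p \<alpha> \<beta> \<gamma> k l" "alg_system q p \<alpha> \<beta> \<gamma> k' l'"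
  shows "k = k'"
proof -
  have 0: "0 < k" "0 < l" "r * ln (k + l) + P (l / k) = 0" "r * ln (k + l) + Q (l / k) = 0"
    using assms(1) unfolding alg_system_iff by auto
  have 1: "0 < k'" "0 < l'" "r * ln (k' + l') + P (l' / k') = 0" "r * ln (k' + l') + Q (l' / k') = 0"
    using assms(2) unfolding alg_system_iff by auto
  have t: "l / k = l' / k'"
  proof (cases "P (l / k) \<le> P (l' / k')")
    case True
    then show ?thesis
      using opposite_monotone_min[OF opposite, of "l' / k'" "l / k"] 0 1 by auto
  next
    case False
    then show ?thesis
      using opposite_monotone_min[OF opposite, of "l / k" "l' / k'"] 0 1 by auto
  qed
  then have "r * ln (k + l) = r * ln (k' + l')" using 0(3) 1(3) unfolding t by linarith
  then have "ln (k + l) = ln (k' + l')" using r(3) by simp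
  then have "k + l = k' + l'" using 0 1 by simp
  moreover have "k + l = k * (1 + l / k)" "k' + l' = k' * (1 + l' / k')"
    using 0 1 by (simp_all add: distrib_left)
  moreover have "1 + l / k > 0" using 0 by (intro add_pos_pos) auto
  ultimately show ?thesis using t by (metis less_irrefl mult_right_cancel)
qed

lemma min_alg_solution_exists: "\<exists>k\<^sub>0 l\<^sub>0. min_alg_solution q p \<alpha> \<beta> \<gamma> k\<^sub>0 l\<^sub>0"
proof -
  obtain t where t: "0 < t" "P t = Q t"
    using log_ratio_crossing[OF AB r(1,3) sgn_ab] unfolding P_def Q_def by auto
  \<comment> \<open>Solves r ln (k + l) + P t = 0 together with l = t k; that this k is the smallest
    one then follows from uniqueness.\<close>
  define k where "k = exp (- P t / r) / (1 + t)"
  define l where "l = t * k"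
  have k: "0 < k" "0 < l" using t by (auto simp: k_def l_def)
  have "k + l = (1 + t) * k" by (simp add: l_def distrib_right)
  also have "\<dots> = exp (- P t / r)" using t by (simp add: k_def)
  finally have "k + l = exp (- P t / r)" .
  then have "r * ln (k + l) = - P t" using r(3) by simp
  moreover have "l / k = t" using k by (simp add: l_def)
  ultimately have "alg_system q p \<alpha> \<beta> \<gamma> k l"
    unfolding alg_system_iff using k t by simp
  then show ?thesis unfolding min_alg_solution_def using alg_system_unique by blast
qed

end

section \<open>Integrals of p-th powers\<close>

lemma abs_add_powr_le:
  fixes a b p :: real
  assumes "0 \<le> p"
  shows "\<bar>a + b\<bar> powr p \<le> 2 powr p * (\<bar>a\<bar> powr p + \<bar>b\<bar> powr p)"
proof -
  have "\<bar>a + b\<bar> powr p \<le> (2 * max \<bar>a\<bar> \<bar>b\<bar>) powr p"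
    using assms by (intro powr_mono2) auto
  also have "\<dots> = 2 powr p * max \<bar>a\<bar> \<bar>b\<bar> powr p" by (simp add: powr_mult)
  also have "max \<bar>a\<bar> \<bar>b\<bar> powr p \<le> \<bar>a\<bar> powr p + \<bar>b\<bar> powr p"
    by (auto simp: max_def)
  finally show ?thesis by simp
qed

text \<open>Kept for individual functions over an arbitrary measure, and paired below with the p-th
  power of the norm instead of the norm: the same lemmas then serve exponent q on the space and
  exponent p on the product space.\<close>

definition Lp :: "'a measure \<Rightarrow> real \<Rightarrow> ('a \<Rightarrow> real) set" where
  "Lp M p = {f \<in> borel_measurable M. integrable M (\<lambda>x. \<bar>f x\<bar> powr p)}"

definition pint :: "'a measure \<Rightarrow> real \<Rightarrow> ('a \<Rightarrow> real) \<Rightarrow> real" where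
  "pint M p f = (LINT x|M. \<bar>f x\<bar> powr p)"

lemma LpI: "f \<in> borel_measurable M \<Longrightarrow> integrable M (\<lambda>x. \<bar>f x\<bar> powr p) \<Longrightarrow> f \<in> Lp M p"
  by (simp add: Lp_def)

lemma Lp_measurable [measurable_dest]: "f \<in> Lp M p \<Longrightarrow> f \<in> borel_measurable M"
  by (simp add: Lp_def)

lemma Lp_integrable: "f \<in> Lp M p \<Longrightarrow> integrable M (\<lambda>x. \<bar>f x\<bar> powr p)"
  by (simp add: Lp_def)

lemma pint_nonneg [simp]: "0 \<le> pint M p f"
  by (simp add: pint_def)

lemma Lp_dominated:
  assumes "g \<in> borel_measurable M" "integrable M h" "\<And>x. \<bar>g x\<bar> powr p \<le> h x"
  shows "g \<in> Lp M p"
proof (rule LpI)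
  note [measurable] = assms(1)
  show "integrable M (\<lambda>x. \<bar>g x\<bar> powr p)"
    by (rule Bochner_Integration.integrable_bound[OF assms(2)]) (use assms(3) in \<open>auto intro!: AE_I2 order_trans[OF assms(3)]\<close>)
qed (fact assms)

lemma Lp_mono:
  assumes "g \<in> borel_measurable M" "f \<in> Lp M p" "\<And>x. \<bar>g x\<bar> \<le> \<bar>f x\<bar>" "0 \<le> p"
  shows "g \<in> Lp M p" "pint M p g \<le> pint M p f"
proof -
  have le: "\<bar>g x\<bar> powr p \<le> \<bar>f x\<bar> powr p" for x using assms by (intro powr_mono2) auto
  show g: "g \<in> Lp M p" by (rule Lp_dominated[OF assms(1) Lp_integrable[OF assms(2)] le])
  show "pint M p g \<le> pint M p f" unfolding pint_def
    by (intro integral_mono Lp_integrable g assms(2) le)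
qed

lemma Lp_add:
  assumes "f \<in> Lp M p" "g \<in> Lp M p" "0 \<le> p"
  shows "(\<lambda>x. f x + g x) \<in> Lp M p"
    "pint M p (\<lambda>x. f x + g x) \<le> 2 powr p * (pint M p f + pint M p g)"
proof -
  note [measurable] = Lp_measurable[OF assms(1)] Lp_measurable[OF assms(2)]
  have i: "integrable M (\<lambda>x. 2 powr p * (\<bar>f x\<bar> powr p + \<bar>g x\<bar> powr p))"
    using assms(1,2)[THEN Lp_integrable] by auto
  show fg: "(\<lambda>x. f x + g x) \<in> Lp M p"
    by (rule Lp_dominated[OF _ i abs_add_powr_le[OF assms(3)]]) measurable
  have "pint M p (\<lambda>x. f x + g x) \<le> (LINT x|M. 2 powr p * (\<bar>f x\<bar> powr p + \<bar>g x\<bar> powr p))"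
    unfolding pint_def by (intro integral_mono i Lp_integrable[OF fg] abs_add_powr_le assms)
  also have "\<dots> = 2 powr p * (pint M p f + pint M p g)"
    using assms(1,2)[THEN Lp_integrable] by (simp add: pint_def)
  finally show "pint M p (\<lambda>x. f x + g x) \<le> 2 powr p * (pint M p f + pint M p g)" .
qed

lemma Lp_cmult:
  assumes "f \<in> Lp M p"
  shows "(\<lambda>x. c * f x) \<in> Lp M p" "pint M p (\<lambda>x. c * f x) = \<bar>c\<bar> powr p * pint M p f"
  using assms by (auto simp: Lp_def pint_def abs_mult powr_mult)

lemma Lp_diff:
  assumes "f \<in> Lp M p" "g \<in> Lp M p" "0 \<le> p"
  shows "(\<lambda>x. f x - g x) \<in> Lp M p"
    "pint M p (\<lambda>x. f x - g x) \<le> 2 powr p * (pint M p f + pint M p g)"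
proof -
  have "(\<lambda>x. - 1 * g x) \<in> Lp M p" "pint M p (\<lambda>x. - 1 * g x) = pint M p g"
    using Lp_cmult[OF assms(2), of "-1"] by simp_all
  then show "(\<lambda>x. f x - g x) \<in> Lp M p" "pint M p (\<lambda>x. f x - g x) \<le> 2 powr p * (pint M p f + pint M p g)"
    using Lp_add[OF assms(1) _ assms(3), of "\<lambda>x. - 1 * g x"] by auto
qed

lemma pint_eq_0_iff:
  assumes "f \<in> Lp M p"
  shows "pint M p f = 0 \<longleftrightarrow> (AE x in M. f x = 0)"
  using integral_nonneg_eq_0_iff_AE[OF Lp_integrable[OF assms]] by (simp add: pint_def)

lemma pint_cong_AE:
  assumes "f \<in> borel_measurable M" "g \<in> borel_measurable M" "AE x in M. f x = g x"
  shows "pint M p f = pint M p g"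
proof -
  note [measurable] = assms(1,2)
  show ?thesis unfolding pint_def using assms(3) by (intro integral_cong_AE) auto
qed

lemma Lp_cong_AE:
  assumes "f \<in> Lp M p" "g \<in> borel_measurable M" "AE x in M. f x = g x"
  shows "g \<in> Lp M p"
proof -
  note [measurable] = Lp_measurable[OF assms(1)] assms(2)
  have "integrable M (\<lambda>x. \<bar>f x\<bar> powr p) \<longleftrightarrow> integrable M (\<lambda>x. \<bar>g x\<bar> powr p)"
    using assms(3) by (intro integrable_cong_AE) auto
  then show ?thesis using assms by (auto simp: Lp_def)
qed

section \<open>Hoelder's inequality and Fatou's lemma\<close>

lemma powr_prod_le:
  fixes a b \<alpha> \<beta> :: real
  assumes "0 \<le> a" "0 \<le> b" "0 \<le> \<alpha>" "0 \<le> \<beta>"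
  shows "a powr \<alpha> * b powr \<beta> \<le> a powr (\<alpha> + \<beta>) + b powr (\<alpha> + \<beta>)"
proof -
  have "a powr \<alpha> * b powr \<beta> \<le> max a b powr \<alpha> * max a b powr \<beta>"
    using assms by (intro mult_mono powr_mono2) auto
  also have "\<dots> = max a b powr (\<alpha> + \<beta>)" by (simp add: powr_add)
  also have "\<dots> \<le> a powr (\<alpha> + \<beta>) + b powr (\<alpha> + \<beta>)" by (auto simp: max_def)
  finally show ?thesis .
qed

lemma Lp_prod_integrable:
  assumes "f \<in> Lp M (\<alpha> + \<beta>)" "g \<in> Lp M (\<alpha> + \<beta>)" "0 \<le> \<alpha>" "0 \<le> \<beta>"
  shows "integrable M (\<lambda>x. \<bar>f x\<bar> powr \<alpha> * \<bar>g x\<bar> powr \<beta>)"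
proof -
  note [measurable] = Lp_measurable[OF assms(1)] Lp_measurable[OF assms(2)]
  show ?thesis
    by (rule Bochner_Integration.integrable_bound[OF
          Bochner_Integration.integrable_add[OF assms(1,2)[THEN Lp_integrable]]])
       (use assms in \<open>auto intro!: AE_I2 powr_prod_le\<close>)
qed

lemma Holder_pint:
  assumes "f \<in> Lp M (\<alpha> + \<beta>)" "g \<in> Lp M (\<alpha> + \<beta>)" "0 < \<alpha>" "0 < \<beta>"
  shows "(LINT x|M. \<bar>f x\<bar> powr \<alpha> * \<bar>g x\<bar> powr \<beta>)
    \<le> pint M (\<alpha> + \<beta>) f powr (\<alpha> / (\<alpha> + \<beta>)) * pint M (\<alpha> + \<beta>) g powr (\<beta> / (\<alpha> + \<beta>))"
proof -
  note [measurable] = Lp_measurable[OF assms(1)] Lp_measurable[OF assms(2)]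
  define q where "q = \<alpha> + \<beta>"
  define X where "X = pint M q f"
  define Y where "Y = pint M q g"
  have q: "0 < q" using assms by (simp add: q_def)
  have XY0: "0 \<le> X" "0 \<le> Y" by (auto simp: X_def Y_def)
  show ?thesis
  proof (cases "X = 0 \<or> Y = 0")
    case True
    then have "(AE x in M. f x = 0) \<or> (AE x in M. g x = 0)"
      using pint_eq_0_iff[OF assms(1)] pint_eq_0_iff[OF assms(2)] by (simp add: X_def Y_def q_def)
    then have "AE x in M. \<bar>f x\<bar> powr \<alpha> * \<bar>g x\<bar> powr \<beta> = 0" by auto
    then have "(LINT x|M. \<bar>f x\<bar> powr \<alpha> * \<bar>g x\<bar> powr \<beta>) = 0"
      by (rule integral_eq_zero_AE)
    then show ?thesis by simp
  next
    case False
    then have XY: "0 < X" "0 < Y" using XY0 by auto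
    \<comment> \<open>Young's inequality with weights \<alpha> / q and \<beta> / q, after both q-th
      powers have been normalized to integral 1.\<close>
    have le: "\<bar>f x\<bar> powr \<alpha> * \<bar>g x\<bar> powr \<beta> \<le> X powr (\<alpha> / q) * Y powr (\<beta> / q) *
        (\<alpha> / q * (\<bar>f x\<bar> powr q / X) + \<beta> / q * (\<bar>g x\<bar> powr q / Y))" for x
    proof (cases "f x = 0 \<or> g x = 0")
      case True
      then show ?thesis using assms XY q by auto
    next
      case False
      have "\<alpha> / q + \<beta> / q = 1" using q by (simp add: q_def add_divide_distrib[symmetric])
      then have "(\<bar>f x\<bar> powr q / X) powr (\<alpha> / q) * (\<bar>g x\<bar> powr q / Y) powr (\<beta> / q)
        \<le> \<alpha> / q * (\<bar>f x\<bar> powr q / X) + \<beta> / q * (\<bar>g x\<bar> powr q / Y)"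
        using False XY assms q by (intro Youngs_inequality_0) auto
      moreover have "X powr (\<alpha> / q) * Y powr (\<beta> / q) * ((\<bar>f x\<bar> powr q / X) powr (\<alpha> / q) * (\<bar>g x\<bar> powr q / Y) powr (\<beta> / q))
        = \<bar>f x\<bar> powr \<alpha> * \<bar>g x\<bar> powr \<beta>"
        using XY q by (simp add: powr_divide powr_powr)
      ultimately show ?thesis using XY
        by (metis mult_left_mono mult_nonneg_nonneg powr_ge_zero)
    qed
    have i: "integrable M (\<lambda>x. \<bar>f x\<bar> powr q)" "integrable M (\<lambda>x. \<bar>g x\<bar> powr q)"
      using assms(1,2)[THEN Lp_integrable] by (simp_all add: q_def)
    have "(LINT x|M. \<bar>f x\<bar> powr \<alpha> * \<bar>g x\<bar> powr \<beta>) \<le> (LINT x|M. X powr (\<alpha> / q) * Y powr (\<beta> / q) *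
        (\<alpha> / q * (\<bar>f x\<bar> powr q / X) + \<beta> / q * (\<bar>g x\<bar> powr q / Y)))"
      using assms i by (intro integral_mono le Lp_prod_integrable) auto
    also have "\<dots> = X powr (\<alpha> / q) * Y powr (\<beta> / q) * (\<alpha> / q * (X / X) + \<beta> / q * (Y / Y))"
      using i by (simp add: X_def Y_def pint_def)
    also have "\<dots> = X powr (\<alpha> / q) * Y powr (\<beta> / q)"
      using XY q by (simp add: q_def flip: add_divide_distrib)
    finally show ?thesis by (simp add: X_def Y_def q_def)
  qed
qed

text \<open>Almost everywhere convergence and a uniform bound suffice for membership; this is how
  the limit of a minimizing sequence is seen to lie in the Sobolev space.\<close>

lemma Lp_Fatou:
  assumes f: "\<And>n. f n \<in> Lp M p" and K: "\<And>n. pint M p (f n) \<le> K"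
    and lim: "AE x in M. (\<lambda>n. f n x) \<longlonglongrightarrow> g x" and g[measurable]: "g \<in> borel_measurable M" and p: "0 < p"
  shows "g \<in> Lp M p" "pint M p g \<le> K"
proof -
  note [measurable] = Lp_measurable[OF f]
  have K0: "0 \<le> K" using K[of 0] pint_nonneg[of M p "f 0"] by linarith
  have "(\<integral>\<^sup>+x. ennreal (\<bar>g x\<bar> powr p) \<partial>M) = (\<integral>\<^sup>+x. liminf (\<lambda>n. ennreal (\<bar>f n x\<bar> powr p)) \<partial>M)"
  proof (rule nn_integral_cong_AE)
    show "AE x in M. ennreal (\<bar>g x\<bar> powr p) = liminf (\<lambda>n. ennreal (\<bar>f n x\<bar> powr p))"
      using lim
    proof eventually_elim
      case (elim x)
      then have "(\<lambda>n. ennreal (\<bar>f n x\<bar> powr p)) \<longlonglongrightarrow> ennreal (\<bar>g x\<bar> powr p)"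
        using p by (intro tendsto_ennrealI tendsto_powr' tendsto_rabs tendsto_const) auto
      from lim_imp_Liminf[OF sequentially_bot this] show ?case by simp
    qed
  qed
  also have "\<dots> \<le> liminf (\<lambda>n. \<integral>\<^sup>+x. ennreal (\<bar>f n x\<bar> powr p) \<partial>M)"
    by (rule nn_integral_liminf) measurable
  also have "\<dots> \<le> ennreal K"
  proof (rule Liminf_le)
    have "(\<integral>\<^sup>+x. ennreal (\<bar>f n x\<bar> powr p) \<partial>M) \<le> ennreal K" for n
      using K[of n] Lp_integrable[OF f[of n]] K0
      by (subst nn_integral_eq_integral) (auto simp: pint_def ennreal_leI)
    then show "\<forall>\<^sub>F n in sequentially. (\<integral>\<^sup>+x. ennreal (\<bar>f n x\<bar> powr p) \<partial>M) \<le> ennreal K" by simp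
  qed simp
  finally have le: "(\<integral>\<^sup>+x. ennreal (\<bar>g x\<bar> powr p) \<partial>M) \<le> ennreal K" .
  have int: "integrable M (\<lambda>x. \<bar>g x\<bar> powr p)"
    by (rule integrableI_bounded) (use le in \<open>auto intro: le_less_trans\<close>)
  then show "g \<in> Lp M p" by (simp add: Lp_def)
  show "pint M p g \<le> K" using le K0 int
    by (simp add: nn_integral_eq_integral pint_def)
qed

section \<open>The Brezis-Lieb lemma\<close>

lemma powr_perturb:
  fixes p e :: real
  assumes "0 < p" "0 < e"
  shows "\<exists>C\<ge>0. \<forall>a b :: real. \<bar>\<bar>a + b\<bar> powr p - \<bar>a\<bar> powr p\<bar> \<le> e * \<bar>a\<bar> powr p + C * \<bar>b\<bar> powr p"
proof -
  \<comment> \<open>Continuity at 0 yields a d with (1 + d)^p - (1 - d)^p < e. This settles |b|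
    \<le> d |a|; for larger |b| both powers are bounded by a multiple of |b|^p.\<close>
  have "((\<lambda>d::real. (1 + d) powr p - (1 - d) powr p) \<longlongrightarrow> (1 + 0) powr p - (1 - 0) powr p) (at_right 0)"
    using assms by (intro tendsto_intros) auto
  then have "\<forall>\<^sub>F d in at_right (0::real). (1 + d) powr p - (1 - d) powr p < e"
    using assms by (intro order_tendstoD) auto
  moreover have "\<forall>\<^sub>F d in at_right (0::real). d \<in> {0<..<1}"
    by (intro eventually_at_right_real) simp
  ultimately have "\<forall>\<^sub>F d in at_right (0::real). (1 + d) powr p - (1 - d) powr p < e \<and> d \<in> {0<..<1}"
    by (rule eventually_conj)
  then obtain d where d: "(1 + d) powr p - (1 - d) powr p < e" "0 < d" "d < 1"
    using eventually_happens[of _ "at_right (0::real)"] by auto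
  define C where "C = (1 / d + 1) powr p + (1 / d) powr p"
  have "\<bar>\<bar>a + b\<bar> powr p - \<bar>a\<bar> powr p\<bar> \<le> e * \<bar>a\<bar> powr p + C * \<bar>b\<bar> powr p" for a b :: real
  proof (cases "\<bar>b\<bar> \<le> d * \<bar>a\<bar>")
    case True
    have "\<bar>a + b\<bar> powr p \<le> ((1 + d) * \<bar>a\<bar>) powr p"
      using True assms by (intro powr_mono2) (auto simp: distrib_right)
    then have u: "\<bar>a + b\<bar> powr p \<le> (1 + d) powr p * \<bar>a\<bar> powr p" using d by (simp add: powr_mult)
    have "((1 - d) * \<bar>a\<bar>) powr p \<le> \<bar>a + b\<bar> powr p"
      using True assms d by (intro powr_mono2) (auto simp: left_diff_distrib mult_left_le_one_le)
    then have l: "(1 - d) powr p * \<bar>a\<bar> powr p \<le> \<bar>a + b\<bar> powr p" using d by (simp add: powr_mult)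
    have "1 powr p \<le> (1 + d) powr p" "(1 - d) powr p \<le> 1 powr p"
      using d assms by (intro powr_mono2; simp)+
    then have "1 * \<bar>a\<bar> powr p \<le> (1 + d) powr p * \<bar>a\<bar> powr p" "(1 - d) powr p * \<bar>a\<bar> powr p \<le> 1 * \<bar>a\<bar> powr p"
      by (intro mult_right_mono; simp)+
    then have "\<bar>\<bar>a + b\<bar> powr p - \<bar>a\<bar> powr p\<bar> \<le> ((1 + d) powr p - (1 - d) powr p) * \<bar>a\<bar> powr p"
      using u l by (simp add: left_diff_distrib abs_le_iff)
    also have "\<dots> \<le> e * \<bar>a\<bar> powr p" using d by (intro mult_right_mono) auto
    finally show ?thesis by (auto simp: C_def intro: order_trans)
  next
    case False
    then have a: "\<bar>a\<bar> \<le> 1 / d * \<bar>b\<bar>" using d by (simp add: field_simps)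
    have "\<bar>a\<bar> powr p \<le> (1 / d * \<bar>b\<bar>) powr p" using a assms by (intro powr_mono2) auto
    then have 1: "\<bar>a\<bar> powr p \<le> (1 / d) powr p * \<bar>b\<bar> powr p" unfolding powr_mult .
    have "\<bar>a + b\<bar> powr p \<le> ((1 / d + 1) * \<bar>b\<bar>) powr p"
      using a assms by (intro powr_mono2) (auto simp: distrib_right)
    then have 2: "\<bar>a + b\<bar> powr p \<le> (1 / d + 1) powr p * \<bar>b\<bar> powr p" using d by (simp add: powr_mult)
    have "\<bar>\<bar>a + b\<bar> powr p - \<bar>a\<bar> powr p\<bar> \<le> \<bar>a + b\<bar> powr p + \<bar>a\<bar> powr p" by (simp add: abs_le_iff)
    also have "\<dots> \<le> C * \<bar>b\<bar> powr p" using 1 2 by (simp add: C_def distrib_right)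
    finally show ?thesis using assms by (auto intro: order_trans)
  qed
  moreover have "0 \<le> C" by (simp add: C_def)
  ultimately show ?thesis by blast
qed

text \<open>The defect |f n|^p - |f n - g|^p - |g|^p has no evident fixed majorant. The positive
  part \<open>W\<close> of its absolute value minus e |f n - g|^p is dominated by a multiple of
  |g|^p, so its integral tends to 0, while the subtracted part contributes at most e K'.\<close>

lemma Brezis_Lieb:
  assumes f: "\<And>n. f n \<in> Lp M p" and K: "\<And>n. pint M p (f n) \<le> K"
    and lim: "AE x in M. (\<lambda>n. f n x) \<longlonglongrightarrow> g x" and g[measurable]: "g \<in> borel_measurable M" and p: "0 < p"
  shows "(\<lambda>n. pint M p (f n) - pint M p (\<lambda>x. f n x - g x)) \<longlonglongrightarrow> pint M p g"
proof -
  note [measurable] = Lp_measurable[OF f]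
  have gL: "g \<in> Lp M p" and gK: "pint M p g \<le> K" using Lp_Fatou[OF f K lim g p] by auto
  have dL: "(\<lambda>x. f n x - g x) \<in> Lp M p" for n using Lp_diff(1)[OF f gL] p by simp
  define K' where "K' = 2 powr p * (K + K)"
  have dK: "pint M p (\<lambda>x. f n x - g x) \<le> K'" for n
  proof -
    have "pint M p (\<lambda>x. f n x - g x) \<le> 2 powr p * (pint M p (f n) + pint M p g)"
      using Lp_diff(2)[OF f gL] p by simp
    also have "\<dots> \<le> K'" unfolding K'_def using K gK by (intro mult_left_mono add_mono) auto
    finally show ?thesis .
  qed
  have K'0: "0 \<le> K'" using dK[of 0] pint_nonneg[of M p "\<lambda>x. f 0 x - g x"] by linarith
  define w where "w n x = \<bar>f n x\<bar> powr p - \<bar>f n x - g x\<bar> powr p - \<bar>g x\<bar> powr p" for n x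
  have wi: "integrable M (w n)" for n
    unfolding w_def using Lp_integrable[OF f] Lp_integrable[OF dL] Lp_integrable[OF gL] by auto
  have w_int: "(LINT x|M. w n x) = pint M p (f n) - pint M p (\<lambda>x. f n x - g x) - pint M p g" for n
    unfolding w_def pint_def using Lp_integrable[OF f] Lp_integrable[OF dL] Lp_integrable[OF gL] by auto
  have "(\<lambda>n. LINT x|M. w n x) \<longlonglongrightarrow> 0"
  proof (rule LIMSEQ_I)
    fix r :: real assume r: "0 < r"
    define e where "e = r / (2 * (K' + 1))"
    have e: "0 < e" using r K'0 by (simp add: e_def)
    obtain C where C: "C \<ge> 0" "\<And>a b :: real. \<bar>\<bar>a + b\<bar> powr p - \<bar>a\<bar> powr p\<bar> \<le> e * \<bar>a\<bar> powr p + C * \<bar>b\<bar> powr p"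
      using powr_perturb[OF p e] by blast
    define W where "W n x = max 0 (\<bar>w n x\<bar> - e * \<bar>f n x - g x\<bar> powr p)" for n x
    have wm[measurable]: "w n \<in> borel_measurable M" for n using wi by auto
    have Wm[measurable]: "W n \<in> borel_measurable M" for n unfolding W_def by measurable
    have Wb: "\<bar>W n x\<bar> \<le> (C + 1) * \<bar>g x\<bar> powr p" for n x
    proof -
      have "\<bar>w n x\<bar> \<le> \<bar>\<bar>(f n x - g x) + g x\<bar> powr p - \<bar>f n x - g x\<bar> powr p\<bar> + \<bar>g x\<bar> powr p"
        unfolding w_def by (rule order_trans[OF abs_triangle_ineq4]) simp
      also have "\<dots> \<le> e * \<bar>f n x - g x\<bar> powr p + C * \<bar>g x\<bar> powr p + \<bar>g x\<bar> powr p"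
        using C(2)[of "f n x - g x" "g x"] by simp
      finally show ?thesis using C(1) by (auto simp: W_def distrib_right)
    qed
    have "(\<lambda>n. LINT x|M. W n x) \<longlonglongrightarrow> (LINT x|M. 0)"
    proof (rule integral_dominated_convergence)
      show "integrable M (\<lambda>x. (C + 1) * \<bar>g x\<bar> powr p)" using Lp_integrable[OF gL] by auto
      show "AE x in M. norm (W n x) \<le> (C + 1) * \<bar>g x\<bar> powr p" for n using Wb by auto
      show "AE x in M. (\<lambda>n. W n x) \<longlonglongrightarrow> 0" using lim
      proof eventually_elim
        case (elim x)
        have "(\<lambda>n. max 0 (\<bar>\<bar>f n x\<bar> powr p - \<bar>f n x - g x\<bar> powr p - \<bar>g x\<bar> powr p\<bar> - e * \<bar>f n x - g x\<bar> powr p))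
          \<longlonglongrightarrow> max 0 (\<bar>\<bar>g x\<bar> powr p - \<bar>g x - g x\<bar> powr p - \<bar>g x\<bar> powr p\<bar> - e * \<bar>g x - g x\<bar> powr p)"
          using p elim by (intro tendsto_intros tendsto_powr') auto
        then show ?case using p by (simp add: W_def w_def)
      qed
    qed auto
    then have "(\<lambda>n. LINT x|M. W n x) \<longlonglongrightarrow> 0" by simp
    then obtain N where N: "\<And>n. n \<ge> N \<Longrightarrow> norm ((LINT x|M. W n x) - 0) < r / 2"
      using r by (metis LIMSEQ_D half_gt_zero)
    have Wi: "integrable M (W n)" for n
    proof (rule Bochner_Integration.integrable_bound)
      show "integrable M (\<lambda>x. (C + 1) * \<bar>g x\<bar> powr p)" using Lp_integrable[OF gL] by auto
    qed (use Wb C in auto)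
    have "norm ((LINT x|M. w n x) - 0) < r" if n: "n \<ge> N" for n
    proof -
      have "\<bar>LINT x|M. w n x\<bar> \<le> (LINT x|M. \<bar>w n x\<bar>)" by (rule integral_abs_bound)
      also have "\<dots> \<le> (LINT x|M. W n x + e * \<bar>f n x - g x\<bar> powr p)"
        using wi Wi Lp_integrable[OF dL] by (intro integral_mono) (auto simp: W_def)
      also have "\<dots> = (LINT x|M. W n x) + e * pint M p (\<lambda>x. f n x - g x)"
        using Wi Lp_integrable[OF dL] by (simp add: pint_def)
      also have "\<dots> \<le> (LINT x|M. W n x) + e * K'" using dK e by (auto intro!: mult_left_mono)
      also have "e * K' \<le> r / 2" using K'0 r by (simp add: e_def field_simps)
      finally show ?thesis using N[OF n] by simp
    qed
    then show "\<exists>N. \<forall>n\<ge>N. norm ((LINT x|M. w n x) - 0) < r" by blast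
  qed
  then have "(\<lambda>n. (LINT x|M. w n x) + pint M p g) \<longlonglongrightarrow> 0 + pint M p g" by (intro tendsto_intros)
  then show ?thesis by (simp add: w_int)
qed

section \<open>Differentiating integrals of p-th powers along a line\<close>

lemma abs_powr_has_derivative:
  fixes p x :: real
  assumes "1 < p"
  shows "((\<lambda>x. \<bar>x\<bar> powr p) has_real_derivative p * \<bar>x\<bar> powr (p - 2) * x) (at x)"
proof -
  consider "x > 0" | "x < 0" | "x = 0" by linarith
  then show ?thesis
  proof cases
    case 1
    have "((\<lambda>x. x powr p) has_real_derivative p * x powr (p - 1)) (at x)"
      using 1 by (auto intro!: derivative_eq_intros)
    moreover have "\<forall>\<^sub>F y in nhds x. \<bar>y\<bar> powr p = y powr p"
      using eventually_nhds_in_open[of "{0<..}" x] 1 by (auto elim!: eventually_mono)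
    moreover have "x powr (p - 1) = x powr (p - 2) * x" using 1 by (simp add: powr_diff power2_eq_square)
    ultimately show ?thesis using 1 by (subst DERIV_cong_ev[OF refl _ refl]) (auto simp: mult.assoc)
  next
    case 2
    have "((\<lambda>x. (- x) powr p) has_real_derivative p * (-x) powr (p - 1) * (-1)) (at x)"
      using 2 by (auto intro!: derivative_eq_intros)
    moreover have "\<forall>\<^sub>F y in nhds x. \<bar>y\<bar> powr p = (-y) powr p"
      using eventually_nhds_in_open[of "{..<0}" x] 2 by (auto elim!: eventually_mono)
    moreover have "(-x) powr (p - 1) = (-x) powr (p - 2) * (-x)" using 2 by (simp add: powr_diff power2_eq_square)
    ultimately show ?thesis using 2 by (subst DERIV_cong_ev[OF refl _ refl]) (auto simp: algebra_simps)
  next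
    case 3
    have lim: "((\<lambda>h::real. \<bar>h\<bar> powr (p - 1) * sgn h) \<longlongrightarrow> 0) (at 0)"
    proof (rule Lim_null_comparison)
      have "((\<lambda>h::real. \<bar>h\<bar> powr (p - 1)) \<longlongrightarrow> \<bar>0\<bar> powr (p - 1)) (at 0)"
        using assms by (intro tendsto_powr' tendsto_intros) auto
      then show "((\<lambda>h::real. \<bar>h\<bar> powr (p - 1)) \<longlongrightarrow> 0) (at 0)" using assms by simp
      show "\<forall>\<^sub>F h::real in at 0. norm (\<bar>h\<bar> powr (p - 1) * sgn h) \<le> \<bar>h\<bar> powr (p - 1)"
        by (intro always_eventually allI) (simp add: abs_mult sgn_if)
    qed
    have eq: "(\<bar>0 + h\<bar> powr p - \<bar>0\<bar> powr p) / h = \<bar>h\<bar> powr (p - 1) * sgn h" if "h \<noteq> 0" for h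
      using assms that by (cases "0 < h") (auto simp: powr_diff)
    have ev: "\<forall>\<^sub>F h in at 0. (\<bar>0 + h\<bar> powr p - \<bar>0\<bar> powr p) / h = \<bar>h\<bar> powr (p - 1) * sgn h"
      unfolding eventually_at_filter by (intro always_eventually allI impI) (rule eq)
    have "((\<lambda>h. (\<bar>0 + h\<bar> powr p - \<bar>0\<bar> powr p) / h) \<longlongrightarrow> 0) (at (0::real))"
      by (rule iffD2[OF tendsto_cong[OF ev] lim])
    then show ?thesis using 3 by (simp add: DERIV_def)
  qed
qed

text \<open>The mean value theorem supplies an integrable majorant, uniform in |t| \<le> 1, for the
  difference quotients in \<open>pint_has_derivative\<close>.\<close>

lemma abs_powr_line_bound:
  fixes a b t p :: real
  assumes "1 < p" "\<bar>t\<bar> \<le> 1"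
  shows "\<bar>\<bar>a + t * b\<bar> powr p - \<bar>a\<bar> powr p\<bar> \<le> \<bar>t\<bar> * (p * (\<bar>a\<bar> + \<bar>b\<bar>) powr p)"
proof -
  define B where "B = p * (\<bar>a\<bar> + \<bar>b\<bar>) powr p"
  have "norm ((\<lambda>t. \<bar>a + t * b\<bar> powr p) t - (\<lambda>t. \<bar>a + t * b\<bar> powr p) 0) \<le> B * norm (t - 0)"
  proof (rule field_differentiable_bound[where S="{-1..1}" and f'="\<lambda>t. p * \<bar>a + t * b\<bar> powr (p - 2) * (a + t * b) * b"])
    fix t :: real assume t: "t \<in> {-1..1}"
    have "((\<lambda>t. \<bar>a + t * b\<bar> powr p) has_real_derivative p * \<bar>a + t * b\<bar> powr (p - 2) * (a + t * b) * b) (at t)"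
      by (rule DERIV_chain2[OF abs_powr_has_derivative[OF assms(1)]]) (auto intro!: derivative_eq_intros)
    then show "((\<lambda>t. \<bar>a + t * b\<bar> powr p) has_real_derivative p * \<bar>a + t * b\<bar> powr (p - 2) * (a + t * b) * b) (at t within {-1..1})"
      by (rule has_field_derivative_at_within)
    define c where "c = \<bar>a + t * b\<bar>"
    have c: "0 \<le> c" "c \<le> \<bar>a\<bar> + \<bar>b\<bar>"
    proof -
      have "c \<le> \<bar>a\<bar> + \<bar>t\<bar> * \<bar>b\<bar>" unfolding c_def by (metis abs_mult abs_triangle_ineq)
      also have "\<bar>t\<bar> * \<bar>b\<bar> \<le> 1 * \<bar>b\<bar>" using t by (intro mult_right_mono) auto
      finally show "c \<le> \<bar>a\<bar> + \<bar>b\<bar>" by simp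
    qed (simp add: c_def)
    have "c powr (p - 2) * c = c powr (p - 1)" using c(1)
      by (cases "c = 0") (simp_all add: powr_diff power2_eq_square)
    then have "norm (p * \<bar>a + t * b\<bar> powr (p - 2) * (a + t * b) * b) = p * c powr (p - 1) * \<bar>b\<bar>"
      using assms unfolding c_def by (simp add: abs_mult)
    also have "\<dots> \<le> p * (\<bar>a\<bar> + \<bar>b\<bar>) powr (p - 1) * (\<bar>a\<bar> + \<bar>b\<bar>) powr 1"
      using assms c by (intro mult_mono powr_mono2) auto
    also have "\<dots> = B" unfolding B_def mult.assoc powr_add[symmetric] by simp
    finally show "norm (p * \<bar>a + t * b\<bar> powr (p - 2) * (a + t * b) * b) \<le> B" .
  qed (use assms in auto)
  then show ?thesis by (simp add: B_def mult.commute)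
qed

text \<open>Dominated convergence along sequences t -> 0. It is applied once on the space and once,
  to difference quotients, on the product space.\<close>

lemma pint_has_derivative:
  assumes f: "f \<in> Lp M p" and g: "g \<in> Lp M p" and p: "1 < p"
  shows "((\<lambda>t. pint M p (\<lambda>x. f x + t * g x)) has_real_derivative
     p * (LINT x|M. \<bar>f x\<bar> powr (p - 2) * f x * g x)) (at 0)"
proof -
  note [measurable] = Lp_measurable[OF f] Lp_measurable[OF g]
  have L: "(\<lambda>x. f x + t * g x) \<in> Lp M p" for t
    using Lp_add(1)[OF f Lp_cmult(1)[OF g]] p by simp
  have "((\<lambda>t. (pint M p (\<lambda>x. f x + t * g x) - pint M p f) / t) \<longlongrightarrow> p * (LINT x|M. \<bar>f x\<bar> powr (p - 2) * f x * g x))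
     (at 0 within {-1<..<1})"
    unfolding tendsto_at_iff_sequentially o_def
  proof (intro allI impI)
    fix X :: "nat \<Rightarrow> real"
    assume X: "\<forall>i. X i \<in> {-1<..<1} - {0}" "X \<longlonglongrightarrow> 0"
    have eq: "(pint M p (\<lambda>x. f x + X n * g x) - pint M p f) / X n
       = (LINT x|M. (\<bar>f x + X n * g x\<bar> powr p - \<bar>f x\<bar> powr p) / X n)" for n
      unfolding pint_def using Lp_integrable[OF L[of "X n"]] Lp_integrable[OF f] by simp
    have "(\<lambda>n. LINT x|M. (\<bar>f x + X n * g x\<bar> powr p - \<bar>f x\<bar> powr p) / X n)
       \<longlonglongrightarrow> (LINT x|M. p * (\<bar>f x\<bar> powr (p - 2) * f x * g x))"
    proof (rule integral_dominated_convergence)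
      have "(\<lambda>x. \<bar>f x\<bar> + \<bar>g x\<bar>) \<in> Lp M p"
        using Lp_mono(1)[OF _ f, of "\<lambda>x. \<bar>f x\<bar>"] Lp_mono(1)[OF _ g, of "\<lambda>x. \<bar>g x\<bar>"] p
        by (intro Lp_add(1)) auto
      from Lp_integrable[OF this]
      show "integrable M (\<lambda>x. p * (\<bar>f x\<bar> + \<bar>g x\<bar>) powr p)" by simp
      show "AE x in M. norm ((\<bar>f x + X n * g x\<bar> powr p - \<bar>f x\<bar> powr p) / X n) \<le> p * (\<bar>f x\<bar> + \<bar>g x\<bar>) powr p" for n
      proof (rule AE_I2)
        fix x
        have Xn: "X n \<noteq> 0" "\<bar>X n\<bar> \<le> 1" using X(1)[rule_format, of n] by auto
        show "norm ((\<bar>f x + X n * g x\<bar> powr p - \<bar>f x\<bar> powr p) / X n) \<le> p * (\<bar>f x\<bar> + \<bar>g x\<bar>) powr p"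
          using abs_powr_line_bound[OF p Xn(2), of "f x" "g x"] Xn by (simp add: field_simps)
      qed
      show "AE x in M. (\<lambda>n. (\<bar>f x + X n * g x\<bar> powr p - \<bar>f x\<bar> powr p) / X n) \<longlonglongrightarrow> p * (\<bar>f x\<bar> powr (p - 2) * f x * g x)"
      proof (rule AE_I2)
        fix x
        have "((\<lambda>t. \<bar>f x + t * g x\<bar> powr p) has_real_derivative p * \<bar>f x + 0 * g x\<bar> powr (p - 2) * (f x + 0 * g x) * g x) (at 0)"
          by (rule DERIV_chain2[OF abs_powr_has_derivative[OF p]]) (auto intro!: derivative_eq_intros)
        then have "((\<lambda>t. (\<bar>f x + t * g x\<bar> powr p - \<bar>f x\<bar> powr p) / t) \<longlongrightarrow> p * (\<bar>f x\<bar> powr (p - 2) * f x * g x)) (at 0)"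
          by (simp add: has_field_derivative_iff mult.assoc)
        then show "(\<lambda>n. (\<bar>f x + X n * g x\<bar> powr p - \<bar>f x\<bar> powr p) / X n) \<longlonglongrightarrow> p * (\<bar>f x\<bar> powr (p - 2) * f x * g x)"
          using X unfolding tendsto_at_iff_sequentially o_def by auto
      qed
    qed measurable
    then show "(\<lambda>n. (pint M p (\<lambda>x. f x + X n * g x) - pint M p f) / X n) \<longlonglongrightarrow> p * (LINT x|M. \<bar>f x\<bar> powr (p - 2) * f x * g x)"
      unfolding eq by simp
  qed
  then show ?thesis
    by (simp add: has_field_derivative_iff at_within_open[of 0 "{-1<..<1}"])
qed

section \<open>The Gagliardo energy and its invariances\<close>

lemma integrable_lborel_affine:
  fixes f :: "'a::euclidean_space \<Rightarrow> real"
  assumes c: "c \<noteq> 0" and f: "integrable lborel f"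
  shows "integrable lborel (\<lambda>x. f (t + c *\<^sub>R x))"
    and "(LINT x|lborel. f x) = \<bar>c\<bar> ^ DIM('a) * (LINT x|lborel. f (t + c *\<^sub>R x))"
proof -
  note [measurable] = borel_measurable_integrable[OF f]
  have fm: "f \<in> borel_measurable borel" using borel_measurable_integrable[OF f] by simp
  have T: "(\<lambda>x. t + c *\<^sub>R x) \<in> measurable lborel borel" by measurable
  have "integrable (density (distr lborel borel (\<lambda>x. t + c *\<^sub>R x)) (\<lambda>_. \<bar>c\<bar> ^ DIM('a))) f"
    using f lborel_affine[OF c, of t] by simp
  then have "integrable (distr lborel borel (\<lambda>x. t + c *\<^sub>R x)) (\<lambda>x. \<bar>c\<bar> ^ DIM('a) *\<^sub>R f x)"
    by (subst (asm) integrable_density) (use fm in auto)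
  then have "integrable (distr lborel borel (\<lambda>x. t + c *\<^sub>R x)) f"
    using c by simp
  then show "integrable lborel (\<lambda>x. f (t + c *\<^sub>R x))"
    using fm T by (subst (asm) integrable_distr_eq) auto
  have "(LINT x|lborel. f x) = (LINT x|density (distr lborel borel (\<lambda>x. t + c *\<^sub>R x)) (\<lambda>_. \<bar>c\<bar> ^ DIM('a)). f x)"
    using lborel_affine[OF c, of t] by simp
  also have "\<dots> = (LINT x|distr lborel borel (\<lambda>x. t + c *\<^sub>R x). \<bar>c\<bar> ^ DIM('a) *\<^sub>R f x)"
    by (subst integral_density) (use fm in auto)
  also have "\<dots> = \<bar>c\<bar> ^ DIM('a) * (LINT x|lborel. f (t + c *\<^sub>R x))"
    using fm T by (subst integral_distr) auto
  finally show "(LINT x|lborel. f x) = \<bar>c\<bar> ^ DIM('a) * (LINT x|lborel. f (t + c *\<^sub>R x))" .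
qed

lemma Lp_affine:
  fixes f :: "'a::euclidean_space \<Rightarrow> real"
  assumes c: "0 < c" and f: "f \<in> Lp lborel p"
  shows "(\<lambda>x. f (t + c *\<^sub>R x)) \<in> Lp lborel p"
    and "pint lborel p (\<lambda>x. f (t + c *\<^sub>R x)) = c powr (- real DIM('a)) * pint lborel p f"
proof -
  note [measurable] = Lp_measurable[OF f]
  have c0: "c \<noteq> 0" using c by simp
  note i = integrable_lborel_affine[OF c0 Lp_integrable[OF f], of t]
  show "(\<lambda>x. f (t + c *\<^sub>R x)) \<in> Lp lborel p"
    using i(1) Lp_measurable[OF f] by (auto simp: Lp_def)
  show "pint lborel p (\<lambda>x. f (t + c *\<^sub>R x)) = c powr (- real DIM('a)) * pint lborel p f"
    unfolding pint_def i(2) using c by (simp add: powr_minus powr_realpow)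
qed

text \<open>The kernel enters through its p-th root, which makes the quotient linear in u and turns
  the Gagliardo energy into an ordinary integral of a p-th power.\<close>

definition diff_quot :: "real \<Rightarrow> real \<Rightarrow> (real ^ 'n \<Rightarrow> real) \<Rightarrow> (real ^ 'n) \<times> (real ^ 'n) \<Rightarrow> real" where
  "diff_quot s p u = (\<lambda>(x, y). (u x - u y) / norm (x - y) powr ((real CARD('n) + s * p) / p))"

lemma borel_measurable_diff_quot:
  assumes [measurable]: "u \<in> borel_measurable borel"
  shows "diff_quot s p u \<in> borel_measurable (lborel \<Otimes>\<^sub>M lborel)"
  unfolding diff_quot_def by measurable

lemma gagliardo_integrand_eq:
  assumes "0 < p"
  shows "gagliardo_integrand s p u = (\<lambda>z. \<bar>diff_quot s p u z\<bar> powr p)"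
  using assms by (intro ext) (simp add: split_beta gagliardo_integrand_def diff_quot_def powr_divide powr_powr)

lemma diff_quot_add: "diff_quot s p (\<lambda>x. u x + c * v x) z = diff_quot s p u z + c * diff_quot s p v z"
  by (cases z) (simp add: diff_quot_def add_divide_distrib[symmetric] algebra_simps)

lemma diff_quot_cmult: "diff_quot s p (\<lambda>x. c * v x) z = c * diff_quot s p v z"
  by (cases z) (simp add: diff_quot_def algebra_simps)

lemma diff_quot_affine:
  fixes u :: "real ^ 'n \<Rightarrow> real"
  assumes "0 < R"
  shows "diff_quot s p (\<lambda>x. u (a + R *\<^sub>R x)) z =
    R powr ((real CARD('n) + s * p) / p) * diff_quot s p u ((a, a) + R *\<^sub>R z)"
proof (cases z)
  case (Pair x y)
  have "norm (a + R *\<^sub>R x - (a + R *\<^sub>R y)) = R * norm (x - y)"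
    using assms by (simp flip: scaleR_diff_right)
  then show ?thesis using assms Pair by (simp add: diff_quot_def powr_mult)
qed

text \<open>The parameter n names the type whose cardinality is the dimension, so that
  \<open>sobolev_const n s p\<close> can be formed inside the locale.\<close>

locale frac_sobolev =
  fixes n :: "'n::finite itself" and s p N q :: real
  assumes s: "0 < s" "s < 1" and p: "1 < p" and sp: "s * p < N"
    and N_def: "N = real CARD('n)" and q_def: "q = crit_exp CARD('n) s p"
begin

abbreviation W :: "(real ^ 'n \<Rightarrow> real) set" where "W \<equiv> sobolev_space s p"
abbreviation \<delta> :: "(real ^ 'n \<Rightarrow> real) \<Rightarrow> (real ^ 'n) \<times> (real ^ 'n) \<Rightarrow> real" where "\<delta> \<equiv> diff_quot s p"
abbreviation \<mu> :: "((real ^ 'n) \<times> (real ^ 'n)) measure" where "\<mu> \<equiv> lborel \<Otimes>\<^sub>M lborel"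
definition E :: "(real ^ 'n \<Rightarrow> real) \<Rightarrow> real" where "E u = pint \<mu> p (\<delta> u)"
definition B :: "(real ^ 'n \<Rightarrow> real) \<Rightarrow> real" where "B u = pint lborel q u"

lemma N_pos: "0 < N" by (simp add: N_def)

lemma q_eq: "q = N * p / (N - s * p)" by (simp add: q_def crit_exp_def N_def)

text \<open>N / q = N / p - s is the scaling relation of the critical exponent; 1 - p / q = s p / N
  is the form that produces the factor s / N and the exponent N / (s p) of the final
  formula.\<close>

lemma q_facts: "p < q" "0 < q" "1 < q" "N / q = N / p - s" "1 - p / q = s * p / N" "q * (s * p / N) = q - p"
proof -
  have d: "0 < N - s * p" using sp by simp
  have "q - p = s * p * p / (N - s * p)" using d by (simp add: q_eq field_simps)
  moreover have "0 < s * p * p / (N - s * p)" using d s p by simp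
  ultimately show 1: "p < q" by linarith
  then show "0 < q" "1 < q" using p by auto
  show "N / q = N / p - s" using d p N_pos by (simp add: q_eq diff_divide_distrib)
  have "p / q = (N - s * p) / N" using d p by (simp add: q_eq)
  then show 2: "1 - p / q = s * p / N" using N_pos by (simp add: diff_divide_distrib)
  show "q * (s * p / N) = q - p" unfolding 2[symmetric] using \<open>0 < q\<close> by (simp add: field_simps)
qed

lemma E_nonneg [simp]: "0 \<le> E u" and B_nonneg [simp]: "0 \<le> B u"
  by (simp_all add: E_def B_def)

lemma W_iff: "u \<in> W \<longleftrightarrow> u \<in> Lp lborel q \<and> \<delta> u \<in> Lp \<mu> p"
  using borel_measurable_diff_quot[of u s p] p
  by (auto simp: sobolev_space_def Lp_def gagliardo_integrand_eq q_def)

lemma W_Lp: "u \<in> W \<Longrightarrow> u \<in> Lp lborel q" "u \<in> W \<Longrightarrow> \<delta> u \<in> Lp \<mu> p"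
  by (simp_all add: W_iff)

lemma W_measurable [measurable_dest]: "u \<in> W \<Longrightarrow> u \<in> borel_measurable borel"
  by (simp add: sobolev_space_def)

lemma sobolev_norm_powr: "sobolev_norm s p u powr p = E u" if "u \<in> W" for u
proof -
  have "(LINT z|\<mu>. gagliardo_integrand s p u z) = E u"
    using p by (simp add: E_def pint_def gagliardo_integrand_eq)
  then show ?thesis using p by (simp add: sobolev_norm_def powr_powr)
qed

lemma sobolev_quotient_eq: "sobolev_quotient s p u = E u / B u powr (p / q)" if "u \<in> W" for u :: "real ^ 'n \<Rightarrow> real"
  unfolding sobolev_quotient_def q_def[symmetric]
  by (simp add: sobolev_norm_powr[OF that] B_def pint_def)

lemma nonzero_ae_iff: "nonzero_ae u \<longleftrightarrow> 0 < B u" if "u \<in> W"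
  using pint_eq_0_iff[OF W_Lp(1)[OF that]] B_nonneg[of u]
  unfolding nonzero_ae_def B_def[symmetric] by linarith

lemma W_add_cmult:
  assumes "u \<in> W" "v \<in> W"
  shows "(\<lambda>x. u x + c * v x) \<in> W"
proof -
  have "(\<lambda>x. u x + c * v x) \<in> Lp lborel q"
    using W_Lp(1)[OF assms(1)] Lp_cmult(1)[OF W_Lp(1)[OF assms(2)]] q_facts by (intro Lp_add(1)) auto
  moreover have "(\<lambda>z. \<delta> u z + c * \<delta> v z) \<in> Lp \<mu> p"
    using W_Lp(2)[OF assms(1)] Lp_cmult(1)[OF W_Lp(2)[OF assms(2)]] p by (intro Lp_add(1)) auto
  moreover have "\<delta> (\<lambda>x. u x + c * v x) = (\<lambda>z. \<delta> u z + c * \<delta> v z)"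
    by (rule ext) (rule diff_quot_add)
  ultimately show ?thesis by (simp add: W_iff)
qed

lemma W_cmult:
  assumes "u \<in> W"
  shows "(\<lambda>x. c * u x) \<in> W" "E (\<lambda>x. c * u x) = \<bar>c\<bar> powr p * E u" "B (\<lambda>x. c * u x) = \<bar>c\<bar> powr q * B u"
proof -
  have "\<delta> (\<lambda>x. c * u x) = (\<lambda>z. c * \<delta> u z)"
    by (rule ext) (rule diff_quot_cmult)
  then show "(\<lambda>x. c * u x) \<in> W" "E (\<lambda>x. c * u x) = \<bar>c\<bar> powr p * E u" "B (\<lambda>x. c * u x) = \<bar>c\<bar> powr q * B u"
    using Lp_cmult[OF W_Lp(1)[OF assms]] Lp_cmult[OF W_Lp(2)[OF assms]]
    by (simp_all add: W_iff E_def B_def)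
qed

lemma W_affine:
  assumes "u \<in> W" "0 < R"
  shows "(\<lambda>x. u (a + R *\<^sub>R x)) \<in> W"
    "E (\<lambda>x. u (a + R *\<^sub>R x)) = R powr (s * p - N) * E u"
    "B (\<lambda>x. u (a + R *\<^sub>R x)) = R powr (- N) * B u"
proof -
  have eq: "\<delta> (\<lambda>x. u (a + R *\<^sub>R x)) = (\<lambda>z. R powr ((N + s * p) / p) * \<delta> u ((a, a) + R *\<^sub>R z))"
    unfolding N_def by (rule ext) (rule diff_quot_affine[OF assms(2)])
  note 1 = Lp_affine[OF assms(2) W_Lp(1)[OF assms(1)], of a]
  note 2 = Lp_affine[OF assms(2) W_Lp(2)[OF assms(1), unfolded lborel_prod], of "(a, a)"]
  show "(\<lambda>x. u (a + R *\<^sub>R x)) \<in> W"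
    unfolding W_iff eq lborel_prod using 1(1) Lp_cmult(1)[OF 2(1)] by auto
  show "B (\<lambda>x. u (a + R *\<^sub>R x)) = R powr (- N) * B u"
    using 1(2) by (simp add: B_def N_def)
  \<comment> \<open>The first power comes from the kernel; \<open>R powr (- (2 * N))\<close> comes
    from the change of variables on the product space, which has dimension 2 N.\<close>
  have "E (\<lambda>x. u (a + R *\<^sub>R x)) = (R powr ((N + s * p) / p)) powr p * (R powr (- (2 * N)) * E u)"
    unfolding E_def eq lborel_prod Lp_cmult(2)[OF 2(1)] 2(2) by (simp add: N_def)
  also have "\<dots> = R powr (s * p - N) * E u"
    using assms p by (simp add: powr_powr flip: powr_add mult.assoc)
  finally show "E (\<lambda>x. u (a + R *\<^sub>R x)) = R powr (s * p - N) * E u" .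
qed

lemma W_abs:
  assumes "u \<in> W"
  shows "(\<lambda>x. \<bar>u x\<bar>) \<in> W" "E (\<lambda>x. \<bar>u x\<bar>) \<le> E u" "B (\<lambda>x. \<bar>u x\<bar>) = B u"
proof -
  note [measurable] = W_measurable[OF assms]
  have m: "\<delta> (\<lambda>x. \<bar>u x\<bar>) \<in> borel_measurable \<mu>" by (rule borel_measurable_diff_quot) measurable
  have le: "\<bar>\<delta> (\<lambda>x. \<bar>u x\<bar>) z\<bar> \<le> \<bar>\<delta> u z\<bar>" for z
    by (cases z) (simp add: diff_quot_def divide_right_mono)
  note 1 = Lp_mono[OF m W_Lp(2)[OF assms] le]
  show "(\<lambda>x. \<bar>u x\<bar>) \<in> W"
    unfolding W_iff using 1(1) p q_facts W_Lp(1)[OF assms] by (auto simp: Lp_def)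
  show "E (\<lambda>x. \<bar>u x\<bar>) \<le> E u" unfolding E_def using 1(2) p by simp
  show "B (\<lambda>x. \<bar>u x\<bar>) = B u" by (simp add: B_def pint_def)
qed

text \<open>Positivity of the minimizer is first obtained almost everywhere, while
  \<open>normalized_minimizer\<close> asks for it at every point; this permits the change on a null
  set.\<close>

lemma W_cong_AE:
  assumes "u \<in> W" and v: "v \<in> borel_measurable borel" and ae: "AE x in lborel. u x = v x"
  shows "v \<in> W" "E v = E u" "B v = B u"
proof -
  note [measurable] = W_measurable[OF assms(1)] v
  have "AE x in lborel. AE y in lborel. u x = v x \<and> u y = v y"
    using ae by eventually_elim (use ae in auto)
  moreover have "{z \<in> space \<mu>. u (fst z) = v (fst z) \<and> u (snd z) = v (snd z)} \<in> sets \<mu>"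
    by measurable
  ultimately have "AE z in \<mu>. u (fst z) = v (fst z) \<and> u (snd z) = v (snd z)"
    using lborel_pair.AE_pair_iff[where P = "\<lambda>x y. u x = v x \<and> u y = v y"] by simp
  then have d: "AE z in \<mu>. \<delta> u z = \<delta> v z"
    by eventually_elim (auto simp: diff_quot_def split: prod.splits)
  have m: "\<delta> u \<in> borel_measurable \<mu>" "\<delta> v \<in> borel_measurable \<mu>"
    by (auto intro!: borel_measurable_diff_quot)
  have ae': "AE x in lborel. v x = u x" "AE z in \<mu>. \<delta> v z = \<delta> u z" using ae d by auto
  show "v \<in> W"
    using Lp_cong_AE[OF W_Lp(1)[OF assms(1)] _ ae] Lp_cong_AE[OF W_Lp(2)[OF assms(1)] m(2) d] v
    by (simp add: W_iff)
  show "E v = E u" unfolding E_def by (rule pint_cong_AE[OF m(2,1) ae'(2)])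
  show "B v = B u" unfolding B_def by (rule pint_cong_AE[OF _ _ ae'(1)]) auto
qed

end

section \<open>A compactly supported Lipschitz function of finite energy\<close>

text \<open>Turns an estimate on each dyadic shell into a series; overlaps of the sets only increase
  the right-hand side.\<close>

lemma nn_integral_cover_le:
  fixes f :: "'a \<Rightarrow> ennreal" and A :: "nat \<Rightarrow> 'a set"
  assumes [measurable]: "\<And>j. A j \<in> sets M"
    and c: "\<And>x. x \<in> space M \<Longrightarrow> f x = 0 \<or> (\<exists>j. x \<in> A j \<and> f x \<le> c j)"
  shows "(\<integral>\<^sup>+x. f x \<partial>M) \<le> (\<Sum>j. c j * emeasure M (A j))"
proof -
  have "(\<integral>\<^sup>+x. f x \<partial>M) \<le> (\<integral>\<^sup>+x. (\<Sum>j. c j * indicator (A j) x) \<partial>M)"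
  proof (rule nn_integral_mono)
    fix x assume "x \<in> space M"
    then consider "f x = 0" | j where "x \<in> A j" "f x \<le> c j" using c by blast
    then show "f x \<le> (\<Sum>j. c j * indicator (A j) x)"
    proof cases
      case 2
      have "g j \<le> suminf g" for g :: "nat \<Rightarrow> ennreal"
        using sum_le_suminf[of g "{j}"] by simp
      from this[of "\<lambda>j. c j * indicator (A j) x"]
      have "c j * indicator (A j) x \<le> (\<Sum>j. c j * indicator (A j) x)" .
      then show ?thesis using 2 by (auto intro: order_trans)
    qed simp
  qed
  also have "\<dots> = (\<Sum>j. \<integral>\<^sup>+x. c j * indicator (A j) x \<partial>M)"
    by (rule nn_integral_suminf) measurable
  also have "\<dots> = (\<Sum>j. c j * emeasure M (A j))"
    by (simp add: nn_integral_cmult_indicator)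
  finally show ?thesis .
qed

lemma suminf_geometric_finite:
  assumes "0 \<le> c" "0 \<le> r" "r < 1"
  shows "(\<Sum>j. ennreal (c * r ^ j)) < \<infinity>"
proof -
  have "summable (\<lambda>j. c * r ^ j)" using assms by (intro summable_mult summable_geometric) auto
  then have "(\<Sum>j. ennreal (c * r ^ j)) = ennreal (\<Sum>j. c * r ^ j)"
    using assms by (intro suminf_ennreal2) auto
  then show ?thesis by simp
qed

lemma nn_integral_lborel_reflect:
  fixes f :: "'a::euclidean_space \<Rightarrow> ennreal"
  assumes [measurable]: "f \<in> borel_measurable borel"
  shows "(\<integral>\<^sup>+y. f (x - y) \<partial>lborel) = (\<integral>\<^sup>+y. f y \<partial>lborel)"
proof -
  have "(lborel :: 'a measure) = distr lborel borel (\<lambda>y. x - y)"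
    using lborel_affine[of "-1::real" x] by (simp add: density_1)
  then have "(\<integral>\<^sup>+y. f y \<partial>lborel) = (\<integral>\<^sup>+y. f y \<partial>distr lborel borel (\<lambda>y. x - y))" by simp
  also have "\<dots> = (\<integral>\<^sup>+y. f (x - y) \<partial>lborel)"
    by (rule nn_integral_distr) auto
  finally show ?thesis by simp
qed

context frac_sobolev
begin

section \<open>Integrability of the truncated kernel\<close>

definition \<kappa> :: real where "\<kappa> = N + s * p"

definition \<omega> :: real where "\<omega> = unit_ball_vol N"

lemma \<omega>_pos: "0 < \<omega>"
  unfolding \<omega>_def unfolding N_def by simp

lemma emeasure_ball_powr:
  fixes a :: "real ^ 'n"
  assumes "0 < r"
  shows "emeasure lborel (cball a r) = ennreal (\<omega> * r powr N)"
  using assms unfolding \<omega>_def unfolding N_def by (simp add: emeasure_cball powr_realpow)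

lemma measure_ball_powr:
  fixes a :: "real ^ 'n"
  assumes "0 < r"
  shows "measure lborel (cball a r) = \<omega> * r powr N"
  using emeasure_ball_powr[OF assms] \<omega>_pos by (simp add: measure_def)

text \<open>Bounds the energy density, at displacement h, of a 1-Lipschitz function with values in
  the unit interval: the Lipschitz bound tames the singularity at 0, the bound 1 serves far away. At
  h = 0 the quotient is 0 / 0 and hence 0.\<close>

definition kern :: "real ^ 'n \<Rightarrow> real" where
  "kern h = min 1 (norm h powr p) / norm h powr \<kappa>"

lemma kern_measurable [measurable]: "kern \<in> borel_measurable borel"
  unfolding kern_def by measurable

lemma kern_nonneg: "0 \<le> kern h"
  by (simp add: kern_def)

text \<open>On the shell 2^j \<le> |h| \<le> 2^(j+1) the kernel is at most 2^(-j \<kappa>) and the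
  volume is of order 2^(j N), which gives a geometric series with ratio 2^(-s p).\<close>

lemma nn_integral_kern_far: "(\<integral>\<^sup>+h. ennreal (kern h) * indicator (- ball 0 1) h \<partial>lborel) < \<infinity>"
proof -
  have "(\<integral>\<^sup>+h. ennreal (kern h) * indicator (- ball 0 1) h \<partial>lborel)
    \<le> (\<Sum>j. ennreal (2 powr (- real j * \<kappa>)) * emeasure lborel (cball (0 :: real ^ 'n) (2 powr (real j + 1))))"
  proof (rule nn_integral_cover_le)
    fix h :: "real ^ 'n"
    show "ennreal (kern h) * indicator (- ball 0 1) h = 0 \<or>
       (\<exists>j. h \<in> cball 0 (2 powr (real j + 1)) \<and> ennreal (kern h) * indicator (- ball 0 1) h \<le> ennreal (2 powr (- real j * \<kappa>)))"
    proof (cases "norm h < 1")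
      case False
      define j where "j = nat \<lfloor>log 2 (norm h)\<rfloor>"
      have "1 \<le> norm h" "h \<noteq> 0" using False by auto
      then have "0 \<le> log 2 (norm h)" by (subst zero_le_log_cancel_iff) auto
      then have j: "real j \<le> log 2 (norm h)" "log 2 (norm h) < real j + 1"
        unfolding j_def by linarith+
      have h: "2 powr (real j) \<le> norm h" "norm h \<le> 2 powr (real j + 1)"
        using j \<open>h \<noteq> 0\<close> le_log_iff[of 2 "norm h" "real j"] log_le_iff[of 2 "norm h" "real j + 1"] by auto
      have "kern h \<le> 1 / norm h powr \<kappa>"
        unfolding kern_def by (intro divide_right_mono) auto
      also have "\<dots> \<le> 1 / (2 powr (real j)) powr \<kappa>"
        using h s p N_pos by (intro divide_left_mono powr_mono2 mult_pos_pos) (auto simp: \<kappa>_def)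
      also have "\<dots> = 2 powr (- real j * \<kappa>)" by (simp add: powr_powr powr_minus_divide)
      finally show ?thesis using h False by (intro disjI2 exI[of _ j]) (auto intro: ennreal_leI)
    qed (auto simp: indicator_def)
  qed auto
  also have "\<dots> = (\<Sum>j. ennreal (\<omega> * 2 powr N * (2 powr (- (s * p))) ^ j))"
  proof (rule suminf_cong)
    fix j
    have "ennreal (2 powr (- real j * \<kappa>)) * emeasure lborel (cball (0 :: real ^ 'n) (2 powr (real j + 1)))
      = ennreal (2 powr (- real j * \<kappa>) * (\<omega> * (2 powr (real j + 1)) powr N))"
      using \<omega>_pos by (simp add: emeasure_ball_powr ennreal_mult)
    also have "2 powr (- real j * \<kappa>) * (\<omega> * (2 powr (real j + 1)) powr N) = \<omega> * 2 powr N * (2 powr (- (s * p))) ^ j"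
      by (simp add: powr_powr powr_realpow[symmetric] \<kappa>_def algebra_simps flip: powr_add)
    finally show "ennreal (2 powr (- real j * \<kappa>)) * emeasure lborel (cball (0 :: real ^ 'n) (2 powr (real j + 1)))
      = ennreal (\<omega> * 2 powr N * (2 powr (- (s * p))) ^ j)" .
  qed
  also have "\<dots> < \<infinity>"
    using \<omega>_pos s p by (intro suminf_geometric_finite) (auto simp: powr_less_one)
  finally show ?thesis .
qed

text \<open>The shells 2^(-j-1) \<le> |h| \<le> 2^(-j) give a geometric series with ratio 2^(s p -
  p); its convergence is where s < 1 enters.\<close>

lemma nn_integral_kern_near: "(\<integral>\<^sup>+h. ennreal (kern h) * indicator (ball 0 1) h \<partial>lborel) < \<infinity>"
proof -
  have "(\<integral>\<^sup>+h. ennreal (kern h) * indicator (ball 0 1) h \<partial>lborel)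
    \<le> (\<Sum>j. ennreal (2 powr (- real j * p + (real j + 1) * \<kappa>)) * emeasure lborel (cball (0 :: real ^ 'n) (2 powr (- real j))))"
  proof (rule nn_integral_cover_le)
    fix h :: "real ^ 'n"
    show "ennreal (kern h) * indicator (ball 0 1) h = 0 \<or>
       (\<exists>j. h \<in> cball 0 (2 powr (- real j)) \<and> ennreal (kern h) * indicator (ball 0 1) h \<le> ennreal (2 powr (- real j * p + (real j + 1) * \<kappa>)))"
    proof (cases "norm h < 1 \<and> h \<noteq> 0")
      case True
      define j where "j = nat \<lfloor>- log 2 (norm h)\<rfloor>"
      have "0 \<le> - log 2 (norm h)" using True by (simp add: log_le_zero_cancel_iff)
      then have j: "real j \<le> - log 2 (norm h)" "- log 2 (norm h) < real j + 1"
        unfolding j_def by linarith+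
      then have j': "log 2 (norm h) \<le> - real j" "- (real j + 1) \<le> log 2 (norm h)" by linarith+
      have h: "2 powr (- (real j + 1)) \<le> norm h" "norm h \<le> 2 powr (- real j)"
        using j' True le_log_iff[of 2 "norm h" "- (real j + 1)"] log_le_iff[of 2 "norm h" "- real j"] by auto
      have "kern h \<le> norm h powr p / norm h powr \<kappa>"
        unfolding kern_def by (intro divide_right_mono) auto
      also have "\<dots> \<le> (2 powr (- real j)) powr p / (2 powr (- (real j + 1))) powr \<kappa>"
        using h s p N_pos True by (intro frac_le powr_mono2) (auto simp: \<kappa>_def)
      also have "\<dots> = 2 powr (- real j * p + (real j + 1) * \<kappa>)"
        by (simp only: powr_powr powr_diff[symmetric]) (simp add: algebra_simps)
      finally show ?thesis using h True by (intro disjI2 exI[of _ j]) (auto intro: ennreal_leI)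
    qed (auto simp: kern_def indicator_def)
  qed auto
  also have "\<dots> = (\<Sum>j. ennreal (\<omega> * 2 powr \<kappa> * (2 powr (s * p - p)) ^ j))"
  proof (rule suminf_cong)
    fix j
    have "ennreal (2 powr (- real j * p + (real j + 1) * \<kappa>)) * emeasure lborel (cball (0 :: real ^ 'n) (2 powr (- real j)))
      = ennreal (2 powr (- real j * p + (real j + 1) * \<kappa>) * (\<omega> * (2 powr (- real j)) powr N))"
      using \<omega>_pos by (simp add: emeasure_ball_powr ennreal_mult)
    also have "2 powr (- real j * p + (real j + 1) * \<kappa>) * (\<omega> * (2 powr (- real j)) powr N) = \<omega> * 2 powr \<kappa> * (2 powr (s * p - p)) ^ j"
      by (simp add: powr_powr powr_realpow[symmetric] \<kappa>_def algebra_simps flip: powr_add)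
    finally show "ennreal (2 powr (- real j * p + (real j + 1) * \<kappa>)) * emeasure lborel (cball (0 :: real ^ 'n) (2 powr (- real j)))
      = ennreal (\<omega> * 2 powr \<kappa> * (2 powr (s * p - p)) ^ j)" .
  qed
  also have "\<dots> < \<infinity>"
    using \<omega>_pos s p by (intro suminf_geometric_finite) (auto simp: powr_less_one)
  finally show ?thesis .
qed

lemma unit_balls_measurable [measurable]:
  "cball (0 :: real ^ 'n) 1 \<in> sets borel" "ball (0 :: real ^ 'n) 1 \<in> sets borel"
  by auto

lemma nn_integral_kern: "(\<integral>\<^sup>+h. ennreal (kern h) \<partial>lborel) < \<infinity>"
proof -
  have "(\<integral>\<^sup>+h. ennreal (kern h) \<partial>lborel) =
    (\<integral>\<^sup>+h. ennreal (kern h) * indicator (- ball 0 1) h + ennreal (kern h) * indicator (ball 0 1) h \<partial>lborel)"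
    by (intro nn_integral_cong) (auto simp: indicator_def)
  also have "\<dots> = (\<integral>\<^sup>+h. ennreal (kern h) * indicator (- ball 0 1) h \<partial>lborel) + (\<integral>\<^sup>+h. ennreal (kern h) * indicator (ball 0 1) h \<partial>lborel)"
    by (intro nn_integral_add) measurable
  finally show ?thesis using nn_integral_kern_far nn_integral_kern_near by simp
qed

definition cutoff :: "real ^ 'n \<Rightarrow> real" where "cutoff x = max 0 (1 - norm x)"

lemma cutoff_bounds: "0 \<le> cutoff x" "cutoff x \<le> 1" "norm x < 1 \<Longrightarrow> 0 < cutoff x"
  by (auto simp: cutoff_def)

lemma cutoff_measurable [measurable]: "cutoff \<in> borel_measurable borel"
  unfolding cutoff_def by measurable

lemma cutoff_diff: "\<bar>cutoff x - cutoff y\<bar> powr p \<le> min 1 (norm (x - y) powr p) * (indicator (cball 0 1) x + indicator (cball 0 1) y)"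
proof (cases "x \<in> cball 0 1 \<or> y \<in> cball 0 1")
  case True
  have "\<bar>cutoff x - cutoff y\<bar> \<le> norm (x - y)"
    using norm_triangle_ineq3[of x y] unfolding cutoff_def by (auto simp: max_def)
  then have "\<bar>cutoff x - cutoff y\<bar> powr p \<le> norm (x - y) powr p" using p by (intro powr_mono2) auto
  moreover have "\<bar>cutoff x - cutoff y\<bar> \<le> 1" using cutoff_bounds[of x] cutoff_bounds[of y] by linarith
  then have "\<bar>cutoff x - cutoff y\<bar> powr p \<le> 1" using p by (intro powr_le1) auto
  ultimately have "\<bar>cutoff x - cutoff y\<bar> powr p \<le> min 1 (norm (x - y) powr p) * 1" by simp
  also have "\<dots> \<le> min 1 (norm (x - y) powr p) * (indicator (cball 0 1) x + indicator (cball 0 1) y)"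
    using True by (intro mult_left_mono) (auto simp: indicator_def)
  finally show ?thesis .
next
  case False
  then show ?thesis using p by (auto simp: cutoff_def)
qed

text \<open>Used twice: with \<open>B_cutoff_pos\<close> it makes the set in the infimum defining
  the Sobolev constant nonempty, and, dilated, it is the perturbation in
  \<open>minimizer_positive\<close>.\<close>

lemma cutoff_in_W: "cutoff \<in> W"
proof -
  have "integrable lborel (\<lambda>x. \<bar>cutoff x\<bar> powr q)"
  proof (rule Bochner_Integration.integrable_bound)
    show "integrable lborel (indicator (cball (0 :: real ^ 'n) 1) :: _ \<Rightarrow> real)"
      using emeasure_ball_powr[of 1 0] by (intro integrable_real_indicator) auto
    show "AE x in lborel. norm (\<bar>cutoff x\<bar> powr q) \<le> norm (indicator (cball 0 1) x :: real)"
    proof (rule AE_I2)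
      fix x
      have "\<bar>cutoff x\<bar> powr q \<le> 1" using cutoff_bounds[of x] q_facts by (intro powr_le1) auto
      then show "norm (\<bar>cutoff x\<bar> powr q) \<le> norm (indicator (cball 0 1) x :: real)"
        using q_facts by (auto simp: indicator_def cutoff_def)
    qed
  qed measurable
  moreover have "integrable \<mu> (\<lambda>z. \<bar>\<delta> cutoff z\<bar> powr p)"
  proof (rule integrableI_bounded)
    have [measurable]: "\<delta> cutoff \<in> borel_measurable \<mu>" by (rule borel_measurable_diff_quot) measurable
    show "(\<lambda>z. \<bar>\<delta> cutoff z\<bar> powr p) \<in> borel_measurable \<mu>" by measurable
    define I where "I = (\<integral>\<^sup>+h. ennreal (kern h) \<partial>lborel)"
    define J :: "real ^ 'n \<Rightarrow> ennreal" where "J = indicator (cball 0 1)"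
    have [measurable]: "J \<in> borel_measurable borel" unfolding J_def by measurable
    have J: "(\<integral>\<^sup>+x. J x \<partial>lborel) < \<infinity>" unfolding J_def using emeasure_ball_powr[of 1 0] by simp
    \<comment> \<open>A nonzero difference needs one of the two points in the unit ball. After this
      bound Tonelli's theorem integrates \<open>kern\<close> over the free variable and
      \<open>J\<close> over the confined one.\<close>
    have "ennreal (norm (\<bar>\<delta> cutoff z\<bar> powr p)) \<le>
       ennreal (kern (fst z - snd z)) * J (fst z) + ennreal (kern (fst z - snd z)) * J (snd z)" for z
    proof (cases z)
      case (Pair x y)
      have "\<bar>\<delta> cutoff z\<bar> powr p = \<bar>cutoff x - cutoff y\<bar> powr p / norm (x - y) powr \<kappa>"
        using p Pair unfolding \<kappa>_def unfolding N_def by (simp add: diff_quot_def powr_divide powr_powr)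
      also have "\<dots> \<le> min 1 (norm (x - y) powr p) * (indicator (cball 0 1) x + indicator (cball 0 1) y) / norm (x - y) powr \<kappa>"
        by (intro divide_right_mono cutoff_diff) auto
      also have "\<dots> = kern (x - y) * indicator (cball 0 1) x + kern (x - y) * indicator (cball 0 1) y"
        by (simp add: kern_def distrib_left add_divide_distrib)
      finally have "ennreal (norm (\<bar>\<delta> cutoff z\<bar> powr p)) \<le> ennreal (kern (x - y) * indicator (cball 0 1) x + kern (x - y) * indicator (cball 0 1) y)"
        by (simp add: ennreal_leI)
      also have "\<dots> = ennreal (kern (x - y)) * J x + ennreal (kern (x - y)) * J y"
        using kern_nonneg[of "x - y"] by (auto simp: J_def indicator_def)
      finally show ?thesis using Pair by simp
    qed
    then have "(\<integral>\<^sup>+z. ennreal (norm (\<bar>\<delta> cutoff z\<bar> powr p)) \<partial>\<mu>) \<le>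
       (\<integral>\<^sup>+z. ennreal (kern (fst z - snd z)) * J (fst z) + ennreal (kern (fst z - snd z)) * J (snd z) \<partial>\<mu>)"
      by (intro nn_integral_mono)
    also have "\<dots> = (\<integral>\<^sup>+z. ennreal (kern (fst z - snd z)) * J (fst z) \<partial>\<mu>) + (\<integral>\<^sup>+z. ennreal (kern (fst z - snd z)) * J (snd z) \<partial>\<mu>)"
      by (rule nn_integral_add) measurable
    also have "(\<integral>\<^sup>+z. ennreal (kern (fst z - snd z)) * J (fst z) \<partial>\<mu>) = (\<integral>\<^sup>+x. (\<integral>\<^sup>+y. ennreal (kern (x - y)) * J x \<partial>lborel) \<partial>lborel)"
      by (subst lborel.nn_integral_fst[symmetric]) auto
    also have "\<dots> = (\<integral>\<^sup>+x. I * J x \<partial>lborel)"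
      by (simp add: nn_integral_multc nn_integral_lborel_reflect[where f="\<lambda>h. ennreal (kern h)"] I_def)
    also have "(\<integral>\<^sup>+z. ennreal (kern (fst z - snd z)) * J (snd z) \<partial>\<mu>) = (\<integral>\<^sup>+y. (\<integral>\<^sup>+x. ennreal (kern (x - y)) * J y \<partial>lborel) \<partial>lborel)"
      by (subst lborel_pair.nn_integral_snd[symmetric]) auto
    also have "\<dots> = (\<integral>\<^sup>+y. (\<integral>\<^sup>+x. ennreal (kern (y - x)) * J y \<partial>lborel) \<partial>lborel)"
      by (simp add: kern_def norm_minus_commute)
    also have "\<dots> = (\<integral>\<^sup>+x. I * J x \<partial>lborel)"
      by (simp add: nn_integral_multc nn_integral_lborel_reflect[where f="\<lambda>h. ennreal (kern h)"] I_def)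
    also have "(\<integral>\<^sup>+x. I * J x \<partial>lborel) = I * (\<integral>\<^sup>+x. J x \<partial>lborel)"
      by (rule nn_integral_cmult) measurable
    also have "I * (\<integral>\<^sup>+x. J x \<partial>lborel) + I * (\<integral>\<^sup>+x. J x \<partial>lborel) < \<infinity>"
      using nn_integral_kern J by (auto simp: I_def ennreal_mult_less_top)
    finally show "(\<integral>\<^sup>+z. ennreal (norm (\<bar>\<delta> cutoff z\<bar> powr p)) \<partial>\<mu>) < \<infinity>" .
  qed
  ultimately show ?thesis
    unfolding W_iff using borel_measurable_diff_quot[of cutoff s p] by (simp add: Lp_def)
qed

lemma B_cutoff_pos: "0 < B cutoff"
proof (rule ccontr)
  assume "\<not> 0 < B cutoff"
  then have "B cutoff = 0" using B_nonneg[of cutoff] by linarith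
  then have "AE x in lborel. cutoff x = 0"
    using pint_eq_0_iff[OF W_Lp(1)[OF cutoff_in_W]] by (simp add: B_def)
  then have "AE x in lborel. x \<notin> ball (0 :: real ^ 'n) 1"
    by eventually_elim (auto simp: cutoff_def)
  then have "emeasure lborel (ball (0 :: real ^ 'n) 1) = 0"
    by (subst (asm) AE_iff_measurable[of "ball 0 1"]) auto
  then show False using unit_ball_vol_pos[of "real CARD('n)"] by (simp add: emeasure_ball)
qed

end

section \<open>An improved Sobolev inequality\<close>

text \<open>Split at t = \<tau>. With \<tau> free this takes the place of Hoelder's inequality in
  the local estimates: a suitable \<tau> recovers the scaling exponents.\<close>

lemma le_add_powr_Young:
  fixes t \<tau> p :: real
  assumes "0 \<le> t" "0 < \<tau>" "1 \<le> p"
  shows "t \<le> \<tau> + \<tau> powr (1 - p) * t powr p"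
proof (cases "t \<le> \<tau>")
  case False
  then have "t = t powr (1 - p) * t powr p" using assms by (simp flip: powr_add)
  also have "\<dots> \<le> \<tau> powr (1 - p) * t powr p"
    using False assms by (intro mult_right_mono powr_mono2') auto
  finally show ?thesis using assms by simp
qed (use assms in \<open>simp add: add_increasing2\<close>)

context frac_sobolev
begin

text \<open>Where the inner integral diverges the Bochner integral is 0, so pointwise bounds by
  \<open>G u x\<close> also assume integrability in y, which \<open>G_facts\<close> provides almost
  everywhere.\<close>

definition G :: "(real ^ 'n \<Rightarrow> real) \<Rightarrow> real ^ 'n \<Rightarrow> real" where
  "G u x = (LINT y|lborel. \<bar>\<delta> u (x, y)\<bar> powr p)"

lemma G_nonneg: "0 \<le> G u x"
  by (simp add: G_def)

lemma G_facts:
  assumes "u \<in> W"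
  shows "AE x in lborel. integrable lborel (\<lambda>y. \<bar>\<delta> u (x, y)\<bar> powr p)"
    "integrable lborel (G u)" "(LINT x|lborel. G u x) = E u"
  using lborel_pair.AE_integrable_fst'[OF Lp_integrable[OF W_Lp(2)[OF assms]]]
    lborel_pair.integrable_fst'[OF Lp_integrable[OF W_Lp(2)[OF assms]]]
    lborel_pair.integral_fst'[OF Lp_integrable[OF W_Lp(2)[OF assms]]]
  by (simp_all add: G_def[abs_def] E_def pint_def)

lemma Lp_set_integrable:
  assumes u: "u \<in> Lp lborel q" and [measurable]: "A \<in> sets lborel" and A: "emeasure lborel A < \<infinity>" and \<tau>: "0 < \<tau>"
  shows "integrable lborel (\<lambda>y. indicator A y * u y)"
    "(LINT y|lborel. indicator A y * \<bar>u y\<bar>) \<le> \<tau> * measure lborel A + \<tau> powr (1 - q) * pint lborel q u"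
proof -
  note [measurable] = Lp_measurable[OF u]
  have iA: "integrable lborel (indicator A :: _ \<Rightarrow> real)"
    using A assms(2) by (intro integrable_real_indicator) auto
  have i: "integrable lborel (\<lambda>y. \<tau> * indicator A y + \<tau> powr (1 - q) * \<bar>u y\<bar> powr q)"
    using iA Lp_integrable[OF u] by auto
  have le: "\<bar>indicator A y * u y\<bar> \<le> \<tau> * indicator A y + \<tau> powr (1 - q) * \<bar>u y\<bar> powr q" for y
    using le_add_powr_Young[of "\<bar>u y\<bar>" \<tau> q] q_facts \<tau> by (auto simp: indicator_def)
  show 1: "integrable lborel (\<lambda>y. indicator A y * u y)"
    by (rule Bochner_Integration.integrable_bound[OF i]) (use order_trans[OF le abs_ge_self] in auto)
  have "(LINT y|lborel. indicator A y * \<bar>u y\<bar>) \<le> (LINT y|lborel. \<tau> * indicator A y + \<tau> powr (1 - q) * \<bar>u y\<bar> powr q)"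
    using integrable_abs[OF 1] le by (intro integral_mono i) (auto simp: abs_mult)
  also have "\<dots> = \<tau> * measure lborel A + \<tau> powr (1 - q) * pint lborel q u"
    using iA A Lp_integrable[OF u] by (simp add: pint_def)
  finally show "(LINT y|lborel. indicator A y * \<bar>u y\<bar>) \<le> \<tau> * measure lborel A + \<tau> powr (1 - q) * pint lborel q u" .
qed

text \<open>For y in A the kernel factor |x - y|^\<kappa> is at most \<rho>^\<kappa>, so the local
  energy at x controls the deviation of u x from the average over A. The set A is a ball around x in
  \<open>improved_Sobolev\<close> and a ball around a nearby grid point in
  \<open>W_rellich\<close>.\<close>

lemma local_oscillation:
  assumes u: "u \<in> W" and A: "A \<in> sets lborel" "A \<subseteq> cball x \<rho>" and \<rho>: "0 < \<rho>" and \<tau>: "0 < \<tau>"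
    and i: "integrable lborel (\<lambda>y. \<bar>\<delta> u (x, y)\<bar> powr p)"
  shows "\<bar>u x * measure lborel A - (LINT y|lborel. indicator A y * u y)\<bar>
    \<le> \<tau> * measure lborel A + \<tau> powr (1 - p) * \<rho> powr \<kappa> * G u x"
proof -
  note [measurable] = W_measurable[OF u] A(1)
  have "emeasure lborel A \<le> emeasure lborel (cball x \<rho>)" using A by (intro emeasure_mono) auto
  also have "\<dots> < \<infinity>" using emeasure_ball_powr[OF \<rho>, of x] by simp
  finally have fin: "emeasure lborel A < \<infinity>" .
  note iA = integrable_real_indicator[OF A(1) fin]
  note iu = Lp_set_integrable(1)[OF W_Lp(1)[OF u] A(1) fin zero_less_one]
  have le: "\<bar>indicator A y * (u x - u y)\<bar> \<le> \<tau> * indicator A y + \<tau> powr (1 - p) * \<rho> powr \<kappa> * \<bar>\<delta> u (x, y)\<bar> powr p" for y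
  proof (cases "y \<in> A \<and> x \<noteq> y")
    case True
    then have d: "norm (x - y) \<le> \<rho>" "0 < norm (x - y)" using A(2) by (auto simp: dist_norm)
    have eq: "\<bar>u x - u y\<bar> powr p = norm (x - y) powr \<kappa> * \<bar>\<delta> u (x, y)\<bar> powr p"
      using p d unfolding \<kappa>_def unfolding N_def by (simp add: diff_quot_def powr_divide powr_powr)
    have "\<bar>u x - u y\<bar> \<le> \<tau> + \<tau> powr (1 - p) * \<bar>u x - u y\<bar> powr p"
      using p \<tau> by (intro le_add_powr_Young) auto
    also have "\<dots> \<le> \<tau> + \<tau> powr (1 - p) * (\<rho> powr \<kappa> * \<bar>\<delta> u (x, y)\<bar> powr p)"
      unfolding eq using d s p N_pos
      by (intro add_left_mono mult_left_mono mult_right_mono powr_mono2) (auto simp: \<kappa>_def)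
    finally show ?thesis using True by (simp add: mult.assoc)
  qed (use \<tau> in \<open>auto simp: indicator_def\<close>)
  have eq: "u x * measure lborel A - (LINT y|lborel. indicator A y * u y) = (LINT y|lborel. indicator A y * (u x - u y))"
    using iA iu fin by (simp add: right_diff_distrib)
  have "\<bar>LINT y|lborel. indicator A y * (u x - u y)\<bar> \<le> (LINT y|lborel. \<bar>indicator A y * (u x - u y)\<bar>)"
    by (rule integral_abs_bound)
  also have "\<dots> \<le> (LINT y|lborel. \<tau> * indicator A y + \<tau> powr (1 - p) * \<rho> powr \<kappa> * \<bar>\<delta> u (x, y)\<bar> powr p)"
  proof (intro integral_mono le integrable_abs)
    show "integrable lborel (\<lambda>y. indicator A y * (u x - u y))"
      using iA iu by (simp add: right_diff_distrib)
    show "integrable lborel (\<lambda>y. \<tau> * indicator A y + \<tau> powr (1 - p) * \<rho> powr \<kappa> * \<bar>\<delta> u (x, y)\<bar> powr p)"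
      using iA i by simp
  qed
  also have "\<dots> = \<tau> * measure lborel A + \<tau> powr (1 - p) * \<rho> powr \<kappa> * G u x"
    using iA i fin by (simp add: G_def)
  finally show ?thesis unfolding eq .
qed

text \<open>An argument of Hedberg type: the radius is optimized separately at each x, which gives
  |u x|^q \<le> C^q M^(q-p) G u x almost everywhere, and the right-hand side integrates to a
  multiple of E u.\<close>

lemma improved_Sobolev:
  assumes u: "u \<in> W" and M: "0 < M"
    and Morrey: "\<And>a R. 0 < R \<Longrightarrow> (LINT y|lborel. indicator (cball a R) y * \<bar>u y\<bar>) \<le> M * R powr (N - N / q)"
  shows "B u \<le> (1 + 2 / \<omega>) powr q * M powr (q - p) * E u"
proof -
  note [measurable] = W_measurable[OF u]
  define C where "C = 1 + 2 / \<omega>"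
  have C: "0 < C" using \<omega>_pos by (simp add: C_def add_pos_pos)
  have "AE x in lborel. \<bar>u x\<bar> powr q \<le> C powr q * M powr (q - p) * G u x"
    using G_facts(1)[OF u]
  proof eventually_elim
    case (elim x)
    have bound: "\<bar>u x\<bar> \<le> \<tau> + (\<tau> powr (1 - p) * R powr (s * p) * G u x + M * R powr (- (N / q))) / \<omega>"
      if "0 < \<tau>" "0 < R" for \<tau> R
    proof -
      have "\<bar>u x * measure lborel (cball x R) - (LINT y|lborel. indicator (cball x R) y * u y)\<bar>
        \<le> \<tau> * measure lborel (cball x R) + \<tau> powr (1 - p) * R powr \<kappa> * G u x"
        by (rule local_oscillation[OF u _ _ that(2) that(1) elim]) auto
      moreover have "\<bar>LINT y|lborel. indicator (cball x R) y * u y\<bar> \<le> (LINT y|lborel. \<bar>indicator (cball x R) y * u y\<bar>)"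
        by (rule integral_abs_bound)
      moreover have "(LINT y|lborel. \<bar>indicator (cball x R) y * u y\<bar>) \<le> M * R powr (N - N / q)"
        using Morrey[OF that(2), of x] by (simp add: abs_mult)
      ultimately have "\<bar>u x * measure lborel (cball x R)\<bar> \<le> \<tau> * measure lborel (cball x R) + \<tau> powr (1 - p) * R powr \<kappa> * G u x + M * R powr (N - N / q)"
        by linarith
      then have "\<bar>u x\<bar> * (\<omega> * R powr N) \<le> \<tau> * (\<omega> * R powr N) + \<tau> powr (1 - p) * R powr \<kappa> * G u x + M * R powr (N - N / q)"
        using measure_ball_powr[OF that(2), of x] \<omega>_pos by (simp add: abs_mult)
      also have "\<dots> = (\<tau> + (\<tau> powr (1 - p) * R powr (s * p) * G u x + M * R powr (- (N / q))) / \<omega>) * (\<omega> * R powr N)"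
      proof -
        have 1: "R powr \<kappa> = R powr (s * p) * R powr N" "R powr (N - N / q) = R powr (- (N / q)) * R powr N"
          by (simp_all add: \<kappa>_def add.commute flip: powr_add)
        show ?thesis unfolding 1 using \<omega>_pos by (simp add: field_simps)
      qed
      finally show ?thesis by (rule mult_right_le_imp_le) (use \<omega>_pos that in simp)
    qed
    show ?case
    proof (cases "G u x = 0")
      case True
      \<comment> \<open>With no local energy, the choice \<tau> = e / 3 and the radius R below make
        the two remaining terms e / 3 each, which is less than e = |u x|.\<close>
      have "u x = 0"
      proof (rule ccontr)
        assume "u x \<noteq> 0"
        define e where "e = \<bar>u x\<bar>"
        have e: "0 < e" using \<open>u x \<noteq> 0\<close> by (simp add: e_def)
        define R where "R = (e * \<omega> / (3 * M)) powr (- (q / N))"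
        have z: "0 < e * \<omega> / (3 * M)" using e M \<omega>_pos by simp
        then have R: "0 < R" "R powr (- (N / q)) = e * \<omega> / (3 * M)"
          using q_facts(2) N_pos e M \<omega>_pos by (auto simp: R_def powr_powr)
        have "e \<le> e / 3 + M * R powr (- (N / q)) / \<omega>"
          using bound[of "e / 3" R] True e R by (simp add: e_def)
        also have "\<dots> = 2 * e / 3" unfolding R(2) using M \<omega>_pos by simp
        finally show False using e by simp
      qed
      then show ?thesis using q_facts True by simp
    next
      case False
      define g where "g = G u x powr (1 / p)"
      have g: "0 < g" using False G_nonneg[of u x] by (simp add: g_def)
      have Gg: "G u x = g powr p" using p G_nonneg[of u x] by (simp add: g_def powr_powr)
      \<comment> \<open>Since s + N / q = N / p, this R together with \<tau> = R^s g makes all three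
        terms of \<open>bound\<close> equal to R^s g, the last two up to the factor 1 /
        \<omega>.\<close>
      define R where "R = (M / g) powr (p / N)"
      have R: "0 < R" using g M by (simp add: R_def)
      have Rs: "R powr s = (M / g) powr (s * p / N)" by (simp add: R_def powr_powr mult.commute)
      have "R powr s * R powr (N / q) = R powr (N / p)" using q_facts(4) by (simp flip: powr_add)
      also have "\<dots> = M / g" using g M p N_pos by (simp add: R_def powr_powr)
      finally have MR: "M * R powr (- (N / q)) = R powr s * g"
        using g R by (simp add: powr_minus field_simps)
      have "(R powr s * g) powr (1 - p) * R powr (s * p) * g powr p
         = (R powr s) powr (1 - p) * (R powr s) powr p * (g powr (1 - p) * g powr p)"
        by (simp add: powr_mult powr_powr)
      also have "\<dots> = R powr s * g" using g R by (simp add: powr_add[symmetric])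
      finally have Gt: "(R powr s * g) powr (1 - p) * R powr (s * p) * G u x = R powr s * g"
        using Gg by simp
      have "\<bar>u x\<bar> \<le> R powr s * g + (R powr s * g + R powr s * g) / \<omega>"
        using bound[of "R powr s * g" R] g R unfolding MR Gt by simp
      also have "\<dots> = C * (R powr s * g)" using \<omega>_pos by (simp add: C_def field_simps)
      finally have "\<bar>u x\<bar> powr q \<le> (C * (R powr s * g)) powr q" using q_facts by (intro powr_mono2) auto
      also have "\<dots> = C powr q * ((M / g) powr (s * p / N * q) * g powr q)"
        unfolding Rs by (simp add: powr_mult powr_powr)
      also have "s * p / N * q = q - p" using q_facts(6) by (simp add: mult.commute)
      also have "(M / g) powr (q - p) * g powr q = M powr (q - p) * g powr p"
        using g by (simp add: powr_divide powr_diff)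
      finally show ?thesis by (simp add: Gg mult.assoc)
    qed
  qed
  then have "B u \<le> (LINT x|lborel. C powr q * M powr (q - p) * G u x)"
    unfolding B_def pint_def
    using Lp_integrable[OF W_Lp(1)[OF u]] G_facts(2)[OF u] by (intro integral_mono_AE) auto
  also have "\<dots> = C powr q * M powr (q - p) * E u" using G_facts[OF u] by simp
  finally show ?thesis unfolding C_def .
qed

text \<open>With \<tau> = R^(-N/q) both terms of the splitting scale alike in R, so every function
  with finite q-integral has a finite Morrey-type constant.\<close>

lemma Morrey_bound:
  fixes a :: "real ^ 'n"
  assumes u: "u \<in> Lp lborel q" and R: "0 < R"
  shows "(LINT y|lborel. indicator (cball a R) y * \<bar>u y\<bar>) \<le> (\<omega> + pint lborel q u) * R powr (N - N / q)"
proof -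
  define \<tau> where "\<tau> = R powr (- (N / q))"
  have \<tau>: "0 < \<tau>" using R by (simp add: \<tau>_def)
  have "(LINT y|lborel. indicator (cball a R) y * \<bar>u y\<bar>) \<le> \<tau> * measure lborel (cball a R) + \<tau> powr (1 - q) * pint lborel q u"
    using emeasure_ball_powr[OF R, of a] by (intro Lp_set_integrable(2)[OF u _ _ \<tau>]) auto
  also have "\<tau> * measure lborel (cball a R) = \<omega> * R powr (N - N / q)"
    using R by (simp add: \<tau>_def measure_ball_powr powr_diff powr_minus field_simps)
  also have "\<tau> powr (1 - q) = R powr (N - N / q)"
    using q_facts(2) by (simp add: \<tau>_def powr_powr right_diff_distrib)
  finally show ?thesis by (simp add: distrib_right mult.commute)
qed

text \<open>Any finite Morrey-type constant in \<open>improved_Sobolev\<close> turns E u = 0 into B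
  u = 0. This is later the source of positivity of the Sobolev constant.\<close>

lemma E_pos:
  assumes u: "u \<in> W" "0 < B u"
  shows "0 < E u"
proof (rule ccontr)
  assume "\<not> 0 < E u"
  then have "E u = 0" using E_nonneg[of u] by linarith
  define M where "M = \<omega> + B u"
  have "0 < M" using \<omega>_pos u by (simp add: M_def add_pos_pos)
  from improved_Sobolev[OF u(1) this] Morrey_bound[OF W_Lp(1)[OF u(1)]]
  have "B u \<le> (1 + 2 / \<omega>) powr q * M powr (q - p) * E u" by (simp add: M_def B_def)
  then show False using u \<open>E u = 0\<close> by simp
qed

end

section \<open>Local compactness\<close>

lemma ex_dense_sequence: "\<exists>d :: nat \<Rightarrow> 'a::{second_countable_topology,metric_space}. \<forall>x. \<forall>e>0. \<exists>j. dist x (d j) < e"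
proof -
  obtain D :: "'a set" where D: "countable D" "\<And>X. open X \<Longrightarrow> X \<noteq> {} \<Longrightarrow> \<exists>d\<in>D. d \<in> X"
    using countable_dense_exists by blast
  have ne: "D \<noteq> {}" using D(2)[of UNIV] by auto
  have "\<exists>j. dist x (from_nat_into D j) < e" if "0 < e" for x e
  proof -
    have "ball x e \<noteq> {}" using that by simp
    from D(2)[OF open_ball this] obtain y where "y \<in> D" "y \<in> ball x e" by blast
    then show ?thesis using from_nat_into_surj[OF D(1)] by (metis mem_ball)
  qed
  then show ?thesis by blast
qed

text \<open>Such a weight makes the whole space a finite measure, so one Cauchy argument in weighted
  L1 replaces an exhaustion by balls; as it vanishes nowhere, it can be divided out of an almost
  everywhere limit.\<close>

lemma ex_bounded_integrable_weight:
  "\<exists>w. w \<in> borel_measurable borel \<and> integrable lborel w \<and> (\<forall>x :: 'a::euclidean_space. 0 < w x \<and> w x \<le> (1::real))"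
proof -
  obtain h :: "'a \<Rightarrow> ennreal" where h: "h \<in> borel_measurable lborel" "integral\<^sup>N lborel h \<noteq> \<infinity>"
    "\<And>x. 0 < h x" "\<And>x. h x < \<infinity>"
    using sigma_finite_measure.Ex_finite_integrable_function[OF lborel.sigma_finite_measure_axioms] by auto
  note [measurable] = h(1)
  define w where "w x = min 1 (enn2real (h x))" for x
  have hm: "h \<in> borel_measurable borel" using h(1) by simp
  have m: "w \<in> borel_measurable borel" unfolding w_def using hm by measurable
  have w: "0 < w x" "w x \<le> 1" for x
    using h(3,4)[of x] by (auto simp: w_def enn2real_positive_iff)
  have "(\<integral>\<^sup>+x. ennreal (norm (w x)) \<partial>lborel) \<le> integral\<^sup>N lborel h"
  proof (rule nn_integral_mono)
    fix x
    have "ennreal (norm (w x)) \<le> ennreal (enn2real (h x))"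
      using w[of x] by (intro ennreal_leI) (auto simp: w_def)
    also have "\<dots> = h x" using h(4)[of x] by simp
    finally show "ennreal (norm (w x)) \<le> h x" .
  qed
  then have "integrable lborel w"
    using h(2) m by (intro integrableI_bounded) (auto simp: less_top top_unique)
  then show ?thesis using m w by blast
qed

context frac_sobolev
begin

text \<open>Averages over countably many balls converge along a diagonal subsequence, and
  \<open>local_oscillation\<close> bounds the distance of each function to its averages uniformly
  along the sequence. The functions are therefore Cauchy in weighted L1, and a further subsequence
  converges almost everywhere.\<close>

lemma W_rellich:
  assumes u: "\<And>n. u n \<in> W" and BK: "\<And>n. B (u n) \<le> K" and EK: "\<And>n. E (u n) \<le> K"
  obtains r v where "strict_mono (r :: nat \<Rightarrow> nat)" "v \<in> borel_measurable borel"
    "AE x in lborel. (\<lambda>n. u (r n) x) \<longlonglongrightarrow> v x"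
proof -
  note [measurable] = W_measurable[OF u]
  have K0: "0 \<le> K" using BK[of 0] B_nonneg[of "u 0"] by linarith
  obtain d :: "nat \<Rightarrow> real ^ 'n" where d: "\<And>x e. 0 < e \<Longrightarrow> \<exists>j. dist x (d j) < e"
    using ex_dense_sequence by blast
  obtain w :: "real ^ 'n \<Rightarrow> real" where wm [measurable]: "w \<in> borel_measurable borel"
    and wi: "integrable lborel w" and w: "\<And>x. 0 < w x" "\<And>x. w x \<le> 1"
    using ex_bounded_integrable_weight by blast
  have wn: "0 \<le> w x" for x using w(1)[of x] by simp
  define h :: "nat \<Rightarrow> real" where "h m = (1/2) ^ m" for m
  have h: "0 < h m" "h m \<le> 1" for m by (auto simp: h_def power_le_one)
  define A where "A = (\<lambda>(m, j). cball (d j) (h m))"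
  define vol where "vol m = \<omega> * h m powr N" for m
  have vol: "0 < vol m" "vol m \<le> \<omega>" for m
    using \<omega>_pos h[of m] N_pos by (auto simp: vol_def intro!: mult_left_le powr_le1)
  have A: "measure lborel (A (m, j)) = vol m" "A (m, j) \<in> sets lborel" "emeasure lborel (A (m, j)) < \<infinity>" for m j
    using measure_ball_powr[OF h(1), of "d j" m] emeasure_ball_powr[OF h(1), of "d j" m] by (auto simp: A_def vol_def)
  define c where "c f mj = (LINT y|lborel. indicator (A mj) y * f y)" for f :: "real ^ 'n \<Rightarrow> real" and mj :: "nat \<times> nat"
  have c_bound: "\<bar>c (u n) mj\<bar> \<le> \<omega> + K" for n mj
  proof (cases mj)
    case (Pair m j)
    have "\<bar>c (u n) mj\<bar> \<le> (LINT y|lborel. \<bar>indicator (A mj) y * u n y\<bar>)"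
      unfolding c_def by (rule integral_abs_bound)
    also have "\<dots> \<le> 1 * measure lborel (A mj) + 1 powr (1 - q) * pint lborel q (u n)"
      using Lp_set_integrable(2)[OF W_Lp(1)[OF u] A(2,3)[of m j] zero_less_one] Pair by (simp add: abs_mult)
    also have "\<dots> \<le> \<omega> + K" using A(1)[of m j] vol(2)[of m] BK[of n] Pair by (simp add: B_def)
    finally show ?thesis .
  qed
  \<comment> \<open>Diagonal argument over the countably many pairs of a scale m and a center
    j.\<close>
  obtain k where k: "strict_mono k" and kc: "\<And>mj. \<exists>l. (\<lambda>n. c (u (k n)) mj) \<longlonglongrightarrow> l"
  proof (rule function_convergent_subsequence[of UNIV "\<lambda>n mj. c (u n) mj" "\<omega> + K"])
    show "countable (UNIV :: (nat \<times> nat) set)" by simp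
    show "norm (c (u n) mj) \<le> \<omega> + K" for n mj using c_bound by simp
  qed auto
  define v where "v n = u (k n)" for n
  have vW: "v n \<in> W" for n using u by (simp add: v_def)
  note [measurable] = W_measurable[OF vW]
  \<comment> \<open>Selecting the first center within \<open>h m\<close> of x makes the piecewise
    constant average \<open>P m f\<close> Borel measurable.\<close>
  define idx where "idx m x = (LEAST j. dist x (d j) < h m)" for m x
  have idx: "dist x (d (idx m x)) < h m" for m x
    unfolding idx_def using d[OF h(1)] by (rule LeastI_ex)
  have idxm [measurable]: "idx m \<in> measurable borel (count_space UNIV)" for m
    unfolding idx_def by measurable
  define P where "P m f x = c f (m, idx m x) / vol m" for m f x
  have Pm [measurable]: "P m f \<in> borel_measurable borel" for m f
    unfolding P_def by measurable
  have P_bound: "\<bar>P m (v n) x\<bar> \<le> (\<omega> + K) / vol m" for m n x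
    unfolding P_def using c_bound[of "k n"] vol(1)[of m] by (simp add: v_def divide_right_mono)
  have P_lim: "\<exists>l. (\<lambda>n. P m (v n) x) \<longlonglongrightarrow> l" for m x
  proof -
    obtain l where "(\<lambda>n. c (v n) (m, idx m x)) \<longlonglongrightarrow> l" using kc unfolding v_def by blast
    then have "(\<lambda>n. P m (v n) x) \<longlonglongrightarrow> l / vol m"
      unfolding P_def using vol(1)[of m] by (intro tendsto_intros) auto
    then show ?thesis by blast
  qed
  \<comment> \<open>The selected ball lies in the ball of radius 2 h around x; K1 is the quotient of
    (2 h)^\<kappa> by h^(s p) times the volume of the selected ball, the same at every
    scale.\<close>
  define K1 where "K1 = 2 powr \<kappa> / \<omega>"
  have K1: "0 \<le> K1" using \<omega>_pos by (simp add: K1_def)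
  have osc: "AE x in lborel. \<bar>v n x - P m (v n) x\<bar> \<le> \<tau> + \<tau> powr (1 - p) * K1 * h m powr (s * p) * G (v n) x"
    if \<tau>: "0 < \<tau>" for n m \<tau>
    using G_facts(1)[OF vW[of n]]
  proof eventually_elim
    case (elim x)
    let ?A = "A (m, idx m x)"
    have "?A \<subseteq> cball x (2 * h m)"
    proof
      fix y assume "y \<in> ?A"
      then have "dist (d (idx m x)) y \<le> h m" by (simp add: A_def)
      then show "y \<in> cball x (2 * h m)"
        using idx[of x m] dist_triangle[of x y "d (idx m x)"] by simp
    qed
    moreover have "0 < 2 * h m" using h(1)[of m] by simp
    ultimately have "\<bar>v n x * vol m - c (v n) (m, idx m x)\<bar> \<le> \<tau> * vol m + \<tau> powr (1 - p) * (2 * h m) powr \<kappa> * G (v n) x"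
      using local_oscillation[OF vW A(2) _ _ \<tau> elim] unfolding A(1) c_def by blast
    also have "(2 * h m) powr \<kappa> = K1 * h m powr (s * p) * vol m"
      using \<omega>_pos h(1)[of m] by (simp add: K1_def vol_def powr_mult \<kappa>_def powr_add)
    finally have "\<bar>v n x * vol m - c (v n) (m, idx m x)\<bar> / vol m
       \<le> (\<tau> * vol m + \<tau> powr (1 - p) * (K1 * h m powr (s * p) * vol m) * G (v n) x) / vol m"
      using vol(1)[of m] by (intro divide_right_mono) auto
    moreover have "\<bar>v n x * vol m - c (v n) (m, idx m x)\<bar> / vol m = \<bar>v n x - P m (v n) x\<bar>"
    proof -
      have "v n x - P m (v n) x = (v n x * vol m - c (v n) (m, idx m x)) / vol m"
        using vol(1)[of m] by (simp add: P_def diff_divide_distrib)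
      then show ?thesis using vol(1)[of m] by simp
    qed
    moreover have "(\<tau> * vol m + \<tau> powr (1 - p) * (K1 * h m powr (s * p) * vol m) * G (v n) x) / vol m
       = \<tau> + \<tau> powr (1 - p) * K1 * h m powr (s * p) * G (v n) x"
      using vol(1)[of m] by (simp add: add_divide_distrib)
    ultimately show ?case by simp
  qed
  define Wt where "Wt = (LINT x|lborel. w x)"
  have Wt: "0 \<le> Wt" using wn by (simp add: Wt_def)
  have wvi: "integrable lborel (\<lambda>x. w x * v n x)" for n
  proof (rule Bochner_Integration.integrable_bound)
    show "integrable lborel (\<lambda>x. w x + \<bar>v n x\<bar> powr q)"
      using wi Lp_integrable[OF W_Lp(1)[OF vW]] by (rule Bochner_Integration.integrable_add)
    have wb: "\<bar>w x * v n x\<bar> \<le> w x + \<bar>v n x\<bar> powr q" for x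
    proof -
      have "\<bar>w x * v n x\<bar> \<le> w x * (1 + 1 powr (1 - q) * \<bar>v n x\<bar> powr q)"
        using le_add_powr_Young[of "\<bar>v n x\<bar>" 1 q] q_facts wn[of x]
        unfolding abs_mult abs_of_nonneg[OF wn] by (intro mult_left_mono) auto
      also have "\<dots> \<le> w x + 1 * \<bar>v n x\<bar> powr q"
        using w(2)[of x] by (simp add: distrib_left mult_left_le_one_le wn)
      finally show ?thesis by simp
    qed
    show "AE x in lborel. norm (w x * v n x) \<le> norm (w x + \<bar>v n x\<bar> powr q)"
      unfolding real_norm_def by (intro AE_I2 order_trans[OF wb abs_ge_self])
  qed measurable
  have wPi: "integrable lborel (\<lambda>x. w x * P m (v n) x)" for m n
  proof (rule Bochner_Integration.integrable_bound)
    show "integrable lborel (\<lambda>x. w x * ((\<omega> + K) / vol m))" using wi by auto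
    show "AE x in lborel. norm (w x * P m (v n) x) \<le> norm (w x * ((\<omega> + K) / vol m))"
    proof (rule AE_I2)
      fix x
      show "norm (w x * P m (v n) x) \<le> norm (w x * ((\<omega> + K) / vol m))"
        unfolding real_norm_def abs_mult by (intro mult_left_mono order_trans[OF P_bound abs_ge_self]) simp
    qed
  qed measurable
  have L1: "(LINT x|lborel. \<bar>w x * v n x - w x * P m (v n) x\<bar>) \<le> \<tau> * Wt + \<tau> powr (1 - p) * K1 * h m powr (s * p) * K"
    if \<tau>: "0 < \<tau>" for n m \<tau>
  proof -
    define C where "C = \<tau> powr (1 - p) * K1 * h m powr (s * p)"
    have C: "0 \<le> C" using K1 by (simp add: C_def)
    have "(LINT x|lborel. \<bar>w x * v n x - w x * P m (v n) x\<bar>) \<le> (LINT x|lborel. \<tau> * w x + C * G (v n) x)"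
    proof (rule integral_mono_AE)
      show "integrable lborel (\<lambda>x. \<bar>w x * v n x - w x * P m (v n) x\<bar>)"
        using wvi wPi by (intro integrable_abs Bochner_Integration.integrable_diff)
      show "integrable lborel (\<lambda>x. \<tau> * w x + C * G (v n) x)"
        using wi G_facts(2)[OF vW] by auto
      show "AE x in lborel. \<bar>w x * v n x - w x * P m (v n) x\<bar> \<le> \<tau> * w x + C * G (v n) x"
        using osc[OF \<tau>, of n m]
      proof eventually_elim
        case (elim x)
        have "\<bar>w x * v n x - w x * P m (v n) x\<bar> = w x * \<bar>v n x - P m (v n) x\<bar>"
          using wn[of x] by (simp add: abs_mult flip: right_diff_distrib)
        also have "\<dots> \<le> w x * (\<tau> + C * G (v n) x)" using elim wn[of x] by (intro mult_left_mono) (auto simp: C_def)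
        also have "\<dots> = \<tau> * w x + w x * (C * G (v n) x)" by (simp add: distrib_left mult.commute)
        also have "w x * (C * G (v n) x) \<le> C * G (v n) x"
          using w(2)[of x] wn[of x] C G_nonneg[of "v n" x] by (intro mult_left_le_one_le) auto
        finally show ?case by simp
      qed
    qed
    also have "\<dots> = \<tau> * Wt + C * E (v n)" using wi G_facts[OF vW] by (simp add: Wt_def)
    also have "\<dots> \<le> \<tau> * Wt + C * K" using EK C by (auto simp: v_def intro!: mult_left_mono)
    finally show ?thesis by (simp add: C_def)
  qed
  have cauchy: "\<exists>M. \<forall>i\<ge>M. \<forall>j\<ge>M. (LINT x|lborel. norm (w x * v i x - w x * v j x)) < e" if e: "0 < e" for e
  proof -
    \<comment> \<open>\<tau> is fixed before the scale m: the factor \<tau>^(1-p) may be large, but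
      then \<open>h m powr (s * p)\<close> beats it as m grows.\<close>
    define \<tau> where "\<tau> = e / (6 * (Wt + 1))"
    have \<tau>: "0 < \<tau>" "\<tau> * Wt \<le> e / 6" using e Wt by (auto simp: \<tau>_def field_simps)
    have "(\<lambda>m. \<tau> powr (1 - p) * K1 * ((1/2) powr (s * p)) ^ m * K) \<longlonglongrightarrow> \<tau> powr (1 - p) * K1 * 0 * K"
      using s p by (intro tendsto_intros LIMSEQ_power_zero) (auto simp: powr01_less_one)
    then have "\<forall>\<^sub>F m in sequentially. \<tau> powr (1 - p) * K1 * ((1/2) powr (s * p)) ^ m * K < e / 6"
      using e by (intro order_tendstoD) auto
    then obtain m where m: "\<tau> powr (1 - p) * K1 * ((1/2) powr (s * p)) ^ m * K < e / 6"
      using eventually_happens'[OF sequentially_bot] by blast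
    have "((1/2) powr (s * p)) ^ m = h m powr (s * p)"
      by (simp add: h_def powr_realpow[symmetric] powr_powr mult.commute)
    with m have near: "(LINT x|lborel. \<bar>w x * v n x - w x * P m (v n) x\<bar>) \<le> e / 3" for n
      using L1[OF \<tau>(1), of n m] \<tau>(2) by simp
    \<comment> \<open>At a fixed scale the averages converge pointwise and are bounded, so dominated
      convergence makes them Cauchy in weighted L1.\<close>
    define L where "L x = lim (\<lambda>n. P m (v n) x)" for x
    have L: "(\<lambda>n. P m (v n) x) \<longlonglongrightarrow> L x" for x
      using P_lim[of m x] unfolding L_def by (metis limI)
    have Lm [measurable]: "L \<in> borel_measurable borel"
      unfolding L_def by (intro borel_measurable_lim_metric) measurable
    have L_bound: "\<bar>L x\<bar> \<le> (\<omega> + K) / vol m" for x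
      by (rule LIMSEQ_le_const2[OF tendsto_rabs[OF L]]) (use P_bound in auto)
    have "(\<lambda>n. LINT x|lborel. w x * \<bar>P m (v n) x - L x\<bar>) \<longlonglongrightarrow> (LINT x|(lborel :: (real ^ 'n) measure). (0 :: real))"
    proof (rule integral_dominated_convergence)
      show "integrable lborel (\<lambda>x. w x * (2 * ((\<omega> + K) / vol m)))" using wi by auto
      show "AE x in lborel. (\<lambda>n. w x * \<bar>P m (v n) x - L x\<bar>) \<longlonglongrightarrow> 0"
      proof (rule AE_I2)
        fix x
        have "(\<lambda>n. w x * \<bar>P m (v n) x - L x\<bar>) \<longlonglongrightarrow> w x * \<bar>L x - L x\<bar>" by (intro tendsto_intros L)
        then show "(\<lambda>n. w x * \<bar>P m (v n) x - L x\<bar>) \<longlonglongrightarrow> 0" by simp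
      qed
      show "AE x in lborel. norm (w x * \<bar>P m (v n) x - L x\<bar>) \<le> w x * (2 * ((\<omega> + K) / vol m))" for n
      proof (rule AE_I2)
        fix x
        have "\<bar>P m (v n) x - L x\<bar> \<le> 2 * ((\<omega> + K) / vol m)"
          using P_bound[of m n x] L_bound[of x] by linarith
        then show "norm (w x * \<bar>P m (v n) x - L x\<bar>) \<le> w x * (2 * ((\<omega> + K) / vol m))"
          using mult_left_mono[OF _ wn[of x]] by (simp only: real_norm_def abs_mult abs_abs abs_of_nonneg[OF wn])
      qed
    qed measurable
    then have "\<forall>\<^sub>F n in sequentially. (LINT x|lborel. w x * \<bar>P m (v n) x - L x\<bar>) < e / 6"
      using e by (intro order_tendstoD) auto
    then obtain M where M: "\<And>n. n \<ge> M \<Longrightarrow> (LINT x|lborel. w x * \<bar>P m (v n) x - L x\<bar>) < e / 6"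
      by (auto simp: eventually_sequentially)
    have wLi: "integrable lborel (\<lambda>x. w x * \<bar>P m (v n) x - L x\<bar>)" for n
    proof (rule Bochner_Integration.integrable_bound)
      show "integrable lborel (\<lambda>x. w x * (2 * ((\<omega> + K) / vol m)))" using wi by auto
      show "AE x in lborel. norm (w x * \<bar>P m (v n) x - L x\<bar>) \<le> norm (w x * (2 * ((\<omega> + K) / vol m)))"
      proof (rule AE_I2)
        fix x
        have "\<bar>P m (v n) x - L x\<bar> \<le> \<bar>2 * ((\<omega> + K) / vol m)\<bar>"
          using P_bound[of m n x] L_bound[of x] by linarith
        then show "norm (w x * \<bar>P m (v n) x - L x\<bar>) \<le> norm (w x * (2 * ((\<omega> + K) / vol m)))"
          unfolding real_norm_def abs_mult by (intro mult_left_mono) auto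
      qed
    qed measurable
    have "(LINT x|lborel. norm (w x * v i x - w x * v j x)) < e" if ij: "i \<ge> M" "j \<ge> M" for i j
    proof -
      let ?a = "\<lambda>n x. \<bar>w x * v n x - w x * P m (v n) x\<bar>"
      let ?b = "\<lambda>n x. w x * \<bar>P m (v n) x - L x\<bar>"
      have ai: "integrable lborel (?a n)" for n
        using wvi wPi by (intro integrable_abs Bochner_Integration.integrable_diff)
      have "(LINT x|lborel. norm (w x * v i x - w x * v j x)) \<le> (LINT x|lborel. (?a i x + ?a j x) + (?b i x + ?b j x))"
      proof (rule integral_mono)
        show "integrable lborel (\<lambda>x. norm (w x * v i x - w x * v j x))"
          using wvi by (intro integrable_norm Bochner_Integration.integrable_diff)
        show "integrable lborel (\<lambda>x. (?a i x + ?a j x) + (?b i x + ?b j x))"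
          using ai wLi by (intro Bochner_Integration.integrable_add)
        fix x
        have b: "?b n x = \<bar>w x * P m (v n) x - w x * L x\<bar>" for n
          using wn[of x] by (simp add: abs_mult flip: right_diff_distrib)
        show "norm (w x * v i x - w x * v j x) \<le> (?a i x + ?a j x) + (?b i x + ?b j x)"
          unfolding b real_norm_def by linarith
      qed
      also have "\<dots> = ((LINT x|lborel. ?a i x) + (LINT x|lborel. ?a j x)) + ((LINT x|lborel. ?b i x) + (LINT x|lborel. ?b j x))"
        using ai wLi by (subst Bochner_Integration.integral_add; simp?)+
      also have "\<dots> < e" using near[of i] near[of j] M[OF ij(1)] M[OF ij(2)] by linarith
      finally show ?thesis .
    qed
    then show ?thesis by blast
  qed
  obtain r where r: "strict_mono r" "AE x in lborel. Cauchy (\<lambda>i. w x * v (r i) x)"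
    using cauchy_L1_AE_cauchy_subseq[OF wvi cauchy] by blast
  define z where "z x = lim (\<lambda>n. v (r n) x)" for x
  show thesis
  proof (rule that[of "k \<circ> r" z])
    show "strict_mono (k \<circ> r)" using k r(1) by (rule strict_mono_o)
    show "z \<in> borel_measurable borel" unfolding z_def by (intro borel_measurable_lim_metric) measurable
    show "AE x in lborel. (\<lambda>n. u ((k \<circ> r) n) x) \<longlonglongrightarrow> z x"
      using r(2)
    proof eventually_elim
      case (elim x)
      then have "convergent (\<lambda>i. w x * v (r i) x)" by (simp add: Cauchy_convergent_iff)
      then have "convergent (\<lambda>i. v (r i) x)"
        using w(1)[of x] by (subst (asm) convergent_mult_const_iff) auto
      then show ?case by (simp add: z_def convergent_LIMSEQ_iff v_def)
    qed
  qed
qed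

end

section \<open>Existence of a minimizer\<close>

context frac_sobolev
begin

abbreviation S :: real where "S \<equiv> sobolev_const n s p"

lemma sobolev_const_eq:
  "S = (INF u \<in> {u \<in> W. 0 < B u}. E u / B u powr (p / q))"
proof -
  have "{u :: real ^ 'n \<Rightarrow> real. u \<in> W \<and> nonzero_ae u} = {u \<in> W. 0 < B u}"
    using nonzero_ae_iff by blast
  then show ?thesis unfolding sobolev_const_def by (simp add: sobolev_quotient_eq cong: INF_cong_simp)
qed

lemma quotient_bdd_below: "bdd_below ((\<lambda>u. E u / B u powr (p / q)) ` {u \<in> W. 0 < B u})"
  by (rule bdd_belowI[of _ 0]) auto

lemma quotient_dom_nonempty: "{u \<in> W. 0 < B u} \<noteq> {}"
  using cutoff_in_W B_cutoff_pos by blast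

lemma S_nonneg: "0 \<le> S"
  unfolding sobolev_const_eq by (rule cINF_greatest[OF quotient_dom_nonempty]) auto

lemma Sobolev_inequality:
  assumes "u \<in> W"
  shows "S * B u powr (p / q) \<le> E u"
proof (cases "B u = 0")
  case False
  then have "0 < B u" using B_nonneg[of u] by linarith
  then have "S \<le> E u / B u powr (p / q)"
    unfolding sobolev_const_eq using assms by (intro cINF_lower[OF quotient_bdd_below]) auto
  then show ?thesis using \<open>0 < B u\<close> by (simp add: le_divide_eq)
qed simp

text \<open>M is tuned so that a Morrey-type constant at most M would contradict B v = 1 for every
  energy below S + 1. Hence some ball carries more than M R^(N - N/q); moving it to the unit ball by
  a map that preserves \<open>B\<close> and \<open>E\<close> gives c = M, independent of e.\<close>

lemma ex_concentrated_almost_minimizer: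
  "\<exists>c>0. \<forall>e. 0 < e \<and> e \<le> 1 \<longrightarrow> (\<exists>u\<in>W. B u = 1 \<and> E u < S + e \<and>
     c < (LINT y|lborel. indicator (cball 0 1) y * \<bar>u y\<bar>))"
proof -
  define C where "C = (1 + 2 / \<omega>) powr q"
  have "0 < 1 + 2 / \<omega>" using \<omega>_pos by (intro add_pos_pos) auto
  then have C: "0 < C" unfolding C_def powr_gt_zero by (metis less_irrefl)
  define M where "M = (1 / (C * (S + 1))) powr (1 / (q - p))"
  have M: "0 < M" "C * M powr (q - p) * (S + 1) = 1"
    using C S_nonneg q_facts(1) by (auto simp: M_def powr_powr)
  have "\<exists>u\<in>W. B u = 1 \<and> E u < S + e \<and> M < (LINT y|lborel. indicator (cball 0 1) y * \<bar>u y\<bar>)"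
    if e: "0 < e" "e \<le> 1" for e
  proof -
    have "\<exists>u\<in>{u \<in> W. 0 < B u}. E u / B u powr (p / q) < S + e"
      using cINF_less_iff[OF quotient_dom_nonempty quotient_bdd_below, of "S + e"] e
      unfolding sobolev_const_eq[symmetric] by simp
    then obtain u where u: "u \<in> W" "0 < B u" "E u / B u powr (p / q) < S + e" by blast
    define l where "l = B u powr (- (1 / q))"
    define v where "v x = l * u x" for x
    have "l powr q = B u powr (- 1)" unfolding l_def powr_powr using q_facts(2) by simp
    then have lq: "\<bar>l\<bar> powr q * B u = 1" using u(2) by (simp add: l_def powr_minus)
    have v: "v \<in> W" "B v = 1" "E v < S + e"
    proof -
      show "v \<in> W" using W_cmult(1)[OF u(1)] by (simp add: v_def[abs_def])
      show "B v = 1" using W_cmult(3)[OF u(1), of l] lq by (simp add: v_def[abs_def])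
      have "l powr p = B u powr (- (p / q))" unfolding l_def powr_powr by simp
      then have "\<bar>l\<bar> powr p * E u = E u / B u powr (p / q)"
        using u(2) by (simp add: l_def powr_minus divide_inverse mult.commute)
      then show "E v < S + e" using W_cmult(2)[OF u(1), of l] u(3) by (simp add: v_def[abs_def])
    qed
    have "\<exists>a R. 0 < R \<and> M * R powr (N - N / q) < (LINT y|lborel. indicator (cball a R) y * \<bar>v y\<bar>)"
    proof (rule ccontr)
      assume "\<not> ?thesis"
      then have "B v \<le> C * M powr (q - p) * E v"
        unfolding C_def by (intro improved_Sobolev[OF v(1) M(1)]) (meson not_le)
      also have "\<dots> < C * M powr (q - p) * (S + 1)"
        using C M v(3) e by (intro mult_strict_left_mono) auto
      finally show False using v(2) M(2) by simp
    qed
    then obtain a R where R: "0 < R" "M * R powr (N - N / q) < (LINT y|lborel. indicator (cball a R) y * \<bar>v y\<bar>)"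
      by blast
    define f where "f x = v (a + R *\<^sub>R x)" for x
    define z where "z x = R powr (N / q) * f x" for x
    have f: "f \<in> W" "E f = R powr (s * p - N) * E v" "B f = R powr (- N)"
      using W_affine[OF v(1) R(1), of a] v(2) by (simp_all add: f_def[abs_def])
    have zW: "z \<in> W" using W_cmult(1)[OF f(1)] by (simp add: z_def[abs_def])
    have zB: "B z = 1"
      using W_cmult(3)[OF f(1), of "R powr (N / q)"] R(1) q_facts(2) f(3)
      by (simp add: z_def[abs_def] powr_powr flip: powr_add)
    \<comment> \<open>The amplitude R^(N/q) was chosen to keep \<open>B\<close>; this exponent
      identity says that it keeps \<open>E\<close> as well.\<close>
    have ex: "N / q * p + (s * p - N) = 0" using q_facts(4) p by (simp add: field_simps)
    have "E z = (R powr (N / q)) powr p * (R powr (s * p - N) * E v)"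
      using W_cmult(2)[OF f(1), of "R powr (N / q)"] f(2) by (simp add: z_def[abs_def])
    also have "\<dots> = R powr (N / q * p + (s * p - N)) * E v"
      by (simp only: powr_powr powr_add mult.assoc)
    also have "\<dots> = E v" unfolding ex using R(1) by simp
    finally have zE: "E z = E v" .
    have "integrable lborel (\<lambda>y. \<bar>indicator (cball a R) y * v y\<bar>)"
      using emeasure_ball_powr[OF R(1), of a]
      by (intro integrable_abs Lp_set_integrable(1)[OF W_Lp(1)[OF v(1)] _ _ zero_less_one]) auto
    then have i: "integrable lborel (\<lambda>y. indicator (cball a R) y * \<bar>v y\<bar>)"
      by (simp add: abs_mult)
    have ind: "indicator (cball a R) (a + R *\<^sub>R x) = (indicator (cball 0 1) x :: real)" for x
    proof -
      have "dist a (a + R *\<^sub>R x) = R * norm x" using R(1) by (simp add: dist_norm)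
      then show ?thesis using R(1) by (simp add: indicator_def)
    qed
    have "(LINT y|lborel. indicator (cball a R) y * \<bar>v y\<bar>) = R powr N * (LINT x|lborel. indicator (cball 0 1) x * \<bar>f x\<bar>)"
      using integrable_lborel_affine(2)[OF _ i, of R a] R(1)
      by (simp add: ind f_def N_def powr_realpow)
    also have "(LINT x|lborel. indicator (cball 0 1) x * \<bar>f x\<bar>) = R powr (- (N / q)) * (LINT x|lborel. indicator (cball 0 1) x * \<bar>z x\<bar>)"
    proof -
      have "indicator (cball 0 1) x * \<bar>f x\<bar> = R powr (- (N / q)) * (indicator (cball 0 1) x * \<bar>z x\<bar>)" for x
        using R(1) by (simp add: z_def abs_mult powr_minus)
      then have "(LINT x|lborel. indicator (cball 0 1) x * \<bar>f x\<bar>)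
          = (LINT x|lborel. R powr (- (N / q)) * (indicator (cball 0 1) x * \<bar>z x\<bar>))"
        by (rule Bochner_Integration.integral_cong[OF refl])
      then show ?thesis by simp
    qed
    finally have "M * R powr (N - N / q) < R powr (N - N / q) * (LINT x|lborel. indicator (cball 0 1) x * \<bar>z x\<bar>)"
      using R(2) by (simp add: powr_diff powr_minus divide_inverse mult.assoc)
    then have "M < (LINT x|lborel. indicator (cball 0 1) x * \<bar>z x\<bar>)"
      using R(1) by (simp add: mult.commute)
    then show ?thesis using zW zB zE v(3) by auto
  qed
  then show ?thesis using M(1) by blast
qed

lemma tendsto_diff_quot_AE:
  assumes f: "\<And>n. f n \<in> borel_measurable borel" and v: "v \<in> borel_measurable borel"
    and lim: "AE x in lborel. (\<lambda>n. f n x) \<longlonglongrightarrow> v x"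
  shows "AE z in \<mu>. (\<lambda>n. \<delta> (f n) z) \<longlonglongrightarrow> \<delta> v z"
proof -
  note [measurable] = f v
  have "AE x in lborel. AE y in lborel. (\<lambda>n. f n x) \<longlonglongrightarrow> v x \<and> (\<lambda>n. f n y) \<longlonglongrightarrow> v y"
    using lim by eventually_elim (use lim in auto)
  moreover have "{z \<in> space \<mu>. (\<lambda>n. f n (fst z)) \<longlonglongrightarrow> v (fst z) \<and> (\<lambda>n. f n (snd z)) \<longlonglongrightarrow> v (snd z)} \<in> sets \<mu>"
    by measurable
  ultimately have "AE z in \<mu>. (\<lambda>n. f n (fst z)) \<longlonglongrightarrow> v (fst z) \<and> (\<lambda>n. f n (snd z)) \<longlonglongrightarrow> v (snd z)"
    using lborel_pair.AE_pair_iff[where P = "\<lambda>x y. (\<lambda>n. f n x) \<longlonglongrightarrow> v x \<and> (\<lambda>n. f n y) \<longlonglongrightarrow> v y"] by simp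
  then show ?thesis
  proof eventually_elim
    case (elim z)
    then show ?case
      by (cases z; cases "fst z = snd z") (auto simp: diff_quot_def intro!: tendsto_intros)
  qed
qed

text \<open>The mass in the unit ball could sit in tall thin peaks and vanish in the limit. Above
  height T such peaks carry at most T^(1-q) B = c / 2, so truncation at T keeps mass at least c / 2,
  and dominated convergence excludes a zero limit.\<close>

lemma nonzero_limit:
  assumes f: "\<And>n. f n \<in> W" and B1: "\<And>n. B (f n) = 1" and c: "0 < c"
    and mass: "\<And>n. c < (LINT y|lborel. indicator (cball 0 1) y * \<bar>f n y\<bar>)"
    and lim: "AE x in lborel. (\<lambda>n. f n x) \<longlonglongrightarrow> v x" and v[measurable]: "v \<in> borel_measurable borel"
  shows "\<not> (AE x in lborel. v x = 0)"
proof
  note [measurable] = W_measurable[OF f]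
  assume v0: "AE x in lborel. v x = 0"
  define T where "T = (c / 2) powr (1 / (1 - q))"
  have T: "0 < T" "T powr (1 - q) = c / 2" using c q_facts(3) by (auto simp: T_def powr_powr)
  let ?I = "indicator (cball (0 :: real ^ 'n) 1) :: _ \<Rightarrow> real"
  have iI: "integrable lborel ?I"
    using emeasure_ball_powr[of 1 0] by (intro integrable_real_indicator) auto
  have gi: "integrable lborel (\<lambda>y. ?I y * min \<bar>f n y\<bar> T)" for n
  proof (rule Bochner_Integration.integrable_bound)
    show "integrable lborel (\<lambda>y. T * ?I y)" using iI by simp
  qed (use T in \<open>auto simp: indicator_def\<close>)
  have "(\<lambda>n. LINT y|lborel. ?I y * min \<bar>f n y\<bar> T) \<longlonglongrightarrow> (LINT y|(lborel :: (real ^ 'n) measure). 0 :: real)"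
  proof (rule integral_dominated_convergence)
    show "integrable lborel (\<lambda>y. T * ?I y)" using iI by simp
    show "AE y in lborel. norm (?I y * min \<bar>f n y\<bar> T) \<le> T * ?I y" for n
      using T by (auto simp: indicator_def)
    show "AE y in lborel. (\<lambda>n. ?I y * min \<bar>f n y\<bar> T) \<longlonglongrightarrow> 0"
      using lim v0
    proof eventually_elim
      case (elim y)
      then have "(\<lambda>n. ?I y * min \<bar>f n y\<bar> T) \<longlonglongrightarrow> ?I y * min \<bar>0\<bar> T" by (intro tendsto_intros) simp
      then show ?case using T by simp
    qed
  qed measurable
  then have "(\<lambda>n. (LINT y|lborel. ?I y * min \<bar>f n y\<bar> T) + c / 2) \<longlonglongrightarrow> 0 + c / 2"
    by (intro tendsto_intros) simp
  moreover have "c \<le> (LINT y|lborel. ?I y * min \<bar>f n y\<bar> T) + c / 2" for n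
  proof -
    have le: "?I y * \<bar>f n y\<bar> \<le> ?I y * min \<bar>f n y\<bar> T + T powr (1 - q) * \<bar>f n y\<bar> powr q" for y
      using le_add_powr_Young[of "\<bar>f n y\<bar>" T q] q_facts T by (auto simp: indicator_def min_def)
    have "(LINT y|lborel. ?I y * \<bar>f n y\<bar>) \<le> (LINT y|lborel. ?I y * min \<bar>f n y\<bar> T + T powr (1 - q) * \<bar>f n y\<bar> powr q)"
    proof (rule integral_mono[OF _ _ le])
      have "integrable lborel (\<lambda>y. \<bar>?I y * f n y\<bar>)"
        using emeasure_ball_powr[of 1 0]
        by (intro integrable_abs Lp_set_integrable(1)[OF W_Lp(1)[OF f] _ _ zero_less_one]) auto
      then show "integrable lborel (\<lambda>y. ?I y * \<bar>f n y\<bar>)" by (simp add: abs_mult)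
      show "integrable lborel (\<lambda>y. ?I y * min \<bar>f n y\<bar> T + T powr (1 - q) * \<bar>f n y\<bar> powr q)"
        using gi Lp_integrable[OF W_Lp(1)[OF f]] by auto
    qed
    also have "\<dots> = (LINT y|lborel. ?I y * min \<bar>f n y\<bar> T) + T powr (1 - q) * B (f n)"
      using gi Lp_integrable[OF W_Lp(1)[OF f]] by (simp add: B_def pint_def)
    finally show ?thesis using mass[of n] B1[of n] T(2) by simp
  qed
  ultimately have "c \<le> 0 + c / 2" by (intro LIMSEQ_le_const) auto
  then show False using c by simp
qed

lemma ex_minimizer: "\<exists>v\<in>W. B v = 1 \<and> E v = S \<and> 0 < S"
proof -
  obtain c where c: "0 < c" "\<And>e. 0 < e \<Longrightarrow> e \<le> 1 \<Longrightarrow> \<exists>u\<in>W. B u = 1 \<and> E u < S + e \<and>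
     c < (LINT y|lborel. indicator (cball 0 1) y * \<bar>u y\<bar>)"
    using ex_concentrated_almost_minimizer by blast
  have "\<forall>n. \<exists>u. u \<in> W \<and> B u = 1 \<and> E u < S + 1 / real (Suc n) \<and>
     c < (LINT y|lborel. indicator (cball 0 1) y * \<bar>u y\<bar>)"
  proof
    fix n :: nat
    have "0 < 1 / real (Suc n)" "1 / real (Suc n) \<le> 1" by simp_all
    from c(2)[OF this] show "\<exists>u. u \<in> W \<and> B u = 1 \<and> E u < S + 1 / real (Suc n) \<and>
     c < (LINT y|lborel. indicator (cball 0 1) y * \<bar>u y\<bar>)" by blast
  qed
  then obtain u where u: "\<And>n. u n \<in> W" "\<And>n. B (u n) = 1" "\<And>n. E (u n) < S + 1 / real (Suc n)"
     "\<And>n. c < (LINT y|lborel. indicator (cball 0 1) y * \<bar>u n y\<bar>)"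
    by metis
  have EK: "E (u n) \<le> S + 1" for n
  proof -
    have "1 / real (Suc n) \<le> 1" by simp
    then show ?thesis using u(3)[of n] by linarith
  qed
  obtain r v where r: "strict_mono r" and v [measurable]: "v \<in> borel_measurable borel"
    and lim: "AE x in lborel. (\<lambda>n. u (r n) x) \<longlonglongrightarrow> v x"
    by (rule W_rellich[of u "S + 1"]) (use u(1,2) EK S_nonneg in auto)
  define f where "f n = u (r n)" for n
  have f: "f n \<in> W" "B (f n) = 1" "E (f n) \<le> S + 1" for n using u EK by (auto simp: f_def)
  have lim: "AE x in lborel. (\<lambda>n. f n x) \<longlonglongrightarrow> v x" using lim by (simp add: f_def)
  have dlim: "AE z in \<mu>. (\<lambda>n. \<delta> (f n) z) \<longlonglongrightarrow> \<delta> v z"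
    using f(1) by (intro tendsto_diff_quot_AE lim v) auto
  have dm: "\<delta> v \<in> borel_measurable \<mu>" by (rule borel_measurable_diff_quot) measurable
  have vm: "v \<in> borel_measurable lborel" by simp
  have vL: "v \<in> Lp lborel q"
    using f(2) by (intro Lp_Fatou(1)[OF W_Lp(1)[OF f(1)] _ lim vm q_facts(2), of 1]) (simp add: B_def)
  have p0: "0 < p" using p by simp
  have "\<delta> v \<in> Lp \<mu> p"
    using f(3) by (intro Lp_Fatou(1)[OF W_Lp(2)[OF f(1)] _ dlim dm p0, of "S + 1"]) (simp add: E_def)
  with vL have vW: "v \<in> W" by (simp add: W_iff)
  have dW: "(\<lambda>x. f n x - v x) \<in> W" for n using W_add_cmult[OF f(1) vW, of n "-1"] by simp
  have "(\<lambda>n. B (f n) - B (\<lambda>x. f n x - v x)) \<longlonglongrightarrow> B v"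
    unfolding B_def using f(2) by (intro Brezis_Lieb[OF W_Lp(1)[OF f(1)] _ lim vm q_facts(2), of 1]) (simp add: B_def)
  then have "(\<lambda>n. 1 - (1 - B (\<lambda>x. f n x - v x))) \<longlonglongrightarrow> 1 - B v"
    unfolding f(2) by (intro tendsto_intros)
  then have Blim: "(\<lambda>n. B (\<lambda>x. f n x - v x)) \<longlonglongrightarrow> 1 - B v" by simp
  have dd: "\<delta> (\<lambda>x. f n x - v x) = (\<lambda>z. \<delta> (f n) z - \<delta> v z)" for n
    using diff_quot_add[of s p "f n" "-1" v] by (intro ext) simp
  have EBL: "(\<lambda>n. E (f n) - E (\<lambda>x. f n x - v x)) \<longlonglongrightarrow> E v"
    unfolding E_def dd using f(3)
    by (intro Brezis_Lieb[OF W_Lp(2)[OF f(1)] _ dlim dm p0, of "S + 1"]) (simp add: E_def)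
  have Elim0: "(\<lambda>n. E (u n)) \<longlonglongrightarrow> S"
  proof (rule tendsto_sandwich)
    show "\<forall>\<^sub>F n in sequentially. S \<le> E (u n)"
      using Sobolev_inequality[OF u(1)] u(2) by simp
    show "\<forall>\<^sub>F n in sequentially. E (u n) \<le> S + 1 / real (Suc n)" using u(3) by (simp add: less_imp_le)
    have "(\<lambda>n. S + 1 / real (Suc n)) \<longlonglongrightarrow> S + 0" by (intro tendsto_intros LIMSEQ_Suc[OF lim_1_over_n])
    then show "(\<lambda>n. S + 1 / real (Suc n)) \<longlonglongrightarrow> S" by simp
  qed simp
  have "(\<lambda>n. E (f n)) \<longlonglongrightarrow> S"
    using LIMSEQ_subseq_LIMSEQ[OF Elim0 r] by (simp add: f_def o_def)
  then have "(\<lambda>n. E (f n) - (E (f n) - E (\<lambda>x. f n x - v x))) \<longlonglongrightarrow> S - E v"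
    by (intro tendsto_diff EBL)
  then have Elim: "(\<lambda>n. E (\<lambda>x. f n x - v x)) \<longlonglongrightarrow> S - E v" by simp
  have t1: "0 \<le> 1 - B v" by (rule LIMSEQ_le_const[OF Blim]) auto
  have "(\<lambda>n. S * B (\<lambda>x. f n x - v x) powr (p / q)) \<longlonglongrightarrow> S * (1 - B v) powr (p / q)"
    using p q_facts by (intro tendsto_intros tendsto_powr' Blim) auto
  \<comment> \<open>The Sobolev inequality for the remainders f n - v, passed to the limit. Added to
    the one for v it leaves no room for 0 < B v < 1.\<close>
  then have split: "S * (1 - B v) powr (p / q) \<le> S - E v"
    by (rule LIMSEQ_le[OF _ Elim]) (use Sobolev_inequality[OF dW] in auto)
  have "\<not> (AE x in lborel. v x = 0)"
    using u(4) by (intro nonzero_limit[OF f(1,2) c(1) _ lim v]) (simp add: f_def)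
  then have t0: "0 < B v" using nonzero_ae_iff[OF vW] by (simp add: nonzero_ae_def)
  have Ev: "0 < E v" by (rule E_pos[OF vW t0])
  have "0 \<le> S * (1 - B v) powr (p / q)" using S_nonneg by simp
  \<comment> \<open>S is at least E v, and E v is positive because the limit v is nonzero.\<close>
  then have Spos: "0 < S" using Ev split by linarith
  have sob: "S * B v powr (p / q) \<le> E v" by (rule Sobolev_inequality[OF vW])
  have B1: "B v = 1"
  proof (rule ccontr)
    assume "B v \<noteq> 1"
    then have t: "0 < B v" "B v < 1" using t0 t1 by auto
    have pq: "p / q < 1" using q_facts p by simp
    have "B v powr 1 < B v powr (p / q)" "(1 - B v) powr 1 < (1 - B v) powr (p / q)"
      using t pq by (intro powr_less_mono'; simp)+
    then have "1 < B v powr (p / q) + (1 - B v) powr (p / q)" using t by simp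
    then have "S * 1 < S * (B v powr (p / q) + (1 - B v) powr (p / q))"
      using Spos by (intro mult_strict_left_mono)
    then show False using sob split by (simp add: distrib_left)
  qed
  have "E v = S" using sob split p q_facts unfolding B1 by simp
  then show ?thesis using vW B1 Spos by blast
qed

end

section \<open>Positivity and the Euler-Lagrange equation\<close>

text \<open>Follows from (b - c)^(p-1) \<le> b^(p-1). It yields the first-order gain in
  \<open>minimizer_positive\<close>: shrinking a difference b by c saves at least c b^(p-1).\<close>

lemma powr_sub_le:
  fixes b c p :: real
  assumes "0 \<le> c" "c \<le> b" "0 < b" "1 \<le> p"
  shows "(b - c) powr p \<le> b powr p - c * b powr (p - 1)"
proof (cases "b = c")
  case True
  have "c * c powr (p - 1) = c powr p"
    using assms True by (simp add: powr_diff)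
  then show ?thesis using True by simp
next
  case False
  have "(b - c) powr p = (b - c) * (b - c) powr (p - 1)" using assms False by (simp add: powr_diff)
  also have "\<dots> \<le> (b - c) * b powr (p - 1)" using assms by (intro mult_left_mono powr_mono2) auto
  also have "\<dots> = b powr p - c * b powr (p - 1)" 
  proof -
    have "b * b powr (p - 1) = b powr p" using assms by (simp add: powr_diff)
    then show ?thesis by (simp add: left_diff_distrib)
  qed
  finally show ?thesis .
qed

context frac_sobolev
begin

lemma minimizer_positive:
  assumes v: "v \<in> W" and nn: "\<And>x. 0 \<le> v x" and B1: "B v = 1" and ES: "E v = S"
  shows "AE x in lborel. 0 < v x"
proof (rule ccontr)
  assume neg: "\<not> (AE x in lborel. 0 < v x)"
  note [measurable] = W_measurable[OF v]
  \<comment> \<open>Countably many balls exhaust the space, so the zero set has positive measure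
    inside one of them; likewise, since B v = 1, v is at least some fixed level on a set of positive
    measure.\<close>
  obtain k :: nat where k: "\<not> (AE x in lborel. \<not> (v x = 0 \<and> norm x \<le> real k))"
  proof (rule ccontr)
    assume "\<not> thesis"
    then have "AE x in lborel. \<not> (v x = 0 \<and> norm x \<le> real k)" for k :: nat using that by blast
    then have "AE x in lborel. \<forall>k :: nat. \<not> (v x = 0 \<and> norm x \<le> real k)"
      by (intro iffD2[OF AE_all_countable] allI)
    then have "AE x in lborel. 0 < v x"
    proof eventually_elim
      case (elim x)
      obtain k :: nat where "norm x \<le> real k" using real_arch_simple by blast
      then show ?case using elim nn[of x] by (metis order_le_less)
    qed
    then show False using neg by simp
  qed
  obtain j :: nat where j: "\<not> (AE x in lborel. \<not> 1 / real (Suc j) \<le> v x)"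
  proof (rule ccontr)
    assume "\<not> thesis"
    then have "AE x in lborel. \<not> 1 / real (Suc j) \<le> v x" for j using that by blast
    then have "AE x in lborel. \<forall>j. \<not> 1 / real (Suc j) \<le> v x"
      by (intro iffD2[OF AE_all_countable] allI)
    then have "AE x in lborel. v x = 0"
    proof eventually_elim
      case (elim x)
      show ?case
      proof (rule ccontr)
        assume "v x \<noteq> 0"
        then have "0 < v x" using nn[of x] by simp
        then obtain i where "1 / real (Suc i) < v x" by (metis nat_approx_posE)
        then show False using elim by (metis less_imp_le)
      qed
    qed
    then show False using nonzero_ae_iff[OF v] B1 by (simp add: nonzero_ae_def)
  qed
  define d where "d = 1 / real (Suc j)"
  have d: "0 < d" by (simp add: d_def)
  define Z where "Z = {x. v x = 0 \<and> norm x \<le> real k}"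
  define P where "P = {x. d \<le> v x}"
  have ZP [measurable]: "Z \<in> sets borel" "P \<in> sets borel" unfolding Z_def P_def by measurable
  have Zpos: "emeasure lborel Z \<noteq> 0"
    using k AE_iff_measurable[of Z lborel "\<lambda>x. \<not> (v x = 0 \<and> norm x \<le> real k)"] ZP(1) by (auto simp: Z_def)
  have Ppos: "emeasure lborel P \<noteq> 0"
    using j AE_iff_measurable[of P lborel "\<lambda>x. \<not> d \<le> v x"] ZP(2) by (auto simp: P_def d_def)
  \<comment> \<open>Makes the dilated cutoff at least 1/2 on the ball of radius
    \<open>Suc k\<close>, which contains \<open>Z\<close>.\<close>
  define R where "R = 1 / (2 * real (Suc k))"
  have R: "0 < R" by (simp add: R_def)
  define \<eta> where "\<eta> x = cutoff (0 + R *\<^sub>R x)" for x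
  have \<eta>W: "\<eta> \<in> W" unfolding \<eta>_def by (rule W_affine(1)[OF cutoff_in_W R])
  have \<eta>: "0 \<le> \<eta> x" "\<eta> x \<le> 1" for x using cutoff_bounds by (auto simp: \<eta>_def)
  have \<eta>Z: "1 / 2 \<le> \<eta> x" if "x \<in> Z" for x
  proof -
    have "norm x \<le> real (Suc k)" using that by (simp add: Z_def)
    then have "R * norm x \<le> R * real (Suc k)" using R by (intro mult_left_mono) auto
    also have "\<dots> = 1 / 2" by (simp add: R_def)
    finally show ?thesis using R by (simp add: \<eta>_def cutoff_def)
  qed
  note [measurable] = W_measurable[OF \<eta>W]
  \<comment> \<open>Kernel restricted to pairs from \<open>Z\<close> and \<open>P\<close>, where
    raising v above 0 brings the two values closer. Its integral, finite because the energy of v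
    dominates it, is up to the factor d^(p-1) / 2 the coefficient of the linear gain.\<close>
  define g where "g = (\<lambda>(x, y). indicator Z x * indicator P y / norm (x - y) powr \<kappa> :: real)"
  have gm [measurable]: "g \<in> borel_measurable \<mu>" unfolding g_def by measurable
  have g0: "0 \<le> g z" for z by (simp add: g_def split_beta)
  have dv: "\<bar>\<delta> u (x, y)\<bar> powr p = \<bar>u x - u y\<bar> powr p / norm (x - y) powr \<kappa>" for u x y
    using p unfolding \<kappa>_def unfolding N_def by (simp add: diff_quot_def powr_divide powr_powr)
  have gle: "g z \<le> \<bar>\<delta> v z\<bar> powr p / d powr p" for z
  proof (cases z)
    case (Pair x y)
    show ?thesis
    proof (cases "x \<in> Z \<and> y \<in> P")
      case True
      then have "d powr p \<le> \<bar>v x - v y\<bar> powr p"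
        using p d by (intro powr_mono2) (auto simp: Z_def P_def)
      then have "d powr p / norm (x - y) powr \<kappa> \<le> \<bar>v x - v y\<bar> powr p / norm (x - y) powr \<kappa>"
        by (intro divide_right_mono) auto
      then have "d powr p / norm (x - y) powr \<kappa> / d powr p \<le> \<bar>v x - v y\<bar> powr p / norm (x - y) powr \<kappa> / d powr p"
        by (rule divide_right_mono) simp
      moreover have "d powr p / norm (x - y) powr \<kappa> / d powr p = g z" using True d by (simp add: g_def Pair)
      ultimately show ?thesis unfolding Pair dv by simp
    qed (auto simp: g_def Pair)
  qed
  have gi: "integrable \<mu> g"
  proof (rule Bochner_Integration.integrable_bound)
    show "integrable \<mu> (\<lambda>z. \<bar>\<delta> v z\<bar> powr p / d powr p)" using Lp_integrable[OF W_Lp(2)[OF v]] by simp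
  qed (use gle g0 in auto)
  have Ipos: "0 < (LINT z|\<mu>. g z)"
  proof -
    have "(LINT z|\<mu>. g z) \<noteq> 0"
    proof
      assume "(LINT z|\<mu>. g z) = 0"
      then have "AE z in \<mu>. g z = 0"
        using integral_nonneg_eq_0_iff_AE[OF gi] g0 by simp
      then have "AE z in \<mu>. z \<notin> Z \<times> P"
      proof eventually_elim
        case (elim z)
        show ?case
        proof
          assume z: "z \<in> Z \<times> P"
          then have "fst z \<noteq> snd z" using d by (auto simp: Z_def P_def)
          then show False using elim z by (auto simp: g_def split_beta)
        qed
      qed
      moreover have m: "Z \<times> P \<in> sets \<mu>" using ZP by auto
      ultimately have "emeasure \<mu> (Z \<times> P) = 0"
        using AE_iff_measurable[of "Z \<times> P" \<mu> "\<lambda>z. z \<notin> Z \<times> P"] sets.sets_into_space[OF m] by auto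
      then show False using Zpos Ppos ZP by (simp add: lborel.emeasure_pair_measure_Times)
    qed
    moreover have "0 \<le> (LINT z|\<mu>. g z)" by (intro Bochner_Integration.integral_nonneg g0)
    ultimately show ?thesis by simp
  qed
  \<comment> \<open>\<epsilon> \<le> d ensures that the maximum still equals v on \<open>P\<close>.
    One factor \<epsilon> is divided out, so the right-hand side tends to 0 with \<epsilon> because
    p > 1.\<close>
  have key: "d powr (p - 1) / 2 * (LINT z|\<mu>. g z) \<le> \<epsilon> powr (p - 1) * E \<eta>" if \<epsilon>: "0 < \<epsilon>" "\<epsilon> \<le> d" for \<epsilon>
  proof -
    define m where "m x = max (v x) (\<epsilon> * \<eta> x)" for x
    have mm [measurable]: "m \<in> borel_measurable borel" unfolding m_def by measurable
    define c where "c = \<epsilon> / 2 * d powr (p - 1)"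
    define h where "h z = (\<bar>\<delta> v z\<bar> powr p + \<epsilon> powr p * \<bar>\<delta> \<eta> z\<bar> powr p) - c * g z" for z
    have hi: "integrable \<mu> h"
      unfolding h_def using gi Lp_integrable[OF W_Lp(2)[OF v]] Lp_integrable[OF W_Lp(2)[OF \<eta>W]] by auto
    have "\<bar>m x - m y\<bar> powr p \<le> (\<bar>v x - v y\<bar> powr p + \<epsilon> powr p * \<bar>\<eta> x - \<eta> y\<bar> powr p) - c * (indicator Z x * indicator P y)" for x y
    proof (cases "x \<in> Z \<and> y \<in> P")
      case True
      have "\<epsilon> * \<eta> x \<le> \<epsilon> * 1" "\<epsilon> * \<eta> y \<le> \<epsilon> * 1" using \<epsilon> \<eta> by (intro mult_left_mono; simp)+
      moreover have "d \<le> v y" using True by (simp add: P_def)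
      ultimately have e1: "\<epsilon> * \<eta> x \<le> v y" "\<epsilon> * \<eta> y \<le> v y" using \<epsilon> by linarith+
      have e0: "0 \<le> \<epsilon> * \<eta> x" using \<epsilon> \<eta> by simp
      have vx: "v x = 0" and vy: "d \<le> v y" "0 < v y" using True d by (auto simp: Z_def P_def)
      have mx: "m x = \<epsilon> * \<eta> x" "m y = v y" using e1 e0 vx by (auto simp: m_def)
      have "\<epsilon> / 2 * d powr (p - 1) \<le> \<epsilon> * \<eta> x * v y powr (p - 1)"
        using \<eta>Z[of x] True \<epsilon> \<eta>[of x] vy d p by (intro mult_mono powr_mono2) auto
      then have ce: "c \<le> \<epsilon> * \<eta> x * v y powr (p - 1)" by (simp add: c_def)
      have "\<bar>m x - m y\<bar> powr p = (v y - \<epsilon> * \<eta> x) powr p" using e1 mx by simp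
      also have "\<dots> \<le> v y powr p - \<epsilon> * \<eta> x * v y powr (p - 1)"
        using powr_sub_le[OF e0 e1(1) vy(2), of p] p by simp
      also have "\<dots> \<le> \<bar>v x - v y\<bar> powr p - c" using ce vx vy by simp
      also have "\<dots> \<le> (\<bar>v x - v y\<bar> powr p + \<epsilon> powr p * \<bar>\<eta> x - \<eta> y\<bar> powr p) - c" by simp
      finally show ?thesis using True by simp
    next
      case False
      \<comment> \<open>For all other pairs the difference of the maxima is at most the larger of
        the two differences, and its p-th power at most the sum of theirs.\<close>
      have "\<bar>m x - m y\<bar> \<le> max \<bar>v x - v y\<bar> \<bar>\<epsilon> * \<eta> x - \<epsilon> * \<eta> y\<bar>" by (auto simp: m_def max_def)
      also have "\<bar>\<epsilon> * \<eta> x - \<epsilon> * \<eta> y\<bar> = \<epsilon> * \<bar>\<eta> x - \<eta> y\<bar>"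
        using \<epsilon> by (simp add: abs_mult flip: right_diff_distrib)
      finally have "\<bar>m x - m y\<bar> powr p \<le> (max \<bar>v x - v y\<bar> (\<epsilon> * \<bar>\<eta> x - \<eta> y\<bar>)) powr p"
        using p by (intro powr_mono2) auto
      also have "\<dots> \<le> \<bar>v x - v y\<bar> powr p + (\<epsilon> * \<bar>\<eta> x - \<eta> y\<bar>) powr p" by (auto simp: max_def)
      also have "(\<epsilon> * \<bar>\<eta> x - \<eta> y\<bar>) powr p = \<epsilon> powr p * \<bar>\<eta> x - \<eta> y\<bar> powr p" by (simp add: powr_mult)
      finally show ?thesis using False by auto
    qed
    then have "\<bar>m x - m y\<bar> powr p / norm (x - y) powr \<kappa> \<le>
        ((\<bar>v x - v y\<bar> powr p + \<epsilon> powr p * \<bar>\<eta> x - \<eta> y\<bar> powr p) - c * (indicator Z x * indicator P y)) / norm (x - y) powr \<kappa>" for x y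
      by (intro divide_right_mono) auto
    then have mh: "\<bar>\<delta> m z\<bar> powr p \<le> h z" for z
      by (cases z) (simp add: dv h_def g_def diff_divide_distrib add_divide_distrib)
    have dm: "\<delta> m \<in> Lp \<mu> p" by (rule Lp_dominated[OF borel_measurable_diff_quot[OF mm] hi mh])
    have "(\<lambda>x. v x + \<epsilon> * \<eta> x) \<in> Lp lborel q" using W_Lp(1)[OF W_add_cmult[OF v \<eta>W]] .
    moreover have "\<bar>m x\<bar> \<le> \<bar>v x + \<epsilon> * \<eta> x\<bar>" for x
    proof -
      have "0 \<le> \<epsilon> * \<eta> x" using \<epsilon> \<eta> by simp
      then show ?thesis using nn[of x] by (auto simp: m_def max_def)
    qed
    ultimately have mL: "m \<in> Lp lborel q"
      by (rule Lp_mono(1)[rotated]) (use q_facts in auto)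
    have mW: "m \<in> W" using dm mL by (simp add: W_iff)
    \<comment> \<open>The maximum only raises v, so the Sobolev inequality bounds its energy below
      by S = E v.\<close>
    have "B v \<le> B m" unfolding B_def
      by (rule Lp_mono(2)[OF _ mL]) (use nn q_facts in \<open>auto simp: m_def le_max_iff_disj abs_of_nonneg\<close>)
    then have "1 \<le> B m powr (p / q)" using B1 p q_facts by (intro ge_one_powr_ge_zero) auto
    then have "S * 1 \<le> S * B m powr (p / q)" by (intro mult_left_mono S_nonneg)
    also have "\<dots> \<le> E m" by (rule Sobolev_inequality[OF mW])
    also have "\<dots> \<le> (LINT z|\<mu>. h z)"
      unfolding E_def pint_def by (intro integral_mono hi mh Lp_integrable[OF dm])
    also have "\<dots> = E v + \<epsilon> powr p * E \<eta> - c * (LINT z|\<mu>. g z)"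
      unfolding h_def E_def pint_def
      using gi Lp_integrable[OF W_Lp(2)[OF v]] Lp_integrable[OF W_Lp(2)[OF \<eta>W]] by simp
    finally have "c * (LINT z|\<mu>. g z) \<le> \<epsilon> powr p * E \<eta>" using ES by simp
    also have "\<epsilon> powr p = \<epsilon> * \<epsilon> powr (p - 1)" using \<epsilon> by (simp add: powr_diff)
    finally have "\<epsilon> * (d powr (p - 1) / 2 * (LINT z|\<mu>. g z)) \<le> \<epsilon> * (\<epsilon> powr (p - 1) * E \<eta>)"
      by (simp add: c_def mult.assoc)
    then show ?thesis using \<epsilon> by (simp only: mult_le_cancel_left_pos)
  qed
  define e where "e n = d * (1 / real (Suc n))" for n
  have elim: "e \<longlonglongrightarrow> d * 0" unfolding e_def by (intro tendsto_intros LIMSEQ_Suc[OF lim_1_over_n])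
  have e: "0 < e n" "e n \<le> d" for n using d by (simp_all add: e_def divide_le_eq)
  have "(\<lambda>n. e n powr (p - 1) * E \<eta>) \<longlonglongrightarrow> (d * 0) powr (p - 1) * E \<eta>"
    using p e by (intro tendsto_intros tendsto_powr' elim) (auto simp: less_imp_le)
  then have "d powr (p - 1) / 2 * (LINT z|\<mu>. g z) \<le> (d * 0) powr (p - 1) * E \<eta>"
    by (rule LIMSEQ_le_const) (use key[OF e] in auto)
  moreover have "0 < d powr (p - 1) / 2 * (LINT z|\<mu>. g z)" using d Ipos by simp
  ultimately show False by simp
qed

lemma ex_positive_minimizer: "\<exists>v\<in>W. B v = 1 \<and> E v = S \<and> (\<forall>x. 0 < v x)"
proof -
  obtain u where u: "u \<in> W" "B u = 1" "E u = S" using ex_minimizer by blast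
  define a where "a x = \<bar>u x\<bar>" for x
  have a: "a \<in> W" "B a = 1" "E a \<le> S" using W_abs[OF u(1)] u by (simp_all add: a_def[abs_def])
  have "S \<le> E a" using Sobolev_inequality[OF a(1)] a(2) by simp
  then have Ea: "E a = S" using a(3) by simp
  have ae: "AE x in lborel. 0 < a x"
    by (rule minimizer_positive[OF a(1) _ a(2) Ea]) (simp add: a_def)
  note [measurable] = W_measurable[OF a(1)]
  \<comment> \<open>The value 1 on the exceptional null set gives positivity at every point.\<close>
  define v where "v x = (if 0 < a x then a x else 1)" for x
  have vm: "v \<in> borel_measurable borel" unfolding v_def by measurable
  have "AE x in lborel. a x = v x" using ae by eventually_elim (simp add: v_def)
  note w = W_cong_AE[OF a(1) vm this]
  have "0 < v x" for x by (simp add: v_def)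
  with w a Ea show ?thesis by (intro bexI[of _ v]) auto
qed

section \<open>The Euler-Lagrange equation and the normalization\<close>

lemma frac_p_laplacian_eq: "frac_p_laplacian s p u \<phi> = (LINT z|\<mu>. \<bar>\<delta> u z\<bar> powr (p - 2) * \<delta> u z * \<delta> \<phi> z)"
proof -
  have "\<bar>u x - u y\<bar> powr (p - 2) * (u x - u y) * (\<phi> x - \<phi> y) / norm (x - y) powr (real CARD('n) + s * p)
    = \<bar>\<delta> u (x, y)\<bar> powr (p - 2) * \<delta> u (x, y) * \<delta> \<phi> (x, y)" for x y
  proof (cases "x = y")
    case False
    define t where "t = norm (x - y) powr ((real CARD('n) + s * p) / p)"
    have t: "0 < t" using False by (simp add: t_def)
    have "norm (x - y) powr (real CARD('n) + s * p) = t powr p" using p by (simp add: t_def powr_powr)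
    also have "\<dots> = t powr (p - 2) * t * t" using t by (simp add: powr_diff power2_eq_square)
    finally show ?thesis using t by (simp add: diff_quot_def t_def[symmetric] powr_divide)
  qed (simp add: diff_quot_def)
  then show ?thesis unfolding frac_p_laplacian_def by (intro Bochner_Integration.integral_cong) auto
qed

text \<open>\<open>F\<close> is nonnegative by the Sobolev inequality and vanishes at t = 0, so its
  derivative there is 0; no constraint has to be handled. B v = 1 makes the derivative of the power
  of \<open>B\<close> simply p D.\<close>

lemma Euler_Lagrange:
  assumes v: "v \<in> W" and B1: "B v = 1" and ES: "E v = S" and pos: "\<And>x. 0 < v x" and \<phi>: "\<phi> \<in> W"
  shows "frac_p_laplacian s p v \<phi> = S * (LINT x|lborel. v x powr (q - 1) * \<phi> x)"
proof -
  define D where "D = (LINT x|lborel. \<bar>v x\<bar> powr (q - 2) * v x * \<phi> x)"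
  have "((\<lambda>t. pint \<mu> p (\<lambda>z. \<delta> v z + t * \<delta> \<phi> z)) has_real_derivative p * frac_p_laplacian s p v \<phi>) (at 0)"
    unfolding frac_p_laplacian_eq by (rule pint_has_derivative[OF W_Lp(2)[OF v] W_Lp(2)[OF \<phi>] p])
  moreover have "pint \<mu> p (\<lambda>z. \<delta> v z + t * \<delta> \<phi> z) = E (\<lambda>x. v x + t * \<phi> x)" for t
  proof -
    have "\<delta> (\<lambda>x. v x + t * \<phi> x) = (\<lambda>z. \<delta> v z + t * \<delta> \<phi> z)" by (rule ext) (rule diff_quot_add)
    then show ?thesis by (simp add: E_def)
  qed
  ultimately have dE: "((\<lambda>t. E (\<lambda>x. v x + t * \<phi> x)) has_real_derivative p * frac_p_laplacian s p v \<phi>) (at 0)"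
    by simp
  have dB: "((\<lambda>t. B (\<lambda>x. v x + t * \<phi> x)) has_real_derivative q * D) (at 0)"
    unfolding B_def D_def by (rule pint_has_derivative[OF W_Lp(1)[OF v] W_Lp(1)[OF \<phi>] q_facts(3)])
  define F where "F t = E (\<lambda>x. v x + t * \<phi> x) - S * B (\<lambda>x. v x + t * \<phi> x) powr (p / q)" for t
  have "p / q * B (\<lambda>x. v x + 0 * \<phi> x) powr (p / q - of_nat 1) * (q * D) = p * D"
    using q_facts(2) by (simp add: B1)
  moreover have "((\<lambda>t. B (\<lambda>x. v x + t * \<phi> x) powr (p / q)) has_real_derivative
     p / q * B (\<lambda>x. v x + 0 * \<phi> x) powr (p / q - of_nat 1) * (q * D)) (at 0)"
    by (rule DERIV_fun_powr[OF dB]) (simp add: B1)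
  ultimately have dP: "((\<lambda>t. B (\<lambda>x. v x + t * \<phi> x) powr (p / q)) has_real_derivative p * D) (at 0)"
    by metis
  have dF: "(F has_real_derivative p * frac_p_laplacian s p v \<phi> - S * (p * D)) (at 0)"
    unfolding F_def by (rule DERIV_diff[OF dE DERIV_cmult[OF dP]])
  have "0 \<le> F t" for t unfolding F_def using Sobolev_inequality[OF W_add_cmult[OF v \<phi>]] by simp
  moreover have "F 0 = 0" by (simp add: F_def B1 ES)
  ultimately have "p * frac_p_laplacian s p v \<phi> - S * (p * D) = 0"
    by (intro DERIV_local_min[OF dF zero_less_one]) auto
  then have "frac_p_laplacian s p v \<phi> = S * D" using p by simp
  moreover have "\<bar>v x\<bar> powr (q - 2) * v x * \<phi> x = v x powr (q - 1) * \<phi> x" for x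
    using pos[of x] by (simp add: powr_diff power2_eq_square)
  ultimately show ?thesis by (simp add: D_def)
qed

lemma ex_normalized_minimizer: "\<exists>U :: real ^ 'n \<Rightarrow> real. normalized_minimizer s p U"
proof -
  obtain v where v: "v \<in> W" "B v = 1" "E v = S" "\<And>x. 0 < v x" using ex_positive_minimizer by blast
  have S: "0 < S" using ex_minimizer by blast
  \<comment> \<open>The left-hand side of the equation is homogeneous of degree p - 1 and the
    right-hand side of degree q - 1, so l^(q-p) = S absorbs the factor S.\<close>
  define l where "l = S powr (1 / (q - p))"
  have l: "0 < l" using S by (simp add: l_def)
  have lS: "l powr (q - p) = S" using S q_facts(1) by (simp add: l_def powr_powr)
  define U where "U x = l * v x" for x
  have UW: "U \<in> W" "E U = l powr p * S" "B U = l powr q"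
    using W_cmult[OF v(1), of l] l v by (simp_all add: U_def[abs_def])
  have "sobolev_quotient s p U = S"
    using sobolev_quotient_eq[OF UW(1)] UW l q_facts(2) by (simp add: powr_powr)
  moreover have "frac_p_laplacian s p U \<phi> = (LINT x|lborel. U x powr (q - 1) * \<phi> x)" if \<phi>: "\<phi> \<in> W" for \<phi>
  proof -
    have lp: "l powr (p - 2) * l = l powr (p - 1)" using l by (simp add: powr_diff power2_eq_square)
    have "frac_p_laplacian s p U \<phi> = l powr (p - 1) * frac_p_laplacian s p v \<phi>"
    proof -
      have eq: "\<bar>\<delta> U z\<bar> powr (p - 2) * \<delta> U z * \<delta> \<phi> z = l powr (p - 1) * (\<bar>\<delta> v z\<bar> powr (p - 2) * \<delta> v z * \<delta> \<phi> z)" for z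
        unfolding U_def diff_quot_cmult lp[symmetric] using l by (simp add: abs_mult powr_mult)
      show ?thesis unfolding frac_p_laplacian_eq integral_mult_right_zero[symmetric]
        by (rule Bochner_Integration.integral_cong[OF refl eq])
    qed
    also have "\<dots> = l powr (p - 1) * (l powr (q - p) * (LINT x|lborel. v x powr (q - 1) * \<phi> x))"
      using Euler_Lagrange[OF v \<phi>] lS by simp
    also have "\<dots> = l powr (q - 1) * (LINT x|lborel. v x powr (q - 1) * \<phi> x)"
      by (simp add: mult.assoc[symmetric] powr_add[symmetric])
    also have "\<dots> = (LINT x|lborel. U x powr (q - 1) * \<phi> x)"
      by (simp add: U_def powr_mult mult.assoc)
    finally show ?thesis .
  qed
  moreover have "nonzero_ae U" using nonzero_ae_iff[OF UW(1)] UW(3) l by simp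
  ultimately have "normalized_minimizer s p U"
    using UW(1) v(4) l unfolding normalized_minimizer_def q_def[symmetric]
    by (auto simp: U_def sobolev_const_def)
  then show ?thesis by blast
qed

end

section \<open>The Nehari set\<close>

context frac_sobolev
begin

definition mixed :: "real \<Rightarrow> real \<Rightarrow> (real ^ 'n \<Rightarrow> real) \<Rightarrow> (real ^ 'n \<Rightarrow> real) \<Rightarrow> real" where
  "mixed \<alpha> \<beta> u v = (LINT x|lborel. \<bar>u x\<bar> powr \<alpha> * \<bar>v x\<bar> powr \<beta>)"

context
  fixes \<alpha> \<beta> \<gamma> :: real
  assumes \<alpha>\<beta>: "1 < \<alpha>" "1 < \<beta>" "\<alpha> + \<beta> = q" and \<gamma>: "0 < \<gamma>"
begin

lemma mixed_integrable:
  assumes "u \<in> W" "v \<in> W"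
  shows "integrable lborel (\<lambda>x. \<bar>u x\<bar> powr \<alpha> * \<bar>v x\<bar> powr \<beta>)"
  using W_Lp(1)[OF assms(1)] W_Lp(1)[OF assms(2)] \<alpha>\<beta> by (intro Lp_prod_integrable) auto

lemma Holder_mixed:
  assumes "u \<in> W" "v \<in> W"
  shows "mixed \<alpha> \<beta> u v \<le> B u powr (\<alpha> / q) * B v powr (\<beta> / q)"
  using Holder_pint[of u lborel \<alpha> \<beta> v] W_Lp(1)[OF assms(1)] W_Lp(1)[OF assms(2)] \<alpha>\<beta>
  by (simp add: mixed_def B_def)

lemma nehari_set_iff:
  "(u, v) \<in> nehari_set s p \<alpha> \<beta> \<gamma> \<longleftrightarrow> u \<in> W \<and> v \<in> W \<and> 0 < B u \<and> 0 < B v \<and>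
     E u = B u + \<alpha> * \<gamma> / q * mixed \<alpha> \<beta> u v \<and> E v = B v + \<beta> * \<gamma> / q * mixed \<alpha> \<beta> u v"
proof (cases "u \<in> W \<and> v \<in> W")
  case True
  then have uv: "u \<in> W" "v \<in> W" by auto
  have i: "(LINT x|lborel. \<bar>f x\<bar> powr q + c * \<bar>u x\<bar> powr \<alpha> * \<bar>v x\<bar> powr \<beta>) = B f + c * mixed \<alpha> \<beta> u v"
    if "f \<in> W" for f c
    using Lp_integrable[OF W_Lp(1)[OF that]] mixed_integrable[OF uv]
    by (simp add: B_def pint_def mixed_def mult.assoc)
  show ?thesis
    unfolding nehari_set_def q_def[symmetric] mem_Collect_eq case_prod_conv i[OF uv(1)] i[OF uv(2)]
    using uv by (simp add: nonzero_ae_iff sobolev_norm_powr)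
qed (auto simp: nehari_set_def)

text \<open>Add the two constraints: since \<alpha> + \<beta> = q, the nonlinear integral equals E u
  + E v, and 1 / p - 1 / q = s / N.\<close>

lemma energy_nehari:
  assumes "(u, v) \<in> nehari_set s p \<alpha> \<beta> \<gamma>"
  shows "energy s p \<alpha> \<beta> \<gamma> (u, v) = s / N * (E u + E v)"
proof -
  have uv: "u \<in> W" "v \<in> W"
    and eq: "E u = B u + \<alpha> * \<gamma> / q * mixed \<alpha> \<beta> u v" "E v = B v + \<beta> * \<gamma> / q * mixed \<alpha> \<beta> u v"
    using assms unfolding nehari_set_iff by auto
  have "(LINT x|lborel. \<bar>u x\<bar> powr q + \<bar>v x\<bar> powr q + \<gamma> * \<bar>u x\<bar> powr \<alpha> * \<bar>v x\<bar> powr \<beta>) =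
     B u + B v + \<gamma> * mixed \<alpha> \<beta> u v"
    using Lp_integrable[OF W_Lp(1)[OF uv(1)]] Lp_integrable[OF W_Lp(1)[OF uv(2)]] mixed_integrable[OF uv]
    by (simp add: B_def pint_def mixed_def mult.assoc)
  also have "\<dots> = E u + E v"
  proof -
    have "\<alpha> * \<gamma> / q + \<beta> * \<gamma> / q = \<gamma>"
      using \<alpha>\<beta>(3) q_facts(2) by (simp flip: add_divide_distrib distrib_right)
    then have "\<alpha> * \<gamma> / q * mixed \<alpha> \<beta> u v + \<beta> * \<gamma> / q * mixed \<alpha> \<beta> u v = \<gamma> * mixed \<alpha> \<beta> u v"
      by (simp only: flip: distrib_right)
    then show ?thesis unfolding eq by simp
  qed
  finally have "energy s p \<alpha> \<beta> \<gamma> (u, v) = 1 / p * (E u + E v) - 1 / q * (E u + E v)"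
    unfolding energy_def q_def[symmetric] using uv by (simp add: sobolev_norm_powr)
  also have "\<dots> = (1 - p / q) / p * (E u + E v)"
  proof -
    have "1 / p - 1 / q = (1 - p / q) / p" using p by (simp add: diff_divide_distrib)
    then show ?thesis by (simp only: left_diff_distrib[symmetric])
  qed
  also have "(1 - p / q) / p = s / N" unfolding q_facts(5) using p by simp
  finally show ?thesis .
qed

lemma S_pos: "0 < S"
  using ex_minimizer by blast

lemma sobolev_exponent: "q / (q - p) = N / (s * p)"
  using q_facts(1,2) N_pos s p by (subst q_facts(6)[symmetric]) simp

text \<open>The substitution \<open>k = (B u) powr (p / q) / S powr (p / (q - p))\<close> turns the Nehari
  constraints into the inequalities of the algebraic system.\<close>

lemma scaled_inequality:
  assumes u: "u \<in> W" "0 < B u" and v: "v \<in> W" "0 < B v" and ab: "a + b = q"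
    and m: "m \<le> B u powr (a / q) * B v powr (b / q)" and c: "0 \<le> c" and eq: "E u = B u + c * m"
  defines "k \<equiv> B u powr (p / q) / S powr (p / (q - p))" and "l \<equiv> B v powr (p / q) / S powr (p / (q - p))"
  shows "1 \<le> k powr ((q - p) / p) + c * k powr ((a - p) / p) * l powr (b / p)"
proof -
  \<comment> \<open>Chosen so that \<sigma>^((q-p)/p) = S; the factor S (k \<sigma>) then cancels
    from the whole inequality.\<close>
  define \<sigma> where "\<sigma> = S powr (p / (q - p))"
  have \<sigma>: "0 < \<sigma>" "\<sigma> powr ((q - p) / p) = S"
    using S_pos q_facts(1) p by (auto simp: \<sigma>_def powr_powr)
  have k: "0 < k" "0 < l" using u v \<sigma> by (auto simp: k_def l_def \<sigma>_def)
  have kB: "B u powr (p / q) = k * \<sigma>" "B v powr (p / q) = l * \<sigma>"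
    using \<sigma> by (simp_all add: k_def l_def \<sigma>_def)
  have pw: "B f powr (t / q) = (B f powr (p / q)) powr (t / p)" for f t
    using p by (simp add: powr_powr)
  have Bu: "B u = (k * \<sigma>) powr (q / p)"
    using pw[of u q] u q_facts(2) kB by simp
  have "S * (k * \<sigma>) \<le> E u" using Sobolev_inequality[OF u(1)] kB by simp
  also have "\<dots> \<le> (k * \<sigma>) powr (q / p) + c * ((k * \<sigma>) powr (a / p) * (l * \<sigma>) powr (b / p))"
    using eq Bu mult_left_mono[OF m[unfolded pw[of u a] pw[of v b] kB] c] by linarith
  also have "(k * \<sigma>) powr (q / p) = k powr ((q - p) / p) * (S * (k * \<sigma>))"
  proof -
    have "q / p = (q - p) / p + 1" using p by (simp add: field_simps)
    then have "(k * \<sigma>) powr (q / p) = (k * \<sigma>) powr ((q - p) / p) * (k * \<sigma>)"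
      using k \<sigma> by (simp add: powr_add)
    then show ?thesis unfolding powr_mult \<sigma>(2) by (simp add: mult.assoc)
  qed
  also have "(k * \<sigma>) powr (a / p) * (l * \<sigma>) powr (b / p) = k powr ((a - p) / p) * l powr (b / p) * (S * (k * \<sigma>))"
  proof -
    have 1: "a / p = (a - p) / p + 1" using p by (simp add: field_simps)
    have "(q - p) / p = (a - p) / p + b / p" using ab by (simp add: add_divide_distrib[symmetric])
    then have 2: "S = \<sigma> powr ((a - p) / p) * \<sigma> powr (b / p)" using \<sigma>(2) by (simp add: powr_add)
    have "(k * \<sigma>) powr (a / p) = k powr ((a - p) / p) * \<sigma> powr ((a - p) / p) * (k * \<sigma>)"
      using k \<sigma> by (subst 1) (simp add: powr_add powr_mult)
    then show ?thesis unfolding 2 by (simp add: powr_mult)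
  qed
  finally have "1 * (S * (k * \<sigma>)) \<le> (k powr ((q - p) / p) + c * k powr ((a - p) / p) * l powr (b / p)) * (S * (k * \<sigma>))"
    by (simp add: distrib_right mult.assoc)
  then show ?thesis by (rule mult_right_le_imp_le) (use S_pos k \<sigma> in simp)
qed

text \<open>K stands for any lower bound of k + l under the two inequalities, which keeps the
  condition on \<gamma> out of the analysis. The two Sobolev inequalities add up to E u + E v \<ge>
  S \<sigma> (k + l), and S \<sigma> = S^(N/(s p)).\<close>

lemma energy_nehari_ge:
  fixes u v :: "real ^ 'n \<Rightarrow> real"
  assumes uv: "(u, v) \<in> nehari_set s p \<alpha> \<beta> \<gamma>"
    and alg: "\<And>k l. 0 < k \<Longrightarrow> 0 < l \<Longrightarrow>
      1 \<le> k powr ((q - p) / p) + \<alpha> * \<gamma> / q * k powr ((\<alpha> - p) / p) * l powr (\<beta> / p) \<Longrightarrow>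
      1 \<le> l powr ((q - p) / p) + \<beta> * \<gamma> / q * l powr ((\<beta> - p) / p) * k powr (\<alpha> / p) \<Longrightarrow> K \<le> k + l"
  shows "s / N * K * S powr (N / (s * p)) \<le> energy s p \<alpha> \<beta> \<gamma> (u, v)"
proof -
  have W: "u \<in> W" "v \<in> W" and B0: "0 < B u" "0 < B v"
    and eq: "E u = B u + \<alpha> * \<gamma> / q * mixed \<alpha> \<beta> u v" "E v = B v + \<beta> * \<gamma> / q * mixed \<alpha> \<beta> u v"
    using uv unfolding nehari_set_iff by auto
  define \<sigma> where "\<sigma> = S powr (p / (q - p))"
  have \<sigma>: "0 < \<sigma>" using S_pos by (simp add: \<sigma>_def)
  define k where "k = B u powr (p / q) / \<sigma>"
  define l where "l = B v powr (p / q) / \<sigma>"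
  have k: "0 < k" "0 < l" using B0 \<sigma> by (auto simp: k_def l_def)
  have c: "0 \<le> \<alpha> * \<gamma> / q" "0 \<le> \<beta> * \<gamma> / q" using \<alpha>\<beta> \<gamma> q_facts(2) by auto
  have "1 \<le> k powr ((q - p) / p) + \<alpha> * \<gamma> / q * k powr ((\<alpha> - p) / p) * l powr (\<beta> / p)"
    unfolding k_def l_def \<sigma>_def
    by (rule scaled_inequality[OF W(1) B0(1) W(2) B0(2) \<alpha>\<beta>(3) Holder_mixed[OF W] c(1) eq(1)])
  moreover have "1 \<le> l powr ((q - p) / p) + \<beta> * \<gamma> / q * l powr ((\<beta> - p) / p) * k powr (\<alpha> / p)"
    unfolding k_def l_def \<sigma>_def
    using Holder_mixed[OF W] \<alpha>\<beta>(3)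
    by (intro scaled_inequality[OF W(2) B0(2) W(1) B0(1) _ _ c(2) eq(2)]) (auto simp: mult.commute)
  ultimately have K: "K \<le> k + l" by (rule alg[OF k])
  have "S * (k * \<sigma>) \<le> E u" "S * (l * \<sigma>) \<le> E v"
    using Sobolev_inequality[OF W(1)] Sobolev_inequality[OF W(2)] \<sigma> by (simp_all add: k_def l_def)
  moreover have "S * \<sigma> * (k + l) = S * (k * \<sigma>) + S * (l * \<sigma>)" by (simp add: algebra_simps)
  ultimately have "S * \<sigma> * (k + l) \<le> E u + E v" by linarith
  moreover have "S * \<sigma> * K \<le> S * \<sigma> * (k + l)" using K S_pos \<sigma> by (intro mult_left_mono) auto
  ultimately have "S * \<sigma> * K \<le> E u + E v" by linarith
  moreover have "S * \<sigma> = S powr (N / (s * p))"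
  proof -
    have "1 + p / (q - p) = q / (q - p)" using q_facts(1) by (simp add: field_simps)
    moreover have "S * \<sigma> = S powr (1 + p / (q - p))" using S_pos by (simp add: \<sigma>_def powr_add)
    ultimately show ?thesis by (simp add: sobolev_exponent)
  qed
  ultimately have "S powr (N / (s * p)) * K \<le> E u + E v" by simp
  then have "s / N * (S powr (N / (s * p)) * K) \<le> s / N * (E u + E v)"
    using s N_pos by (intro mult_left_mono) auto
  then show ?thesis unfolding energy_nehari[OF uv] by (simp add: mult_ac)
qed

text \<open>Testing the equation with U itself gives E U = B U; the value of the Sobolev quotient
  then determines B U, since 1 - p / q = s p / N.\<close>

lemma normalized_minimizer_energy:
  assumes U: "normalized_minimizer s p (U :: real ^ 'n \<Rightarrow> real)"
  shows "U \<in> W" "E U = B U" "B U = S powr (N / (s * p))"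
proof -
  show W: "U \<in> W" using U by (simp add: normalized_minimizer_def)
  have pos: "0 < U x" for x using U by (simp add: normalized_minimizer_def)
  have "0 < B U" using U nonzero_ae_iff[OF W] by (simp add: normalized_minimizer_def)
  have EL: "frac_p_laplacian s p U U = (LINT x|lborel. U x powr (q - 1) * U x)"
    using U W unfolding normalized_minimizer_def q_def[symmetric] by blast
  have "\<bar>\<delta> U z\<bar> powr (p - 2) * \<delta> U z * \<delta> U z = \<bar>\<delta> U z\<bar> powr p" for z
  proof (cases "\<delta> U z = 0")
    case False
    have "\<bar>\<delta> U z\<bar> powr p = \<bar>\<delta> U z\<bar> powr (p - 2) * \<bar>\<delta> U z\<bar> powr 2"
      by (simp only: powr_add[symmetric]) simp
    moreover have "\<bar>\<delta> U z\<bar> powr 2 = \<delta> U z * \<delta> U z" using False by (simp add: power2_eq_square)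
    ultimately show ?thesis by (simp only: mult.assoc)
  qed simp
  then have "frac_p_laplacian s p U U = E U" by (simp add: frac_p_laplacian_eq E_def pint_def)
  moreover have "U x powr (q - 1) * U x = \<bar>U x\<bar> powr q" for x
    using pos[of x] by (simp add: powr_diff)
  ultimately show EB: "E U = B U" using EL by (simp add: B_def pint_def)
  have "E U / B U powr (p / q) = S"
    using U sobolev_quotient_eq[OF W] by (simp add: normalized_minimizer_def sobolev_const_def)
  then have "B U powr 1 / B U powr (p / q) = S" using EB \<open>0 < B U\<close> by simp
  then have "B U powr (1 - p / q) = S" by (simp only: powr_diff)
  then have "B U powr ((1 - p / q) * (N / (s * p))) = S powr (N / (s * p))"
    by (simp only: powr_powr[symmetric])
  then show "B U = S powr (N / (s * p))" unfolding q_facts(5) using \<open>0 < B U\<close> s p N_pos by simp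
qed

text \<open>For two multiples of U all integrals are multiples of B U, and the right-hand sides of
  the Nehari constraints become k B U and l B U times the left-hand sides of the algebraic
  system.\<close>

lemma scaled_pair_in_nehari:
  assumes U: "normalized_minimizer s p (U :: real ^ 'n \<Rightarrow> real)" and kl: "alg_system q p \<alpha> \<beta> \<gamma> k l"
  defines "u \<equiv> (\<lambda>x. k powr (1 / p) * U x)" and "v \<equiv> (\<lambda>x. l powr (1 / p) * U x)"
  shows "(u, v) \<in> nehari_set s p \<alpha> \<beta> \<gamma>"
    and "energy s p \<alpha> \<beta> \<gamma> (u, v) = s / N * (k + l) * S powr (N / (s * p))"
proof -
  note UW = normalized_minimizer_energy[OF U]
  have B0: "0 < B U" using UW(3) S_pos by simp
  have k: "0 < k" "0 < l"
    and eq: "k powr ((q - p) / p) + \<alpha> * \<gamma> / q * k powr ((\<alpha> - p) / p) * l powr (\<beta> / p) = 1"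
      "l powr ((q - p) / p) + \<beta> * \<gamma> / q * l powr ((\<beta> - p) / p) * k powr (\<alpha> / p) = 1"
    using kl by (auto simp: alg_system_def)
  have W: "u \<in> W" "v \<in> W" and Euv: "E u = k * B U" "E v = l * B U"
    and Buv: "B u = k powr (q / p) * B U" "B v = l powr (q / p) * B U"
    using W_cmult[OF UW(1), of "k powr (1 / p)"] W_cmult[OF UW(1), of "l powr (1 / p)"] UW(2) k p
    by (simp_all add: u_def v_def powr_powr)
  have "\<bar>u x\<bar> powr \<alpha> * \<bar>v x\<bar> powr \<beta> = k powr (\<alpha> / p) * l powr (\<beta> / p) * \<bar>U x\<bar> powr q" for x
    unfolding \<alpha>\<beta>(3)[symmetric] by (simp add: u_def v_def abs_mult powr_mult powr_powr powr_add)
  then have m: "mixed \<alpha> \<beta> u v = k powr (\<alpha> / p) * l powr (\<beta> / p) * B U"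
    by (simp add: mixed_def B_def pint_def)
  have split: "t powr (c / p) = t * t powr ((c - p) / p)" if "0 < t" for t c
  proof -
    have "c / p = 1 + (c - p) / p" using p by (simp add: field_simps)
    then show ?thesis using that by (simp add: powr_add)
  qed
  have "B u + \<alpha> * \<gamma> / q * mixed \<alpha> \<beta> u v
    = k * B U * (k powr ((q - p) / p) + \<alpha> * \<gamma> / q * k powr ((\<alpha> - p) / p) * l powr (\<beta> / p))"
    unfolding Buv m split[OF k(1), of q] split[OF k(1), of \<alpha>] by (simp add: algebra_simps)
  then have 1: "E u = B u + \<alpha> * \<gamma> / q * mixed \<alpha> \<beta> u v" unfolding eq Euv by simp
  have "B v + \<beta> * \<gamma> / q * mixed \<alpha> \<beta> u v
    = l * B U * (l powr ((q - p) / p) + \<beta> * \<gamma> / q * l powr ((\<beta> - p) / p) * k powr (\<alpha> / p))"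
    unfolding Buv m split[OF k(2), of q] split[OF k(2), of \<beta>] by (simp add: algebra_simps)
  then have 2: "E v = B v + \<beta> * \<gamma> / q * mixed \<alpha> \<beta> u v" unfolding eq Euv by simp
  show uv: "(u, v) \<in> nehari_set s p \<alpha> \<beta> \<gamma>"
    unfolding nehari_set_iff using W 1 2 k B0 Buv by simp
  show "energy s p \<alpha> \<beta> \<gamma> (u, v) = s / N * (k + l) * S powr (N / (s * p))"
    unfolding energy_nehari[OF uv] Euv by (simp add: UW(3) distrib_right)
qed

end

end

theorem theorem1p5:
  fixes N :: nat and s p q \<alpha> \<beta> \<gamma> :: real
  assumes N: "N = CARD('n::finite)"
    and s: "0 < s" "s < 1"
    and p: "1 < p" "s * p < real N"
    and q: "q = crit_exp N s p"
    and \<alpha>\<beta>: "1 < \<alpha>" "1 < \<beta>" "\<alpha> + \<beta> = q"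
    and \<gamma>: "0 < \<gamma>"
    and cond:
      "(real N / (2 * s) < p \<and> p < real N / s \<and> p < \<alpha> \<and> p < \<beta> \<and>
        \<gamma> \<le> q * (q - p) / p *
          min (1 / \<alpha> * ((\<alpha> - p) / (\<beta> - p)) powr ((\<beta> - p) / p))
              (1 / \<beta> * ((\<beta> - p) / (\<alpha> - p)) powr ((\<alpha> - p) / p))) \<or>
       (2 * real N / (real N + 2 * s) < p \<and> p < real N / (2 * s) \<and> \<alpha> < p \<and> \<beta> < p \<and>
        q * (q - p) / p *
          max (1 / \<alpha> * ((p - \<beta>) / (p - \<alpha>)) powr ((p - \<beta>) / p))
              (1 / \<beta> * ((p - \<alpha>) / (p - \<beta>)) powr ((p - \<alpha>) / p)) \<le> \<gamma>)"
  shows "(\<exists>k\<^sub>0 l\<^sub>0. min_alg_solution q p \<alpha> \<beta> \<gamma> k\<^sub>0 l\<^sub>0) \<and>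
    (\<exists>U :: real ^ 'n \<Rightarrow> real. normalized_minimizer s p U) \<and>
    (\<forall>k\<^sub>0 l\<^sub>0. min_alg_solution q p \<alpha> \<beta> \<gamma> k\<^sub>0 l\<^sub>0 \<longrightarrow>
       least_energy TYPE('n) s p \<alpha> \<beta> \<gamma> =
         s / real N * (k\<^sub>0 + l\<^sub>0) * sobolev_const TYPE('n) s p powr (real N / (s * p)) \<and>
       (\<forall>U :: real ^ 'n \<Rightarrow> real. normalized_minimizer s p U \<longrightarrow>
          ((\<lambda>x. k\<^sub>0 powr (1 / p) * U x), (\<lambda>x. l\<^sub>0 powr (1 / p) * U x))
            \<in> nehari_set s p \<alpha> \<beta> \<gamma> \<and>
          energy s p \<alpha> \<beta> \<gamma>
            ((\<lambda>x. k\<^sub>0 powr (1 / p) * U x), (\<lambda>x. l\<^sub>0 powr (1 / p) * U x)) =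
          least_energy TYPE('n) s p \<alpha> \<beta> \<gamma>))"
proof -
  interpret frac_sobolev "TYPE('n)" s p "real N" q
    using N s p q by unfold_locales auto
  have pos: "0 < p" "0 < \<alpha>" "0 < \<beta>" "0 < \<gamma>" using p \<alpha>\<beta> \<gamma> by auto
  have cond':
      "(p < \<alpha> \<and> p < \<beta> \<and>
        \<gamma> \<le> q * (q - p) / p *
          min (1 / \<alpha> * ((\<alpha> - p) / (\<beta> - p)) powr ((\<beta> - p) / p))
              (1 / \<beta> * ((\<beta> - p) / (\<alpha> - p)) powr ((\<alpha> - p) / p))) \<or>
       (\<alpha> < p \<and> \<beta> < p \<and>
        q * (q - p) / p *
          max (1 / \<alpha> * ((p - \<beta>) / (p - \<alpha>)) powr ((p - \<beta>) / p))
              (1 / \<beta> * ((p - \<alpha>) / (p - \<beta>)) powr ((p - \<alpha>) / p)) \<le> \<gamma>)"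
    using cond by blast
  obtain U\<^sub>0 :: "real ^ 'n \<Rightarrow> real" where U\<^sub>0: "normalized_minimizer s p U\<^sub>0"
    using ex_normalized_minimizer by blast
  have least: "least_energy TYPE('n) s p \<alpha> \<beta> \<gamma> = s / real N * (k + l) * S powr (real N / (s * p))"
    if kl: "alg_system q p \<alpha> \<beta> \<gamma> k l" for k l
    unfolding least_energy_def
  proof (rule cInf_eq_minimum)
    show "s / real N * (k + l) * S powr (real N / (s * p)) \<in>
      energy s p \<alpha> \<beta> \<gamma> ` (nehari_set s p \<alpha> \<beta> \<gamma> :: ((real ^ 'n \<Rightarrow> real) \<times> (real ^ 'n \<Rightarrow> real)) set)"
      using scaled_pair_in_nehari(1)[OF \<alpha>\<beta> \<gamma> U\<^sub>0 kl]
      unfolding scaled_pair_in_nehari(2)[OF \<alpha>\<beta> \<gamma> U\<^sub>0 kl, symmetric] by (rule imageI)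
    fix e
    assume "e \<in> energy s p \<alpha> \<beta> \<gamma> ` (nehari_set s p \<alpha> \<beta> \<gamma> :: ((real ^ 'n \<Rightarrow> real) \<times> (real ^ 'n \<Rightarrow> real)) set)"
    then obtain u v :: "real ^ 'n \<Rightarrow> real" where uv: "(u, v) \<in> nehari_set s p \<alpha> \<beta> \<gamma>" "e = energy s p \<alpha> \<beta> \<gamma> (u, v)"
      by auto
    show "s / real N * (k + l) * S powr (real N / (s * p)) \<le> e"
      \<comment> \<open>The analytic bound is used with K = k + l; its assumption on K is exactly
        the extremal property of the algebraic system.\<close>
      unfolding uv(2)
      by (rule energy_nehari_ge[OF \<alpha>\<beta> \<gamma> uv(1)])
         (rule alg_system_minimal_sum[OF pos \<alpha>\<beta>(3) q_facts(1) cond' kl])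
  qed
  have "least_energy TYPE('n) s p \<alpha> \<beta> \<gamma> = s / real N * (k + l) * S powr (real N / (s * p)) \<and>
       (\<forall>U :: real ^ 'n \<Rightarrow> real. normalized_minimizer s p U \<longrightarrow>
          ((\<lambda>x. k powr (1 / p) * U x), (\<lambda>x. l powr (1 / p) * U x)) \<in> nehari_set s p \<alpha> \<beta> \<gamma> \<and>
          energy s p \<alpha> \<beta> \<gamma> ((\<lambda>x. k powr (1 / p) * U x), (\<lambda>x. l powr (1 / p) * U x)) =
          least_energy TYPE('n) s p \<alpha> \<beta> \<gamma>)" if "min_alg_solution q p \<alpha> \<beta> \<gamma> k l" for k l
  proof -
    have kl: "alg_system q p \<alpha> \<beta> \<gamma> k l" using that by (simp add: min_alg_solution_def)
    show ?thesis
      unfolding least[OF kl] using scaled_pair_in_nehari[OF \<alpha>\<beta> \<gamma> _ kl] by blast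
  qed
  then show ?thesis
    using min_alg_solution_exists[OF pos \<alpha>\<beta>(3) q_facts(1) cond'] U\<^sub>0 by blast
qed

end
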